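(* Let $a\in\mathbb R^*$, $\psi_a(x)=e^{iax}$, and let $\chi$ be either the trivial or the sign character of $\mathbb R^*$. Then $$C_{\psi_a}(\chi\otimes\gamma_{\psi_a}^{-1},s)=\frac{e^{-\frac{i\pi\chi(-1)\mathrm{sign}(a)}4}\,2^{s-\frac12}}{\pi^s}\frac{L(\chi,s+\frac12)}{L(\chi,-s+\frac12)}\frac{L(\chi^2,-2s+1)}{L(\chi^2,2s)}.$$
   Context: $\gamma_{\psi_a}(y)=1$ if $y>0$ and $-\mathrm{sign}(a)i$ if $y<0$ (normalized Weil index). $L(\mathbf 1,s)=\pi^{-s/2}\Gamma(s/2)$, $L(\mathrm{sign},s)=\pi^{-(s+1)/2}\Gamma((s+1)/2)$. $\overline{SL_2(\mathbb R)}=SL_2(\mathbb R)\times\{\pm1\}$ with Kubota's cocycle $c(g_1,g_2)=(x(g_1),x(g_2))_{\mathbb R}(-x(g_1)x(g_2),x(g_1g_2))_{\mathbb R}$, $x\begin{pmatrix}a&b\\c&d\end{pmatrix}=c$ if $c\ne0$, else $d$, $(\cdot,\cdot)_{\mathbb R}$ the real Hilbert symbol. $I(\chi\otimes\gamma_{\psi_a}^{-1},s)$: smooth $f$ with $f((\begin{pmatrix}t&b\\0&t^{-1}\end{pmatrix},\epsilon)g)=\epsilon|t|^{s+1}\chi(t)\gamma_{\psi_a}^{-1}(t)f(g)$. With $w_0=\begin{pmatrix}0&1\\-1&0\end{pmatrix}$, $n(x)=\begin{pmatrix}1&x\\0&1\end{pmatrix}$: Whittaker functional $\lambda(s,\chi,\psi_a)(f)=\int_{\mathbb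 R}f((w_0n(x),1))\psi_a^{-1}(x)dx$, intertwining operator $A(s)f(g)=\int_{\mathbb R}f((w_0n(x),1)g)dx$ (meromorphic continuations), and $C_{\psi_a}(\chi\otimes\gamma_{\psi_a}^{-1},s)$ is defined by $\lambda(s,\chi,\psi_a)=C\,\lambda(-s,\chi^{-1},\psi_a)\circ A(s)$.
   Formalization: The printed right-hand side is multiplied by |a|^s: right translation by diag(t,1/t) gives C for ψ_{at²} equal to t^{2s} times C for ψ_a, while the printed formula depends only on sign(a), so it fails when |a|≠1; for a=1 and a=−1 the formula is as printed. *)

theory Defs
  imports "HOL-Complex_Analysis.Complex_Analysis"
begin

section \<open>Characters, L-factors and the normalized Weil index\<close>

text \<open>Characters of the multiplicative group of the reals are functions on all reals, vanishing
  at 0. With this convention pointwise products and inverses of characters are again characters.\<close>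

definition triv_char :: "real \<Rightarrow> complex" where
  "triv_char t = (if t = 0 then 0 else 1)"

definition sign_char :: "real \<Rightarrow> complex" where
  "sign_char t = of_real (sgn t)"

text \<open>Only meant for the trivial and the sign character.\<close>

definition L_factor :: "(real \<Rightarrow> complex) \<Rightarrow> complex \<Rightarrow> complex" where
  "L_factor chi s =
     (if chi = triv_char then of_real pi powr (- s / 2) * Gamma (s / 2)
      else of_real pi powr (- (s + 1) / 2) * Gamma ((s + 1) / 2))"

definition psi :: "real \<Rightarrow> real \<Rightarrow> complex" where
  "psi a x = exp (\<i> * of_real (a * x))"

definition weil_index :: "real \<Rightarrow> real \<Rightarrow> complex" where
  "weil_index a y = (if y > 0 then 1 else - of_real (sgn a) * \<i>)"


section \<open>The metaplectic double cover of SL(2,R)\<close>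

definition mat2 :: "real \<Rightarrow> real \<Rightarrow> real \<Rightarrow> real \<Rightarrow> real^2^2" where
  "mat2 a b c d = vector [vector [a, b], vector [c, d]]"

definition hilbert_symbol :: "real \<Rightarrow> real \<Rightarrow> int" where
  "hilbert_symbol a b =
     (if \<exists>x y z. (x, y, z) \<noteq> (0, 0, 0) \<and> z\<^sup>2 = a * x\<^sup>2 + b * y\<^sup>2 then 1 else - 1)"

definition kubota_x :: "real^2^2 \<Rightarrow> real" where
  "kubota_x g = (if g $ 2 $ 1 \<noteq> 0 then g $ 2 $ 1 else g $ 2 $ 2)"

definition kubota_cocycle :: "real^2^2 \<Rightarrow> real^2^2 \<Rightarrow> int" where
  "kubota_cocycle g1 g2 =
     hilbert_symbol (kubota_x g1) (kubota_x g2) *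
     hilbert_symbol (- kubota_x g1 * kubota_x g2) (kubota_x (g1 ** g2))"

type_synonym mp = "(real^2^2) \<times> int"

definition Mp :: "mp set" where
  "Mp = {g. det g = 1} \<times> {1, - 1}"

fun mp_mult :: "mp \<Rightarrow> mp \<Rightarrow> mp" (infixl \<open>\<bullet>\<^sub>M\<close> 70) where
  "(g1, e1) \<bullet>\<^sub>M (g2, e2) = (g1 ** g2, e1 * e2 * kubota_cocycle g1 g2)"

definition upper :: "real \<Rightarrow> real^2^2" where "upper x = mat2 1 x 0 1"
definition lower :: "real \<Rightarrow> real^2^2" where "lower y = mat2 1 0 y 1"
definition torus :: "real \<Rightarrow> real^2^2" where "torus t = mat2 t 0 0 (inverse t)"
definition w0 :: "real^2^2" where "w0 = mat2 0 1 (- 1) 0"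


section \<open>Smooth functions and principal series\<close>

text \<open>Continuous differentiability of order k on an open set.\<close>

fun Ck_on :: "nat \<Rightarrow> ('a::real_normed_vector \<Rightarrow> 'b::real_normed_vector) \<Rightarrow> 'a set \<Rightarrow> bool" where
  "Ck_on 0 f S \<longleftrightarrow> continuous_on S f"
| "Ck_on (Suc k) f S \<longleftrightarrow> (\<forall>x\<in>S. f differentiable at x) \<and>
     (\<forall>v. Ck_on k (\<lambda>x. frechet_derivative f (at x) v) S)"

text \<open>The Lie group structure of the cover is not the product structure of SL(2,R) and the
  discrete group of signs, because the Kubota cocycle is discontinuous. But the maps sending y to
  (lower y, 1), t > 0 to (torus t, 1) and x to (upper x, 1) are homomorphisms into the cover, hence
  they are its smooth one-parameter subgroups lifting those of SL(2,R). So the maps sending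
  (y, t, x) to h (lower y, 1) (torus t, 1) (upper x, 1), for h in the cover, form a smooth atlas.\<close>

definition mp_chart :: "mp \<Rightarrow> real \<times> real \<times> real \<Rightarrow> mp" where
  "mp_chart h = (\<lambda>(y, t, x). h \<bullet>\<^sub>M (lower y, 1) \<bullet>\<^sub>M (torus t, 1) \<bullet>\<^sub>M (upper x, 1))"

definition mp_smooth :: "(mp \<Rightarrow> complex) \<Rightarrow> bool" where
  "mp_smooth f \<longleftrightarrow> (\<forall>h\<in>Mp. \<forall>k. Ck_on k (\<lambda>p. f (mp_chart h p)) (UNIV \<times> {0<..} \<times> UNIV))"

text \<open>The space of the representation induced from the product of a character with the inverse
  of the Weil index. Values of the functions outside the cover are irrelevant.\<close>

definition principal_series :: "real \<Rightarrow> (real \<Rightarrow> complex) \<Rightarrow> complex \<Rightarrow> (mp \<Rightarrow> complex) set" where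
  "principal_series a chi s = {f. mp_smooth f \<and>
     (\<forall>t b. \<forall>\<epsilon>\<in>{1, - 1}. \<forall>g\<in>Mp. t \<noteq> 0 \<longrightarrow>
        f ((mat2 t b 0 (inverse t), \<epsilon>) \<bullet>\<^sub>M g) =
          of_int \<epsilon> * of_real \<bar>t\<bar> powr (s + 1) * chi t * inverse (weil_index a t) * f g)}"


section \<open>Whittaker functional, intertwining operator, local coefficient\<close>

text \<open>The meromorphic continuation to the plane of a function given on the half plane Re s > 0;
  removable singularities are filled in, and the value at a pole is 0.\<close>

definition mero_cont :: "(complex \<Rightarrow> complex) \<Rightarrow> complex \<Rightarrow> complex" where
  "mero_cont F = (THE G. G nicely_meromorphic_on UNIV \<and> (\<forall>s. Re s > 0 \<longrightarrow> G s = F s))"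

text \<open>For f in the principal series at s0, the functions \<open>flat_section s0 f s\<close> form the flat section
  through f: they lie in the principal series at s and agree with f on the preimage of SO(2). In
  the Iwasawa decomposition of a matrix with lower row (c, d), the torus part is torus t up to sign,
  where 1 / t^2 = c^2 + d^2.\<close>

definition flat_section :: "complex \<Rightarrow> (mp \<Rightarrow> complex) \<Rightarrow> complex \<Rightarrow> mp \<Rightarrow> complex" where
  "flat_section s0 f s g =
     f g * of_real ((fst g $ 2 $ 1)\<^sup>2 + (fst g $ 2 $ 2)\<^sup>2) powr ((s0 - s) / 2)"

text \<open>The defining integrals converge absolutely for Re s > 0. At a general point s0 both
  operators are defined by continuation along flat sections; the measure is Lebesgue measure.
  The formula for the Whittaker functional does not involve the inducing character.\<close>

definition whittaker :: "real \<Rightarrow> complex \<Rightarrow> (mp \<Rightarrow> complex) \<Rightarrow> complex" where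
  "whittaker a s0 f =
     mero_cont (\<lambda>s. LINT x|lborel. flat_section s0 f s (w0 ** upper x, 1) * inverse (psi a x)) s0"

definition intertwining :: "complex \<Rightarrow> (mp \<Rightarrow> complex) \<Rightarrow> mp \<Rightarrow> complex" where
  "intertwining s0 f g =
     mero_cont (\<lambda>s. LINT x|lborel. flat_section s0 f s ((w0 ** upper x, 1) \<bullet>\<^sub>M g)) s0"

text \<open>The local coefficient is the meromorphic function C with
  \<open>whittaker a s = C s * (whittaker a (- s) \<circ> intertwining s)\<close> as an identity of meromorphic
  families of functionals, so up to a discrete closed set of s (which contains the poles of the
  intertwining operator and of C).

  Dependence on a: for t > 0, let \<open>f'\<close> be the right translate of f by (torus t, 1). A change of
  variables gives \<open>whittaker a s f' = t powr (1 - s) * whittaker (a * t^2) s f\<close>. As the intertwining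
  operator commutes with right translations, it follows that
  \<open>local_coeff (a * t^2) chi s = t powr (2 * s) * local_coeff a chi s\<close>. This forces a factor
  \<open>\<bar>a\<bar> powr s\<close> in any closed formula; it is 1 for \<open>a = 1\<close> and \<open>a = - 1\<close>.\<close>

definition local_coeff :: "real \<Rightarrow> (real \<Rightarrow> complex) \<Rightarrow> complex \<Rightarrow> complex" where
  "local_coeff a chi = (THE C. C nicely_meromorphic_on UNIV \<and>
     (\<forall>\<^sub>\<approx>s. \<forall>f\<in>principal_series a chi s.
        whittaker a s f = C s * whittaker a (- s) (intertwining s f)))"

end

theory Submission
  imports Defs "HOL-Real_Asymp.Real_Asymp"
begin

text \<open>On the big cell, f in the principal series at s is \<open>f (w0 n(x)) = (1 + x\<^sup>2) powr (- (s + 1) / 2) * h (arccot x)\<close>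
  with h smooth and quasiperiodic of period pi, and flat sections are obtained by fixing h and moving
  s. In these coordinates the intertwining operator is, up to a constant, the convolution of h with
  a power of the sine on a half period, and on the big cell itself it is the convolution of
  \<open>f (w0 n(x))\<close> with a homogeneous function of degree s - 1. Differential recurrences
  (integrations by parts) continue both integrals to entire families, the intertwining operator
  after division by \<open>Gamma s\<close>. For real s in (0, 1), truncating the Whittaker integral to [-R, R] and
  applying Fubini shows that the intertwining operator multiplies the Whittaker functional by the
  conditionally convergent Fourier transform of the homogeneous kernel, a Gamma integral; the
  identity theorem extends this to all s. The duplication and reflection formulas identify the
  inverse of this factor with the quotient of L-factors. Uniqueness of the local coefficient needs
  one function with nonzero Whittaker functional; a vector of weight 1/2 or -1/2 serves.\<close>


section \<open>Differentiation under the integral sign\<close>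

text \<open>The Whittaker functional is applied to the image of the intertwining operator at - s,
  outside its range of absolute convergence. For 0 < s < 1 conditional convergence is left, and this
  forces the truncation. Moreover that image varies with s itself, so holomorphy for one fixed
  function is too weak: the continuation is carried out for functions that are smooth in the angle
  and holomorphic in s, with bounds on every derivative that are uniform in the angle. The
  multiplier of the quasiperiod is - e with e = i chi(-1) sgn(a), the value at -1 of the inducing
  function. As e^2 = -1, no constant h is available, and the simplest test vector has weight 1/2 or
  -1/2. The same e is the weight of the negative half line in the homogeneous kernel. Pulling a
  square root of e out of the transform leaves a single cosine; this square root is the origin of
  the eighth root of unity in the formula. On the cover, smoothness means that the jumps of the
  Kubota cocycle are compensated by those of a branch of the square root. All sign computations
  serve this matching.\<close>

lemma has_vector_derivative_iff_quotient:
  fixes f :: "real \<Rightarrow> complex"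
  shows "(f has_vector_derivative D) (at t0) \<longleftrightarrow> ((\<lambda>t. (f t - f t0) / of_real (t - t0)) \<longlongrightarrow> D) (at t0)"
proof -
  have "(f has_vector_derivative D) (at t0) \<longleftrightarrow>
    ((\<lambda>t. norm (f t - f t0 - (t - t0) *\<^sub>R D) / norm (t - t0)) \<longlongrightarrow> 0) (at t0)"
    by (simp add: has_vector_derivative_def has_derivative_iff_norm bounded_linear_scaleR_left)
  also have "\<dots> \<longleftrightarrow> ((\<lambda>t. norm ((f t - f t0) / of_real (t - t0) - D)) \<longlongrightarrow> 0) (at t0)"
  proof (intro filterlim_cong refl)
    show "eventually (\<lambda>t. norm (f t - f t0 - (t - t0) *\<^sub>R D) / norm (t - t0) =
      norm ((f t - f t0) / of_real (t - t0) - D)) (at t0)"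
      unfolding eventually_at_topological
    proof (intro exI[of _ UNIV] conjI ballI impI)
      fix t assume "t \<noteq> t0"
      then have "(f t - f t0) / of_real (t - t0) - D = (f t - f t0 - (t - t0) *\<^sub>R D) / of_real (t - t0)"
        by (simp add: field_simps scaleR_conv_of_real)
      then show "norm (f t - f t0 - (t - t0) *\<^sub>R D) / norm (t - t0) = norm ((f t - f t0) / of_real (t - t0) - D)"
        by (simp only: norm_divide norm_of_real real_norm_def)
    qed auto
  qed
  also have "\<dots> \<longleftrightarrow> ((\<lambda>t. (f t - f t0) / of_real (t - t0)) \<longlongrightarrow> D) (at t0)"
    by (simp add: tendsto_norm_zero_iff Lim_null[of _ D])
  finally show ?thesis .
qed

text \<open>Convergence at a point of a first countable space can be tested on sequences, where
  dominated convergence applies. The domination is only eventual in the parameter, hence the shift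
  by \<open>N\<close> along each sequence.\<close>

lemma tendsto_integral_at:
  fixes F :: "'p::first_countable_topology \<Rightarrow> 'a \<Rightarrow> 'b::{banach, second_countable_topology}"
  assumes g: "integrable M g"
    and ev: "eventually (\<lambda>p. F p \<in> borel_measurable M \<and> (\<forall>x\<in>space M. norm (F p x) \<le> g x)) (at p0 within S)"
    and G: "G \<in> borel_measurable M"
    and lim: "\<And>x. x \<in> space M \<Longrightarrow> ((\<lambda>p. F p x) \<longlongrightarrow> G x) (at p0 within S)"
  shows "((\<lambda>p. LINT x|M. F p x) \<longlongrightarrow> (LINT x|M. G x)) (at p0 within S)"
proof (unfold tendsto_at_iff_sequentially, safe)
  fix X assume X: "\<forall>i. X i \<in> S - {p0}" "X \<longlonglongrightarrow> p0"
  then have Xlim: "filterlim X (at p0 within S) sequentially"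
    by (auto simp: filterlim_at)
  have "eventually (\<lambda>n. F (X n) \<in> borel_measurable M \<and> (\<forall>x\<in>space M. norm (F (X n) x) \<le> g x)) sequentially"
    using Xlim ev by (auto simp: filterlim_iff)
  then obtain N where N: "\<And>n. n \<ge> N \<Longrightarrow> F (X n) \<in> borel_measurable M"
    "\<And>n x. n \<ge> N \<Longrightarrow> x \<in> space M \<Longrightarrow> norm (F (X n) x) \<le> g x"
    by (auto simp: eventually_sequentially)
  have "(\<lambda>n. LINT x|M. F (X (n + N)) x) \<longlonglongrightarrow> (LINT x|M. G x)"
  proof (rule integral_dominated_convergence[where w = g])
    show "AE x in M. (\<lambda>i. F (X (i + N)) x) \<longlonglongrightarrow> G x"
    proof (rule AE_I2)
      fix x assume "x \<in> space M"
      from filterlim_compose[OF lim[OF this] Xlim]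
      show "(\<lambda>i. F (X (i + N)) x) \<longlonglongrightarrow> G x"
        by (rule LIMSEQ_ignore_initial_segment)
    qed
  qed (use g G N in auto)
  then show "((\<lambda>p. LINT x|M. F p x) \<circ> X) \<longlonglongrightarrow> (LINT x|M. G x)"
    unfolding o_def by (rule LIMSEQ_offset)
qed

text \<open>By the mean value theorem the bound \<open>g\<close> on the derivative also bounds the
  difference quotients, so it dominates them.\<close>

lemma has_vector_derivative_integral:
  fixes f :: "real \<Rightarrow> 'a \<Rightarrow> complex"
  assumes d: "\<And>t x. x \<in> space M \<Longrightarrow> ((\<lambda>t. f t x) has_vector_derivative f' t x) (at t)"
    and f: "\<And>t. integrable M (f t)" and f': "f' t0 \<in> borel_measurable M"
    and g: "integrable M g" "\<And>t x. x \<in> space M \<Longrightarrow> norm (f' t x) \<le> g x"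
  shows "((\<lambda>t. LINT x|M. f t x) has_vector_derivative (LINT x|M. f' t0 x)) (at t0)"
proof -
  have "((\<lambda>t. LINT x|M. (f t x - f t0 x) / of_real (t - t0)) \<longlongrightarrow> (LINT x|M. f' t0 x)) (at t0)"
  proof (rule tendsto_integral_at[OF g(1)])
    show "eventually (\<lambda>t. (\<lambda>x. (f t x - f t0 x) / of_real (t - t0)) \<in> borel_measurable M \<and>
      (\<forall>x\<in>space M. norm ((f t x - f t0 x) / of_real (t - t0)) \<le> g x)) (at t0)"
      unfolding eventually_at_topological
    proof (intro exI[of _ UNIV] conjI ballI impI)
      fix t assume t: "t \<noteq> t0"
      show "(\<lambda>x. (f t x - f t0 x) / of_real (t - t0)) \<in> borel_measurable M"
        using f by (intro borel_measurable_divide borel_measurable_diff) auto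
      fix x assume x: "x \<in> space M"
      have "norm (f t x - f t0 x) \<le> g x * norm (t - t0)"
      proof (rule differentiable_bound[OF convex_UNIV, of "\<lambda>t. f t x" "\<lambda>t h. h *\<^sub>R f' t x" "g x" t t0])
        fix u show "((\<lambda>t. f t x) has_derivative (\<lambda>h. h *\<^sub>R f' u x)) (at u within UNIV)"
          using d[OF x] by (simp add: has_vector_derivative_def)
        show "onorm (\<lambda>h. h *\<^sub>R f' u x) \<le> g x"
          using g(2)[OF x, of u] by (intro onorm_le) (auto simp: mult.commute[of "g x"] mult_left_mono)
      qed auto
      then show "norm ((f t x - f t0 x) / of_real (t - t0)) \<le> g x"
        using t by (simp add: norm_divide field_simps flip: of_real_diff)
    qed auto
    show "((\<lambda>t. (f t x - f t0 x) / of_real (t - t0)) \<longlongrightarrow> f' t0 x) (at t0)" if "x \<in> space M" for x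
      using d[OF that, of t0] by (simp add: has_vector_derivative_iff_quotient)
  qed (use f' in auto)
  also have "(\<lambda>t. LINT x|M. (f t x - f t0 x) / of_real (t - t0)) = (\<lambda>t. ((LINT x|M. f t x) - (LINT x|M. f t0 x)) / of_real (t - t0))"
    using f by (simp add: Bochner_Integration.integral_diff)
  finally show ?thesis
    by (simp add: has_vector_derivative_iff_quotient)
qed

text \<open>Cauchy's inequality on discs of radius \<open>e / 4\<close> around points of the half
  ball bounds the derivative there by \<open>4 * B / e\<close>.\<close>

lemma holomorphic_bound_lipschitz:
  assumes hol: "f holomorphic_on ball s e" and B: "\<And>z. z \<in> ball s e \<Longrightarrow> norm (f z) \<le> B"
    and z: "z \<in> ball s (e / 2)" "w \<in> ball s (e / 2)" 
  shows "norm (f z - f w) \<le> 4 * B / e * norm (z - w)"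
proof -
  have e: "e > 0" using z(1) by (metis dist_not_less_zero less_divide_eq_numeral1(1) mem_ball mult_zero_left order_le_less_trans zero_le_dist)
  show ?thesis
  proof (rule field_differentiable_bound[of "ball s (e / 2)" f "deriv f"])
    fix u assume u: "u \<in> ball s (e / 2)"
    have sub: "cball u (e / 4) \<subseteq> ball s e"
    proof
      fix v assume "v \<in> cball u (e / 4)"
      then show "v \<in> ball s e" using u e dist_triangle[of s v u] by auto
    qed
    have "u \<in> ball s e" using u e by auto
    then show "(f has_field_derivative deriv f u) (at u within ball s (e / 2))"
      using holomorphic_derivI[OF hol open_ball] has_field_derivative_at_within by blast
    have "norm ((deriv ^^ 1) f u) \<le> fact 1 * B / (e / 4) ^ 1"
      using sub e by (intro Cauchy_inequality continuous_on_subset[OF holomorphic_on_imp_continuous_on[OF hol]]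
          holomorphic_on_subset[OF hol] B) (auto simp: dist_norm subset_iff)
    then show "norm (deriv f u) \<le> 4 * B / e" by (simp add: mult.commute)
  qed (use z in auto)
qed

text \<open>Local bounds on the integrand suffice: by \<open>holomorphic_bound_lipschitz\<close>
  they also dominate the difference quotients in \<open>s\<close>.\<close>

lemma holomorphic_on_integral:
  fixes f :: "complex \<Rightarrow> 'a \<Rightarrow> complex"
  assumes U: "open U" and hol: "\<And>x. x \<in> space M \<Longrightarrow> (\<lambda>s. f s x) holomorphic_on U"
    and meas: "\<And>s. s \<in> U \<Longrightarrow> f s \<in> borel_measurable M"
    and bd: "\<And>s. s \<in> U \<Longrightarrow> \<exists>e>0. \<exists>g. integrable M g \<and> (\<forall>s'\<in>ball s e \<inter> U. \<forall>x\<in>space M. norm (f s' x) \<le> g x)"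
  shows "(\<lambda>s. LINT x|M. f s x) holomorphic_on U"
proof (unfold holomorphic_on_open[OF U], intro ballI exI)
  fix s assume s: "s \<in> U"
  obtain e1 g where e1: "e1 > 0" and g: "integrable M g"
    and b1: "\<And>s' x. s' \<in> ball s e1 \<inter> U \<Longrightarrow> x \<in> space M \<Longrightarrow> norm (f s' x) \<le> g x"
    using bd[OF s] by meson
  obtain e2 where e2: "e2 > 0" "ball s e2 \<subseteq> U" using U s openE by blast
  define e where "e = min e1 e2"
  have e: "e > 0" "ball s e \<subseteq> U" "ball s e \<subseteq> ball s e1" using e1 e2 by (auto simp: e_def)
  have b: "norm (f s' x) \<le> g x" if "s' \<in> ball s e" "x \<in> space M" for s' x
    using b1[of s' x] subsetD[OF e(2) that(1)] subsetD[OF e(3) that(1)] that(2) by blast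
  have int: "integrable M (f z)" if "z \<in> ball s e" for z
    by (rule Bochner_Integration.integrable_bound[OF g meas])
       (use b that e in \<open>auto intro!: AE_I2 intro: order_trans[OF _ abs_ge_self]\<close>)
  have d: "((\<lambda>z. (f z x - f s x) / (z - s)) \<longlongrightarrow> deriv (\<lambda>z. f z x) s) (at s)" if "x \<in> space M" for x
    using holomorphic_derivI[OF hol[OF that] U s] by (simp add: has_field_derivative_iff)
  have ev: "eventually (\<lambda>z. z \<in> ball s (e / 2) - {s}) (at s)"
    using e(1) by (intro eventually_at_in_open) auto
  have q: "(\<lambda>x. (f z x - f s x) / (z - s)) \<in> borel_measurable M" if "z \<in> ball s (e/2)" for z
    using int[of z] int[of s] that e by (intro borel_measurable_divide borel_measurable_diff) auto
  have "((\<lambda>z. LINT x|M. (f z x - f s x) / (z - s)) \<longlongrightarrow> (LINT x|M. deriv (\<lambda>z. f z x) s)) (at s)"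
  proof (rule tendsto_integral_at[where g = "\<lambda>x. 4 / e * g x"])
    show "eventually (\<lambda>z. (\<lambda>x. (f z x - f s x) / (z - s)) \<in> borel_measurable M \<and>
      (\<forall>x\<in>space M. norm ((f z x - f s x) / (z - s)) \<le> 4 / e * g x)) (at s)"
      using ev
    proof eventually_elim
      case (elim z)
      have "norm (f z x - f s x) \<le> 4 * g x / e * norm (z - s)" if x: "x \<in> space M" for x
        by (rule holomorphic_bound_lipschitz[where s = s])
           (use e elim b x in \<open>auto intro: holomorphic_on_subset[OF hol[OF x]]\<close>)
      then show ?case using q elim by (auto simp: norm_divide field_simps)
    qed
    \<comment> \<open>The derivative in the parameter is measurable as a pointwise limit of
      difference quotients along this sequence; \<open>n + 2\<close> instead of \<open>n + 1\<close>
      keeps it strictly inside the half ball.\<close>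
    define X where "X n = s + of_real (e / (2 * of_nat (n + 2)))" for n :: nat
    have X: "X n \<in> ball s (e / 2) - {s}" for n
      using e by (auto simp: X_def dist_norm field_simps simp flip: of_real_divide of_real_mult of_real_add intro!: add_pos_nonneg simp del: of_real_mult of_real_divide of_real_add)
    have "X \<longlonglongrightarrow> s + of_real 0"
      unfolding X_def by (intro tendsto_intros) real_asymp
    then have Xlim: "filterlim X (at s) sequentially"
      using X by (auto simp: filterlim_at)
    show "(\<lambda>x. deriv (\<lambda>z. f z x) s) \<in> borel_measurable M"
    proof (rule borel_measurable_LIMSEQ_metric)
      fix i show "(\<lambda>x. (f (X i) x - f s x) / (X i - s)) \<in> borel_measurable M"
        using q X by blast
    next
      fix x assume "x \<in> space M"
      from filterlim_compose[OF d[OF this] Xlim]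
      show "(\<lambda>i. (f (X i) x - f s x) / (X i - s)) \<longlonglongrightarrow> deriv (\<lambda>z. f z x) s" .
    qed
  qed (use g d in auto)
  moreover have "eventually (\<lambda>z. (LINT x|M. (f z x - f s x) / (z - s)) = ((LINT x|M. f z x) - (LINT x|M. f s x)) / (z - s)) (at s)"
    using ev
  proof eventually_elim
    case (elim z)
    then show ?case using int[of z] int[of s] e by simp
  qed
  ultimately have "((\<lambda>z. ((LINT x|M. f z x) - (LINT x|M. f s x)) / (z - s)) \<longlongrightarrow> (LINT x|M. deriv (\<lambda>z. f z x) s)) (at s)"
    by (rule Lim_transform_eventually)
  then show "((\<lambda>s. LINT x|M. f s x) has_field_derivative (LINT x|M. deriv (\<lambda>z. f z x) s)) (at s)"
    by (simp add: has_field_derivative_iff)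
qed

lemma integral_derivative_UNIV:
  fixes F f :: "real \<Rightarrow> complex"
  assumes F: "\<And>x. (F has_vector_derivative f x) (at x)"
    and f: "continuous_on UNIV f" "integrable lborel f"
    and A: "(F \<longlongrightarrow> A) at_bot" and B: "(F \<longlongrightarrow> B) at_top"
  shows "(LINT x|lborel. f x) = B - A"
proof -
  have "(LBINT x=-\<infinity>..\<infinity>. f x) = B - A"
  proof (rule interval_integral_FTC_integrable[where F = F])
    show "((F \<circ> real_of_ereal) \<longlongrightarrow> A) (at_right (- \<infinity>))"
      using A by (simp add: ereal_tendsto_simps)
    show "((F \<circ> real_of_ereal) \<longlongrightarrow> B) (at_left \<infinity>)"
      using B by (simp add: ereal_tendsto_simps)
  qed (use F f in \<open>auto simp: set_integrable_def continuous_on_eq_continuous_at\<close>)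
  then show ?thesis by (simp add: interval_lebesgue_integral_def set_lebesgue_integral_def)
qed

lemma truncated_integral_tendsto:
  fixes f :: "real \<Rightarrow> complex" and A :: "real \<Rightarrow> real set"
  assumes f: "integrable lborel f" and A: "\<And>R. A R \<in> sets borel"
    and ev: "\<And>x. eventually (\<lambda>R. x \<in> A R) at_top"
  shows "((\<lambda>R. LINT x|lborel. indicator (A R) x *\<^sub>R f x) \<longlongrightarrow> (LINT x|lborel. f x)) at_top"
proof (rule integral_dominated_convergence_at_top[where w = "\<lambda>x. norm (f x)"])
  show "AE x in lborel. ((\<lambda>R. indicator (A R) x *\<^sub>R f x) \<longlongrightarrow> f x) at_top"
  proof (rule AE_I2)
    fix x
    show "((\<lambda>R. indicator (A R) x *\<^sub>R f x) \<longlongrightarrow> f x) at_top"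
      by (rule tendsto_eventually) (use ev[of x] in eventually_elim, simp)
  qed
  show "(\<lambda>x. indicator (A R) x *\<^sub>R f x) \<in> borel_measurable lborel" for R
    using f A[of R] by measurable
qed (use f in \<open>auto simp: indicator_def\<close>)


section \<open>Smooth bounded families\<close>

lemma has_vector_derivative_chain_of_real:
  fixes u :: "real \<Rightarrow> real" and g :: "complex \<Rightarrow> complex"
  assumes "(u has_real_derivative u') (at t)" "(g has_field_derivative g') (at (of_real (u t)))"
  shows "((\<lambda>t. g (of_real (u t))) has_vector_derivative of_real u' * g') (at t)"
proof -
  have "((\<lambda>t. complex_of_real (u t)) has_vector_derivative of_real u') (at t)"
    using assms(1) by (intro has_vector_derivative_of_real) (simp add: has_real_derivative_iff_has_vector_derivative)
  from field_vector_diff_chain_at[OF this assms(2)] show ?thesis by (simp add: o_def)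
qed

definition dv :: "(real \<Rightarrow> complex) \<Rightarrow> real \<Rightarrow> complex" where
  "dv h t = vector_derivative h (at t)"

text \<open>The bound is uniform in \<open>t\<close> on the whole line and locally uniform in
  \<open>s\<close>: one constant then dominates the factor \<open>\<Phi> s (t + arccot x)\<close> of
  the integrals below while \<open>s\<close> moves in a small disc.\<close>

definition bounded_family :: "complex set \<Rightarrow> (complex \<Rightarrow> real \<Rightarrow> complex) \<Rightarrow> bool" where
  "bounded_family U \<Phi> \<longleftrightarrow> (\<forall>t. (\<lambda>s. \<Phi> s t) holomorphic_on U) \<and> (\<forall>s\<in>U. continuous_on UNIV (\<Phi> s)) \<and>
     (\<forall>s\<in>U. \<exists>e>0. \<exists>B. \<forall>s'\<in>ball s e \<inter> U. \<forall>t. norm (\<Phi> s' t) \<le> B)"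

text \<open>Derivatives are taken in \<open>t\<close> only, and each of them must again be
  holomorphic in \<open>s\<close> with such bounds, because the shift operators of the recurrences
  differentiate in \<open>t\<close> at every step.\<close>

primrec family_Ck :: "nat \<Rightarrow> complex set \<Rightarrow> (complex \<Rightarrow> real \<Rightarrow> complex) \<Rightarrow> bool" where
  "family_Ck 0 U \<Phi> \<longleftrightarrow> bounded_family U \<Phi>"
| "family_Ck (Suc k) U \<Phi> \<longleftrightarrow> bounded_family U \<Phi> \<and> (\<forall>s\<in>U. \<forall>t. \<Phi> s differentiable at t) \<and>
     family_Ck k U (\<lambda>s. dv (\<Phi> s))"

definition family :: "complex set \<Rightarrow> (complex \<Rightarrow> real \<Rightarrow> complex) \<Rightarrow> bool" where
  "family U \<Phi> \<longleftrightarrow> (\<forall>k. family_Ck k U \<Phi>)"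

lemma bounded_family_cong:
  assumes "\<And>s t. s \<in> U \<Longrightarrow> \<Phi> s t = \<Psi> s t"
  shows "bounded_family U \<Phi> \<longleftrightarrow> bounded_family U \<Psi>"
proof -
  have "\<Phi> s = \<Psi> s" if "s \<in> U" for s using assms that by auto
  then show ?thesis unfolding bounded_family_def
    by (intro conj_cong all_cong1 holomorphic_cong ball_cong ex_cong1 refl) auto
qed

lemma family_Ck_cong:
  assumes "\<And>s t. s \<in> U \<Longrightarrow> \<Phi> s t = \<Psi> s t"
  shows "family_Ck k U \<Phi> \<longleftrightarrow> family_Ck k U \<Psi>"
  using assms
proof (induction k arbitrary: \<Phi> \<Psi>)
  case 0
  then show ?case by (simp add: bounded_family_cong[of U \<Phi> \<Psi>])
next
  case (Suc k)
  have eq: "\<Phi> s = \<Psi> s" if "s \<in> U" for s using Suc.prems that by auto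
  have "family_Ck k U (\<lambda>s. dv (\<Phi> s)) \<longleftrightarrow> family_Ck k U (\<lambda>s. dv (\<Psi> s))"
    by (rule Suc.IH) (simp add: eq)
  then show ?case using bounded_family_cong[of U \<Phi> \<Psi>] Suc.prems eq by simp
qed

lemma family_cong:
  assumes "\<And>s t. s \<in> U \<Longrightarrow> \<Phi> s t = \<Psi> s t"
  shows "family U \<Phi> \<longleftrightarrow> family U \<Psi>"
  using family_Ck_cong[OF assms] by (auto simp: family_def)

lemma family_Ck_bounded: "family_Ck k U \<Phi> \<Longrightarrow> bounded_family U \<Phi>"
  by (cases k) auto

lemma family_Ck_mono: "family_Ck (Suc k) U \<Phi> \<Longrightarrow> family_Ck k U \<Phi>"
  by (induction k arbitrary: \<Phi>) auto

lemma family_Ck_SucI: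
  assumes "bounded_family U \<Phi>" "\<And>s t. s \<in> U \<Longrightarrow> (\<Phi> s has_vector_derivative \<Phi>' s t) (at t)" "family_Ck k U \<Phi>'"
  shows "family_Ck (Suc k) U \<Phi>"
proof -
  have "dv (\<Phi> s) t = \<Phi>' s t" if "s \<in> U" for s t
    using assms(2)[OF that] by (simp add: dv_def vector_derivative_at)
  then show ?thesis
    using assms family_Ck_cong[of U "\<lambda>s. dv (\<Phi> s)" \<Phi>' k]
    by (auto intro: differentiableI_vector[OF assms(2)])
qed

lemma family_bounded: "family U \<Phi> \<Longrightarrow> bounded_family U \<Phi>"
  by (auto simp: family_def intro: family_Ck_bounded)

lemma family_dv: "family U \<Phi> \<Longrightarrow> family U (\<lambda>s. dv (\<Phi> s))"
  unfolding family_def by (metis family_Ck.simps(2))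

lemma family_has_dv: "family U \<Phi> \<Longrightarrow> s \<in> U \<Longrightarrow> (\<Phi> s has_vector_derivative dv (\<Phi> s) t) (at t)"
  unfolding family_def dv_def by (metis family_Ck.simps(2) vector_derivative_works)

lemma bounded_family_scalar:
  assumes "open U" "c holomorphic_on U"
  shows "bounded_family U (\<lambda>s t. c s)"
  unfolding bounded_family_def
proof safe
  fix s assume s: "s \<in> U"
  have "continuous_on U c" using assms(2) by (rule holomorphic_on_imp_continuous_on)
  then obtain e where "e > 0" "\<And>z. z \<in> U \<Longrightarrow> dist z s < e \<Longrightarrow> dist (c z) (c s) < 1"
    using s unfolding continuous_on_iff by (metis zero_less_one)
  moreover have "norm (c z) \<le> norm (c s) + 1" if "dist (c z) (c s) < 1" for z
    using that by norm
  ultimately show "\<exists>e>0. \<exists>B. \<forall>s'\<in>ball s e \<inter> U. \<forall>t::real. norm (c s') \<le> B"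
    by (metis IntE mem_ball dist_commute)
qed (use assms in auto)

lemma bounded_family_mult:
  assumes "bounded_family U \<Phi>" "bounded_family U \<Psi>"
  shows "bounded_family U (\<lambda>s t. \<Phi> s t * \<Psi> s t)"
  unfolding bounded_family_def
proof safe
  fix s assume s: "s \<in> U"
  from assms s obtain e1 B1 e2 B2 where e: "e1 > 0" "e2 > 0" 
    "\<And>s' t. s' \<in> ball s e1 \<inter> U \<Longrightarrow> norm (\<Phi> s' t) \<le> B1" "\<And>s' t. s' \<in> ball s e2 \<inter> U \<Longrightarrow> norm (\<Psi> s' t) \<le> B2"
    unfolding bounded_family_def by meson
  have "norm (\<Phi> s' t * \<Psi> s' t) \<le> B1 * B2" if "s' \<in> ball s (min e1 e2) \<inter> U" for s' t
    unfolding norm_mult using e(3)[of s' t] e(4)[of s' t] that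
    by (intro mult_mono) (auto intro: order_trans[OF norm_ge_zero])
  then show "\<exists>e>0. \<exists>B. \<forall>s'\<in>ball s e \<inter> U. \<forall>t. norm (\<Phi> s' t * \<Psi> s' t) \<le> B"
    using e(1,2) by (intro exI[of _ "min e1 e2"] conjI exI[of _ "B1 * B2"]) auto
qed (use assms in \<open>auto simp: bounded_family_def intro!: holomorphic_intros continuous_intros\<close>)

lemma bounded_family_add:
  assumes "bounded_family U \<Phi>" "bounded_family U \<Psi>"
  shows "bounded_family U (\<lambda>s t. \<Phi> s t + \<Psi> s t)"
  unfolding bounded_family_def
proof safe
  fix s assume s: "s \<in> U"
  from assms s obtain e1 B1 e2 B2 where e: "e1 > 0" "e2 > 0" 
    "\<And>s' t. s' \<in> ball s e1 \<inter> U \<Longrightarrow> norm (\<Phi> s' t) \<le> B1" "\<And>s' t. s' \<in> ball s e2 \<inter> U \<Longrightarrow> norm (\<Psi> s' t) \<le> B2"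
    unfolding bounded_family_def by meson
  have "norm (\<Phi> s' t + \<Psi> s' t) \<le> B1 + B2" if "s' \<in> ball s (min e1 e2) \<inter> U" for s' t
    using e(3)[of s' t] e(4)[of s' t] that by (intro norm_triangle_mono) auto
  then show "\<exists>e>0. \<exists>B. \<forall>s'\<in>ball s e \<inter> U. \<forall>t. norm (\<Phi> s' t + \<Psi> s' t) \<le> B"
    using e(1,2) by (intro exI[of _ "min e1 e2"] conjI exI[of _ "B1 + B2"]) auto
qed (use assms in \<open>auto simp: bounded_family_def intro!: holomorphic_intros continuous_intros\<close>)

lemma family_Ck_add: "family_Ck k U \<Phi> \<Longrightarrow> family_Ck k U \<Psi> \<Longrightarrow> family_Ck k U (\<lambda>s t. \<Phi> s t + \<Psi> s t)"
proof (induction k arbitrary: \<Phi> \<Psi>)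
  case (Suc k)
  show ?case
  proof (rule family_Ck_SucI[where \<Phi>' = "\<lambda>s t. dv (\<Phi> s) t + dv (\<Psi> s) t"])
    fix s t assume s: "s \<in> U"
    then have "(\<Phi> s has_vector_derivative dv (\<Phi> s) t) (at t)" "(\<Psi> s has_vector_derivative dv (\<Psi> s) t) (at t)"
      using Suc.prems unfolding dv_def by (auto simp: vector_derivative_works)
    then show "((\<lambda>t. \<Phi> s t + \<Psi> s t) has_vector_derivative dv (\<Phi> s) t + dv (\<Psi> s) t) (at t)"
      by (rule has_vector_derivative_add)
  qed (use Suc in \<open>auto intro: bounded_family_add\<close>)
qed (auto intro: bounded_family_add)

lemma family_Ck_mult: "family_Ck k U \<Phi> \<Longrightarrow> family_Ck k U \<Psi> \<Longrightarrow> family_Ck k U (\<lambda>s t. \<Phi> s t * \<Psi> s t)"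
proof (induction k arbitrary: \<Phi> \<Psi>)
  case (Suc k)
  show ?case
  proof (rule family_Ck_SucI[where \<Phi>' = "\<lambda>s t. \<Phi> s t * dv (\<Psi> s) t + dv (\<Phi> s) t * \<Psi> s t"])
    fix s t assume s: "s \<in> U"
    then have "(\<Phi> s has_vector_derivative dv (\<Phi> s) t) (at t)" "(\<Psi> s has_vector_derivative dv (\<Psi> s) t) (at t)"
      using Suc.prems unfolding dv_def by (auto simp: vector_derivative_works)
    then show "((\<lambda>t. \<Phi> s t * \<Psi> s t) has_vector_derivative \<Phi> s t * dv (\<Psi> s) t + dv (\<Phi> s) t * \<Psi> s t) (at t)"
      by (rule has_vector_derivative_mult)
  next
    show "family_Ck k U (\<lambda>s t. \<Phi> s t * dv (\<Psi> s) t + dv (\<Phi> s) t * \<Psi> s t)"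
      using Suc.prems family_Ck_mono[OF Suc.prems(1)] family_Ck_mono[OF Suc.prems(2)]
      by (intro family_Ck_add Suc.IH) auto
  qed (use Suc in \<open>auto intro: bounded_family_mult\<close>)
qed (auto intro: bounded_family_mult)

lemma family_add: "family U \<Phi> \<Longrightarrow> family U \<Psi> \<Longrightarrow> family U (\<lambda>s t. \<Phi> s t + \<Psi> s t)"
  and family_mult: "family U \<Phi> \<Longrightarrow> family U \<Psi> \<Longrightarrow> family U (\<lambda>s t. \<Phi> s t * \<Psi> s t)"
  by (auto simp: family_def family_Ck_add family_Ck_mult)

lemma family_scalar:
  assumes "open U" "c holomorphic_on U"
  shows "family U (\<lambda>s t. c s)"
proof -
  have "family_Ck k U (\<lambda>s t. c s)" if "c holomorphic_on U" for k c
    using that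
  proof (induction k arbitrary: c)
    case (Suc k)
    show ?case
      by (rule family_Ck_SucI[where \<Phi>' = "\<lambda>s t. 0"]) 
         (use Suc.IH[of "\<lambda>_. 0"] bounded_family_scalar[OF assms(1) Suc.prems] in auto)
  qed (use bounded_family_scalar[OF assms(1)] in auto)
  then show ?thesis using assms(2) by (simp add: family_def)
qed

lemma family_exp:
  assumes "open U"
  shows "family U (\<lambda>s t. exp (\<i> * of_real (m * t)))"
proof -
  have *: "bounded_family U (\<lambda>s t. exp (\<i> * of_real (m * t)))"
    unfolding bounded_family_def
    by (auto intro!: continuous_intros exI[of _ "1::real"] simp flip: of_real_mult)
  have "family_Ck k U (\<lambda>s t. exp (\<i> * of_real (m * t)))" for k
  proof (induction k)
    case (Suc k)
    show ?case
    proof (rule family_Ck_SucI[where \<Phi>' = "\<lambda>s t. \<i> * of_real m * exp (\<i> * of_real (m * t))", OF *])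
      fix t
      have "((\<lambda>t. exp (\<i> * of_real (m * t))) has_vector_derivative of_real m * (\<i> * exp (\<i> * of_real (m * t)))) (at t)"
        by (rule has_vector_derivative_chain_of_real[where u = "\<lambda>t. m * t" and g = "\<lambda>z. exp (\<i> * z)"])
           (auto intro!: derivative_eq_intros)
      then show "((\<lambda>t. exp (\<i> * of_real (m * t))) has_vector_derivative \<i> * of_real m * exp (\<i> * of_real (m * t))) (at t)"
        by (simp only: mult_ac)
      have "family_Ck k U (\<lambda>s t. \<i> * of_real m)"
        using family_scalar[OF assms, of "\<lambda>_. \<i> * of_real m"] by (simp add: family_def)
      then show "family_Ck k U (\<lambda>s t. \<i> * of_real m * exp (\<i> * of_real (m * t)))"
        by (rule family_Ck_mult) (rule Suc.IH)
    qed
  qed (use * in auto)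
  then show ?thesis by (simp add: family_def)
qed

lemma family_cos:
  assumes "open U"
  shows "family U (\<lambda>s t. of_real (cos t))"
proof -
  have "family U (\<lambda>s t. 1 / 2 * (exp (\<i> * of_real (1 * t)) + exp (\<i> * of_real ((- 1) * t))))"
    using assms by (intro family_mult family_add family_exp family_scalar) auto
  also have "(\<lambda>s t. 1 / 2 * (exp (\<i> * of_real (1 * t)) + exp (\<i> * of_real ((- 1) * t)))) =
    (\<lambda>(s::complex) t. complex_of_real (cos t))"
    by (simp add: cos_exp_eq cos_of_real[symmetric] fun_eq_iff)
  finally show ?thesis .
qed

lemma family_sin:
  assumes "open U"
  shows "family U (\<lambda>s t. of_real (sin t))"
proof -
  have "family U (\<lambda>s t. 1 / (2 * \<i>) * (exp (\<i> * of_real (1 * t)) + (-1) * exp (\<i> * of_real ((- 1) * t))))"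
    using assms by (intro family_mult family_add family_exp family_scalar) auto
  also have "(\<lambda>s t. 1 / (2 * \<i>) * (exp (\<i> * of_real (1 * t)) + (-1) * exp (\<i> * of_real ((- 1) * t)))) =
    (\<lambda>(s::complex) t. complex_of_real (sin t))"
    by (simp add: sin_exp_eq sin_of_real[symmetric] fun_eq_iff)
  finally show ?thesis .
qed

lemma bounded_family_compose:
  assumes "bounded_family U \<Phi>" "g holomorphic_on V" "g ` V \<subseteq> U" 
  shows "bounded_family V (\<lambda>s. \<Phi> (g s))"
  unfolding bounded_family_def
proof safe
  fix t show "(\<lambda>s. \<Phi> (g s) t) holomorphic_on V"
    using assms holomorphic_on_compose_gen[of g V "\<lambda>s. \<Phi> s t" U] by (auto simp: bounded_family_def o_def)
next
  fix s assume s: "s \<in> V"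
  then show "continuous_on UNIV (\<Phi> (g s))" using assms by (auto simp: bounded_family_def)
  obtain e B where e: "e > 0" "\<And>s' t. s' \<in> ball (g s) e \<inter> U \<Longrightarrow> norm (\<Phi> s' t) \<le> B"
    using assms s unfolding bounded_family_def by (metis image_subset_iff)
  obtain d where "d > 0" "\<And>z. z \<in> V \<Longrightarrow> dist z s < d \<Longrightarrow> dist (g z) (g s) < e"
    using holomorphic_on_imp_continuous_on[OF assms(2)] s e(1) unfolding continuous_on_iff by metis
  then show "\<exists>e>0. \<exists>B. \<forall>s'\<in>ball s e \<inter> V. \<forall>t. norm (\<Phi> (g s') t) \<le> B"
    using e(2) assms(3) by (intro exI[of _ d] exI[of _ B] conjI) (auto simp: dist_commute)
qed

text \<open>The reparametrisations that occur are translations, negation, inclusions, and constant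
  maps, which freeze the parameter.\<close>

lemma family_compose:
  assumes "family U \<Phi>" "g holomorphic_on V" "g ` V \<subseteq> U" 
  shows "family V (\<lambda>s. \<Phi> (g s))"
proof -
  have "family_Ck k U \<Phi> \<Longrightarrow> family_Ck k V (\<lambda>s. \<Phi> (g s))" for k
    using assms(2,3)
    by (induction k arbitrary: \<Phi>) (auto intro: bounded_family_compose)
  then show ?thesis using assms(1) by (auto simp: family_def)
qed

lemma family_subset: "family U \<Phi> \<Longrightarrow> V \<subseteq> U \<Longrightarrow> family V \<Phi>"
  using family_compose[of U \<Phi> "\<lambda>s. s" V] by auto

lemma bounded_family_local:
  assumes "\<And>s. s \<in> U \<Longrightarrow> \<exists>V. open V \<and> s \<in> V \<and> bounded_family V \<Phi>"
  shows "bounded_family U \<Phi>"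
  unfolding bounded_family_def
proof safe
  fix t show "(\<lambda>s. \<Phi> s t) holomorphic_on U"
    unfolding holomorphic_on_def
  proof
    fix s assume "s \<in> U"
    then obtain V where V: "open V" "s \<in> V" "(\<lambda>s. \<Phi> s t) holomorphic_on V" 
      using assms unfolding bounded_family_def by meson
    then show "(\<lambda>s. \<Phi> s t) field_differentiable (at s within U)"
      by (meson field_differentiable_at_within holomorphic_on_imp_differentiable_at)
  qed
next
  fix s assume "s \<in> U"
  then obtain V where V: "open V" "s \<in> V" "bounded_family V \<Phi>" using assms by meson
  then show "continuous_on UNIV (\<Phi> s)" by (auto simp: bounded_family_def)
  obtain d where d: "d > 0" "ball s d \<subseteq> V" using V openE by blast
  obtain e B where "e > 0" "\<And>s' t. s' \<in> ball s e \<inter> V \<Longrightarrow> norm (\<Phi> s' t) \<le> B"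
    using V unfolding bounded_family_def by meson
  then show "\<exists>e>0. \<exists>B. \<forall>s'\<in>ball s e \<inter> U. \<forall>t. norm (\<Phi> s' t) \<le> B"
    using d by (intro exI[of _ "min d e"] conjI exI[of _ B]) (auto simp: subset_iff)
qed

text \<open>Glues the continuations built on half planes, on each of which the number of recurrence
  steps is constant.\<close>

lemma family_local:
  assumes "\<And>s. s \<in> U \<Longrightarrow> \<exists>V. open V \<and> s \<in> V \<and> family V \<Phi>"
  shows "family U \<Phi>"
proof -
  have "family_Ck k U \<Phi>" if "\<And>s. s \<in> U \<Longrightarrow> \<exists>V. open V \<and> s \<in> V \<and> family_Ck k V \<Phi>" for k
    using that
  proof (induction k arbitrary: \<Phi>)
    case 0
    then show ?case using bounded_family_local by simp
  next
    case (Suc k)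
    have "bounded_family U \<Phi>"
      by (rule bounded_family_local) (use Suc.prems in \<open>meson family_Ck_bounded\<close>)
    moreover have "\<forall>s\<in>U. \<forall>t. \<Phi> s differentiable at t" using Suc.prems by force
    moreover have "family_Ck k U (\<lambda>s. dv (\<Phi> s))"
      by (rule Suc.IH) (use Suc.prems in force)
    ultimately show ?case by simp
  qed
  then show ?thesis using assms unfolding family_def by meson
qed

text \<open>In the form \<open>family UNIV (\<lambda>_. h)\<close> the notion says that
  \<open>h\<close> is smooth and that \<open>h\<close> and all its derivatives are bounded. This is
  the standing hypothesis on functions of the angle.\<close>

lemma family_const:
  assumes "family UNIV (\<lambda>_. h)" shows "family U (\<lambda>_. h)"
  using family_subset[OF assms] by auto


section \<open>The big cell in angular coordinates\<close>

text \<open>The branch with values between 0 and pi: the big cell becomes an open half period of the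
  angle, with \<open>x\<close> its cotangent.\<close>

definition arccot :: "real \<Rightarrow> real" where
  "arccot x = pi / 2 - arctan x"

text \<open>The power z of the sine of \<open>arccot x\<close>.\<close>

definition sin_pow :: "complex \<Rightarrow> real \<Rightarrow> complex" where
  "sin_pow z x = of_real (1 + x\<^sup>2) powr (- z / 2)"

lemma one_plus_sq_pos: "1 + x\<^sup>2 > (0::real)"
  by (simp add: add_pos_nonneg)

lemma one_plus_sq_nz: "complex_of_real (1 + x\<^sup>2) \<noteq> 0"
  unfolding of_real_eq_0_iff using one_plus_sq_pos[of x] by linarith

lemma one_plus_sq_not_nonpos: "complex_of_real (1 + x\<^sup>2) \<notin> \<real>\<^sub>\<le>\<^sub>0"
  using one_plus_sq_pos[of x] by (simp only: complex_nonpos_Reals_iff Re_complex_of_real Im_complex_of_real) simp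

lemma sin_arccot: "sin (arccot x) = 1 / sqrt (1 + x\<^sup>2)"
  by (simp add: arccot_def sin_diff cos_arctan)

lemma cos_arccot: "cos (arccot x) = x / sqrt (1 + x\<^sup>2)"
  by (simp add: arccot_def cos_diff sin_arctan)

lemma norm_sin_pow: "norm (sin_pow z x) = (1 + x\<^sup>2) powr (- Re z / 2)"
  unfolding sin_pow_def using one_plus_sq_pos[of x] by (subst norm_powr_real_powr) (auto simp: less_imp_le)

lemma sin_pow_add: "sin_pow (z + w) x = sin_pow z x * sin_pow w x"
proof -
  have "- (z + w) / 2 = - z / 2 + - w / 2" by (simp add: field_simps)
  then show ?thesis unfolding sin_pow_def by (simp only: powr_add)
qed

lemma sin_pow_of_real: "sin_pow (of_real c) x = of_real ((1 + x\<^sup>2) powr (- c / 2))"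
proof -
  have "- complex_of_real c / 2 = of_real (- c / 2)" by simp
  then show ?thesis
    unfolding sin_pow_def using one_plus_sq_pos[of x] by (simp only: powr_of_real less_imp_le)
qed

lemma sin_pow_1: "sin_pow 1 x = of_real (sin (arccot x))"
  using sin_pow_of_real[of 1 x] one_plus_sq_pos[of x]
  by (simp add: sin_arccot powr_minus powr_half_sqrt field_simps)

lemma sin_pow_2: "sin_pow 2 x = inverse (of_real (1 + x\<^sup>2))"
  using sin_pow_of_real[of 2 x] one_plus_sq_pos[of x] by (simp add: powr_minus)

lemma holomorphic_sin_pow [holomorphic_intros]:
  assumes "g holomorphic_on U" shows "(\<lambda>s. sin_pow (g s) x) holomorphic_on U"
proof -
  have "(\<lambda>s. exp (- g s / 2 * Ln (of_real (1 + x\<^sup>2)))) holomorphic_on U"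
    by (intro holomorphic_intros assms) auto
  then show ?thesis unfolding sin_pow_def powr_def using one_plus_sq_nz[of x] by simp
qed

text \<open>For \<open>x\<close> the cotangent of an angle, the derivative of the angle in
  \<open>x\<close> is minus the squared sine. Differentiation in \<open>x\<close> therefore raises
  the exponent and improves the decay, which drives both recurrences.\<close>

lemma sin_pow_has_vector_derivative:
  "(sin_pow z has_vector_derivative - z * of_real (cos (arccot x)) * sin_pow (z + 1) x) (at x)"
proof -
  have "((\<lambda>x. of_real (1 + x\<^sup>2) powr (- z / 2)) has_vector_derivative
     of_real (2 * x) * (- z / 2 * of_real (1 + x\<^sup>2) powr (- z / 2 - 1))) (at x)"
    using one_plus_sq_not_nonpos[of x]
    by (intro has_vector_derivative_chain_of_real[where g = "\<lambda>w. w powr (- z / 2)"])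
       (auto intro!: derivative_eq_intros simp del: of_real_add of_real_1)
  also have "of_real (2 * x) * (- z / 2 * of_real (1 + x\<^sup>2) powr (- z / 2 - 1)) = - z * (of_real x * sin_pow (z + 2) x)"
  proof -
    have "- (z + 2) / 2 = - z / 2 - 1" by (simp add: field_simps)
    then show ?thesis unfolding sin_pow_def by (simp only:) simp
  qed
  also have "of_real x * sin_pow (z + 2) x = of_real (x * sin (arccot x)) * sin_pow (z + 1) x"
    using sin_pow_add[of "z + 1" 1 x] by (simp add: sin_pow_1 add.assoc)
  also have "x * sin (arccot x) = cos (arccot x)" by (simp add: sin_arccot cos_arccot)
  finally show ?thesis by (simp add: sin_pow_def[abs_def] mult.assoc)
qed

lemma continuous_on_sin_pow [continuous_intros]: "continuous_on A (sin_pow z)"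
  by (meson sin_pow_has_vector_derivative has_vector_derivative_continuous continuous_at_imp_continuous_on)

lemma arccot_has_derivative: "(arccot has_real_derivative - inverse (1 + x\<^sup>2)) (at x)"
  unfolding arccot_def[abs_def] by (auto intro!: derivative_eq_intros)

lemma continuous_on_arccot [continuous_intros]: "continuous_on A arccot"
  unfolding arccot_def[abs_def] by (intro continuous_intros) 

lemma arccot_chain:
  assumes "(h has_vector_derivative h') (at (t + arccot x))"
  shows "((\<lambda>x. h (t + arccot x)) has_vector_derivative - sin_pow 2 x * h') (at x)"
proof -
  have "((\<lambda>x. t + arccot x) has_vector_derivative - inverse (1 + x\<^sup>2)) (at x)"
    using arccot_has_derivative[of x] unfolding has_real_derivative_iff_has_vector_derivative
    by (auto intro!: derivative_eq_intros)
  from vector_diff_chain_at[OF this, of h h'] assms show ?thesis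
    by (simp add: o_def sin_pow_2 scaleR_conv_of_real)
qed

lemma integrable_one_plus_sq_powr:
  fixes c :: real
  assumes "c > 1"
  shows "integrable lborel (\<lambda>x. (1 + x\<^sup>2) powr (- c / 2))"
proof -
  define h where "h x = indicator {1..} x *\<^sub>R (x powr (- c))" for x :: real
  have "(\<lambda>x. x powr (- c)) integrable_on {1..}"
    using has_integral_powr_to_inf[of "- c" 1] assms by (auto simp: integrable_on_def)
  then have "set_integrable lebesgue {1..} (\<lambda>x. x powr (- c))"
    by (intro nonnegative_absolutely_integrable_1) auto
  then have "integrable lebesgue h" by (simp add: set_integrable_def h_def[abs_def])
  moreover have "h \<in> borel_measurable lborel" unfolding h_def by measurable
  ultimately have h: "integrable lborel h" using integrable_completion by blast
  have h': "integrable lborel (\<lambda>x. h (- x))"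
    using lborel_integrable_real_affine[OF h, of "- 1" 0] by simp
  have i: "integrable lborel (indicator {-1..1} :: real \<Rightarrow> real)" by simp
  show ?thesis
  proof (rule Bochner_Integration.integrable_bound[OF Bochner_Integration.integrable_add[OF i Bochner_Integration.integrable_add[OF h h']]])
    show "(\<lambda>x. (1 + x\<^sup>2) powr (- c / 2)) \<in> borel_measurable lborel" by measurable
    have "(1 + x\<^sup>2) powr (- c / 2) \<le> indicator {-1..1} x + (h x + h (- x))" for x :: real
    proof (cases "\<bar>x\<bar> \<le> 1")
      case True
      have "(1 + x\<^sup>2) powr (- c / 2) \<le> (1 + x\<^sup>2) powr 0"
        using assms by (intro powr_mono) auto
      also have "\<dots> = 1" using one_plus_sq_pos[of x] by simp
      finally show ?thesis using True by (auto simp: h_def indicator_def)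
    next
      case False
      have "(1 + x\<^sup>2) powr (- c / 2) \<le> (x\<^sup>2) powr (- c / 2)"
        using assms False by (intro powr_mono2') auto
      also have "(x\<^sup>2) powr (- c / 2) = (\<bar>x\<bar> powr 2) powr (- c / 2)" using False by (simp add: powr_numeral)
      also have "\<dots> = \<bar>x\<bar> powr (- c)" unfolding powr_powr by simp
      also have "\<dots> \<le> h x + h (- x)" using False by (auto simp: h_def indicator_def)
      finally show ?thesis using False by (simp add: indicator_def)
    qed
    moreover have "h x \<ge> 0" for x by (simp add: h_def)
    ultimately show "AE x in lborel. norm ((1 + x\<^sup>2) powr (- c / 2)) \<le> norm (indicator {-1..1} x + (h x + h (- x)))"
      by (intro AE_I2) (metis abs_of_nonneg order_trans powr_ge_zero real_norm_def)
  qed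
qed

lemma integrable_sin_pow_mult:
  assumes "Re z > 1" "continuous_on UNIV g" "\<And>x. norm (g x) \<le> B"
  shows "integrable lborel (\<lambda>x. sin_pow z x * g x)"
proof (rule Bochner_Integration.integrable_bound[of _ "\<lambda>x. B * (1 + x\<^sup>2) powr (- Re z / 2)"])
  show "integrable lborel (\<lambda>x. B * (1 + x\<^sup>2) powr (- Re z / 2))"
    using integrable_one_plus_sq_powr[OF assms(1)] by simp
  have "continuous_on UNIV (\<lambda>x. sin_pow z x * g x)"
    by (intro continuous_intros assms)
  then show "(\<lambda>x. sin_pow z x * g x) \<in> borel_measurable lborel"
    by (simp add: borel_measurable_continuous_onI)
  show "AE x in lborel. norm (sin_pow z x * g x) \<le> norm (B * (1 + x\<^sup>2) powr (- Re z / 2))"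
    using mult_right_mono[OF order_trans[OF assms(3) abs_ge_self] powr_ge_zero]
    by (intro AE_I2) (simp add: norm_mult norm_sin_pow abs_mult mult.commute)
qed

lemma sin_pow_tendsto_0:
  assumes "Re z > 0"
  shows "(sin_pow z \<longlongrightarrow> 0) at_top" "(sin_pow z \<longlongrightarrow> 0) at_bot"
proof -
  have "((\<lambda>x. (1 + x\<^sup>2) powr (- Re z / 2)) \<longlongrightarrow> 0) at_top" "((\<lambda>x. (1 + x\<^sup>2) powr (- Re z / 2)) \<longlongrightarrow> 0) at_bot"
    using assms by real_asymp+
  then show "(sin_pow z \<longlongrightarrow> 0) at_top" "(sin_pow z \<longlongrightarrow> 0) at_bot"
    by (simp_all add: norm_sin_pow tendsto_norm_zero_iff[of "sin_pow z", symmetric])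
qed

lemma sin_pow_mult_tendsto_0:
  assumes "Re z > 0" "\<And>x. norm (g x) \<le> B"
  shows "((\<lambda>x. sin_pow z x * g x) \<longlongrightarrow> 0) at_top" "((\<lambda>x. sin_pow z x * g x) \<longlongrightarrow> 0) at_bot"
proof -
  have "((\<lambda>x. norm (sin_pow z x) * B) \<longlongrightarrow> 0) at_top" "((\<lambda>x. norm (sin_pow z x) * B) \<longlongrightarrow> 0) at_bot"
    using sin_pow_tendsto_0[OF assms(1)] by (auto intro!: tendsto_eq_intros)
  then show "((\<lambda>x. sin_pow z x * g x) \<longlongrightarrow> 0) at_top" "((\<lambda>x. sin_pow z x * g x) \<longlongrightarrow> 0) at_bot"
    by - (rule Lim_null_comparison[rotated], assumption, simp add: norm_mult assms(2) mult_left_mono)+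
qed

lemma bounded_family_bound:
  assumes "bounded_family U \<Phi>" "s \<in> U"
  obtains B where "\<And>t. norm (\<Phi> s t) \<le> B"
  using assms unfolding bounded_family_def by (metis IntI centre_in_ball)

lemma norm_sin_pow_le:
  assumes "Re z \<ge> c"
  shows "norm (sin_pow z x) \<le> (1 + x\<^sup>2) powr (- c / 2)"
  unfolding norm_sin_pow using assms by (intro powr_mono) auto

text \<open>Covers both integrals: \<open>K\<close> is 1 for the intertwining integral and
  \<open>inverse (psi a x)\<close> for the Whittaker integral.\<close>

lemma holomorphic_kernel_integral:
  assumes U: "open U" and pos: "\<And>s. s \<in> U \<Longrightarrow> Re s > 0" and \<Phi>: "bounded_family U \<Phi>"
    and K: "continuous_on UNIV K" "\<And>x. norm (K x) \<le> 1"
  shows "(\<lambda>s. LINT x|lborel. sin_pow (s + 1) x * (K x * \<Phi> s (t + arccot x))) holomorphic_on U"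
proof (rule holomorphic_on_integral[OF U])
  fix x show "(\<lambda>s. sin_pow (s + 1) x * (K x * \<Phi> s (t + arccot x))) holomorphic_on U"
    using \<Phi> by (intro holomorphic_intros) (auto simp: bounded_family_def)
next
  fix s assume s: "s \<in> U"
  then have "continuous_on UNIV (\<Phi> s)" using \<Phi> by (auto simp: bounded_family_def)
  then have "continuous_on UNIV (\<lambda>x. sin_pow (s + 1) x * (K x * \<Phi> s (t + arccot x)))"
    by (intro continuous_intros K continuous_on_compose2[of UNIV "\<Phi> s" UNIV "\<lambda>x. t + arccot x"]) auto
  then show "(\<lambda>x. sin_pow (s + 1) x * (K x * \<Phi> s (t + arccot x))) \<in> borel_measurable lborel"
    by (simp add: borel_measurable_continuous_onI)
  obtain e B where e: "e > 0" "\<And>s' t. s' \<in> ball s e \<inter> U \<Longrightarrow> norm (\<Phi> s' t) \<le> B"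
    using \<Phi> s unfolding bounded_family_def by meson
  \<comment> \<open>Half the distance to the line Re s = 0: within this radius the exponents have
    real part at least \<open>c + 1\<close>, so one integrable power of \<open>1 + x\<^sup>2\<close>
    dominates.\<close>
  define c where "c = Re s / 2"
  define d where "d = min e c"
  have d: "d > 0" "d \<le> e" "d \<le> c" "c > 0" using e pos[OF s] by (auto simp: d_def c_def)
  show "\<exists>e>0. \<exists>g. integrable lborel g \<and> (\<forall>s'\<in>ball s e \<inter> U. \<forall>x\<in>space lborel. norm (sin_pow (s' + 1) x * (K x * \<Phi> s' (t + arccot x))) \<le> g x)"
  proof (intro exI[of _ d] conjI exI[of _ "\<lambda>x. (1 + x\<^sup>2) powr (- (c + 1) / 2) * (1 * B)"] ballI)
    show "integrable lborel (\<lambda>x. (1 + x\<^sup>2) powr (- (c + 1) / 2) * (1 * B))"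
      using integrable_one_plus_sq_powr[of "c + 1"] d by simp
    fix s' x assume s': "s' \<in> ball s d \<inter> U"
    have "\<bar>Re s - Re s'\<bar> < c" using s' d abs_Re_le_cmod[of "s - s'"] by (auto simp: dist_norm)
    then have "Re (s' + 1) \<ge> c + 1" unfolding c_def plus_complex.sel one_complex.sel by arith
    then have "norm (sin_pow (s' + 1) x) \<le> (1 + x\<^sup>2) powr (- (c + 1) / 2)" by (rule norm_sin_pow_le)
    moreover have "norm (\<Phi> s' (t + arccot x)) \<le> B" using s' d e by auto
    ultimately show "norm (sin_pow (s' + 1) x * (K x * \<Phi> s' (t + arccot x))) \<le> (1 + x\<^sup>2) powr (- (c + 1) / 2) * (1 * B)"
      unfolding norm_mult by (intro mult_mono K(2)) (auto intro: order_trans[OF norm_ge_zero])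
  qed (use d in auto)
qed

section \<open>The two integrals in angular coordinates and their recurrences\<close>

lemma continuous_arccot_compose:
  "continuous_on UNIV h \<Longrightarrow> continuous_on UNIV (\<lambda>x. h (t + arccot x))"
  by (rule continuous_on_compose2[of UNIV h UNIV "\<lambda>x. t + arccot x"]) (auto intro: continuous_intros)

text \<open>In the angle \<theta> this is the integral over (0, pi) of the power
  \<open>s - 1\<close> of the sine against \<open>h (t + \<theta>)\<close>: the change from
  \<open>x\<close> to the angle costs two powers of the sine.\<close>

definition intertwining_integral :: "complex \<Rightarrow> (real \<Rightarrow> complex) \<Rightarrow> real \<Rightarrow> complex" where
  "intertwining_integral s h t = (LINT x|lborel. sin_pow (s + 1) x * h (t + arccot x))"

definition whittaker_integral :: "real \<Rightarrow> complex \<Rightarrow> (real \<Rightarrow> complex) \<Rightarrow> complex" where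
  "whittaker_integral a s h = (LINT x|lborel. sin_pow (s + 1) x * (inverse (psi a x) * h (arccot x)))"

text \<open>From \<open>s * (s + 1) * sin\<^sup>s\<^sup>-\<^sup>1 = (D\<^sup>2 + (s + 1)\<^sup>2) sin\<^sup>s\<^sup>+\<^sup>1\<close>.\<close>

definition intertwining_shift :: "complex \<Rightarrow> (real \<Rightarrow> complex) \<Rightarrow> real \<Rightarrow> complex" where
  "intertwining_shift s h t = dv (dv h) t + (s + 1)\<^sup>2 * h t"

text \<open>From the derivative of \<open>sin\<^sup>s\<^sup>+\<^sup>1 * h\<close> with respect to the cotangent.\<close>

definition whittaker_shift :: "complex \<Rightarrow> (real \<Rightarrow> complex) \<Rightarrow> real \<Rightarrow> complex" where
  "whittaker_shift s h t = - 1 * (of_real (sin t) * dv h t + (s + 1) * (of_real (cos t) * h t))"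

lemma inverse_psi: "inverse (psi a x) = exp (- (\<i> * of_real (a * x)))"
  by (simp add: psi_def exp_minus)

lemma norm_inverse_psi [simp]: "norm (inverse (psi a x)) = 1"
  by (simp add: psi_def norm_inverse flip: of_real_mult)

lemma continuous_on_inverse_psi: "continuous_on A (\<lambda>x. inverse (psi a x))"
  unfolding inverse_psi by (intro continuous_intros)

lemma inverse_psi_has_vector_derivative:
  "((\<lambda>x. inverse (psi a x)) has_vector_derivative - (\<i> * of_real a) * inverse (psi a x)) (at x)"
proof -
  have "((\<lambda>x. exp (- (\<i> * of_real (a * x)))) has_vector_derivative of_real a * (- \<i> * exp (- (\<i> * of_real (a * x))))) (at x)"
    by (rule has_vector_derivative_chain_of_real[where u = "\<lambda>x. a * x" and g = "\<lambda>z. exp (- (\<i> * z))"])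
       (auto intro!: derivative_eq_intros)
  moreover have "of_real a * (- \<i> * exp (- (\<i> * of_real (a * x)))) = - (\<i> * of_real a) * inverse (psi a x)"
    unfolding inverse_psi by (simp only: mult_ac mult_minus_left mult_minus_right)
  ultimately show ?thesis unfolding inverse_psi by (simp only:)
qed

lemma family_intertwining_shift:
  "open U \<Longrightarrow> c holomorphic_on U \<Longrightarrow> family U \<Phi> \<Longrightarrow> family U (\<lambda>s. intertwining_shift (c s) (\<Phi> s))"
  unfolding intertwining_shift_def[abs_def]
  by (intro family_add family_mult family_dv family_scalar holomorphic_intros)

lemma family_whittaker_shift:
  "open U \<Longrightarrow> c holomorphic_on U \<Longrightarrow> family U \<Phi> \<Longrightarrow> family U (\<lambda>s. whittaker_shift (c s) (\<Phi> s))"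
  unfolding whittaker_shift_def[abs_def]
  by (intro family_add family_mult family_dv family_scalar family_sin family_cos holomorphic_intros)

lemma family_const_bound:
  assumes "family UNIV (\<lambda>_. h)"
  obtains B where "\<And>t. norm (h t) \<le> B" 
  using bounded_family_bound[OF family_bounded[OF assms], of 0] by auto

lemma family_const_continuous:
  assumes "family UNIV (\<lambda>_. h)" shows "continuous_on UNIV h"
  using family_bounded[OF assms] by (auto simp: bounded_family_def)

text \<open>Kept pointwise because it is integrated twice: over the whole line for Re s > 0, and
  over bounded intervals at a negative real parameter in \<open>truncated_whittaker_tendsto\<close>,
  where the integrand itself need not be absolutely integrable.\<close>

lemma whittaker_integrand_has_vector_derivative:
  assumes h: "family UNIV (\<lambda>_. h)"
  shows "((\<lambda>x. sin_pow (s + 1) x * (inverse (psi a x) * h (arccot x))) has_vector_derivative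
    sin_pow (s + 1 + 1) x * (inverse (psi a x) * whittaker_shift s h (arccot x))
      - \<i> * of_real a * (sin_pow (s + 1) x * (inverse (psi a x) * h (arccot x)))) (at x)"
proof -
  have hd: "((\<lambda>x. h (arccot x)) has_vector_derivative - sin_pow 2 x * dv h (arccot x)) (at x)"
    using arccot_chain[of h "dv h (arccot x)" 0 x] family_has_dv[OF h, of 0] by simp
  have e1: "sin_pow (s + 1 + 1) x = sin_pow (s + 1) x * of_real (sin (arccot x))"
    by (simp only: sin_pow_add[of "s + 1" 1] sin_pow_1)
  have e2: "sin_pow 2 x = of_real (sin (arccot x)) * of_real (sin (arccot x))"
    using sin_pow_add[of 1 1 x] by (simp add: sin_pow_1)
  define S C :: complex where "S = of_real (sin (arccot x))" and "C = of_real (cos (arccot x))"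
  have key: "p * (e * (- (S * S) * h1) + - (\<i> * of_real a) * e * h0) + - (s + 1) * C * (p * S) * (e * h0)
    = p * S * (e * (- 1 * (S * h1 + (s + 1) * (C * h0)))) - \<i> * of_real a * (p * (e * h0))" for p e h0 h1
    by (simp add: algebra_simps)
  show ?thesis
    by (rule has_vector_derivative_eq_rhs, rule has_vector_derivative_mult[OF sin_pow_has_vector_derivative
        has_vector_derivative_mult[OF inverse_psi_has_vector_derivative hd]])
       (simp only: whittaker_shift_def e1 e2 S_def[symmetric] C_def[symmetric] key)
qed

text \<open>The integrand vanishes at both ends, so its derivative integrates to 0. The oscillation
  of the character thus buys one more power of decay, at the price of a division by
  \<open>\<i> * of_real a\<close>.\<close>

lemma whittaker_integral_recurrence:
  assumes s: "Re s > 0" and a: "a \<noteq> 0" and h: "family UNIV (\<lambda>_. h)"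
  shows "whittaker_integral a s h = inverse (\<i> * of_real a) * whittaker_integral a (s + 1) (whittaker_shift s h)"
proof -
  let ?e = "\<lambda>x. inverse (psi a x)"
  define F where "F x = sin_pow (s + 1) x * (?e x * h (arccot x))" for x
  define G where "G x = sin_pow (s + 1 + 1) x * (?e x * whittaker_shift s h (arccot x))" for x
  have h': "family UNIV (\<lambda>_. whittaker_shift s h)"
    using family_whittaker_shift[OF open_UNIV _ h, of "\<lambda>_. s"] by simp
  have int: "integrable lborel (\<lambda>x. sin_pow (z + 1) x * (?e x * k (arccot x)))" 
    if z: "Re z > 0" and k: "family UNIV (\<lambda>_. k)" for z k
  proof -
    obtain B where "\<And>t. norm (k t) \<le> B" using family_const_bound[OF k] by blast
    then show ?thesis using z continuous_arccot_compose[OF family_const_continuous[OF k], of 0]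
      by (intro integrable_sin_pow_mult[of _ _ B]) (auto simp: norm_mult intro!: continuous_intros continuous_on_inverse_psi)
  qed
  have F: "integrable lborel F" and G: "integrable lborel G"
    using int[OF s h] int[of "s + 1", OF _ h'] s by (simp_all add: F_def[abs_def] G_def[abs_def])
  have der: "(F has_vector_derivative G x - \<i> * of_real a * F x) (at x)" for x
    using whittaker_integrand_has_vector_derivative[OF h, of s a x] by (simp only: F_def[abs_def] G_def)
  obtain B where B: "\<And>t. norm (h t) \<le> B" using family_const_bound[OF h] by blast
  have lim: "(F \<longlongrightarrow> 0) at_bot" "(F \<longlongrightarrow> 0) at_top"
    unfolding F_def[abs_def] using s B
    by (intro sin_pow_mult_tendsto_0[where B = B]; simp add: norm_mult)+
  have cont: "continuous_on UNIV (\<lambda>x. G x - \<i> * of_real a * F x)"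
    unfolding F_def G_def 
    using continuous_arccot_compose[OF family_const_continuous[OF h], of 0] 
      continuous_arccot_compose[OF family_const_continuous[OF h'], of 0]
    by (intro continuous_intros continuous_on_inverse_psi) auto
  have "(LINT x|lborel. G x - \<i> * of_real a * F x) = 0 - 0"
    using F G by (intro integral_derivative_UNIV[OF der cont _ lim]) auto
  then have "(LINT x|lborel. G x) = \<i> * of_real a * (LINT x|lborel. F x)"
    using F G by simp
  then show ?thesis using a unfolding whittaker_integral_def F_def G_def by (simp add: field_simps)
qed

lemma integrable_intertwining:
  assumes "Re s > 0" "family UNIV (\<lambda>_. h)"
  shows "integrable lborel (\<lambda>x. sin_pow (s + 1) x * h (t + arccot x))"
proof -
  obtain B where "\<And>t. norm (h t) \<le> B" using family_const_bound[OF assms(2)] by blast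
  then show ?thesis using assms continuous_arccot_compose[OF family_const_continuous[OF assms(2)]]
    by (intro integrable_sin_pow_mult[of _ _ B]) auto
qed

text \<open>Green's identity on the half period: the operator D^2 + (s + 1)^2 may act on the power
  of the sine, where it lowers the exponent by 2, or on \<open>h\<close>.\<close>

lemma intertwining_integral_recurrence:
  assumes s: "Re s > 0" and h: "family UNIV (\<lambda>_. h)"
  shows "s * (s + 1) * intertwining_integral s h t = intertwining_integral (s + 2) (intertwining_shift s h) t"
proof -
  \<comment> \<open>In the angular variable this is the bracket u h' - u' h of Green's identity,
    with u the power \<open>s + 1\<close> of the sine. It vanishes at both ends of the half period
    because Re s > 0.\<close>
  define F where "F x = sin_pow (s + 1) x * dv h (t + arccot x) 
      - (s + 1) * of_real (cos (arccot x)) * (sin_pow s x * h (t + arccot x))" for x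
  define G where "G x = s * (s + 1) * (sin_pow (s + 1) x * h (t + arccot x))
     - sin_pow (s + 2 + 1) x * intertwining_shift s h (t + arccot x)" for x
  have h': "family UNIV (\<lambda>_. intertwining_shift s h)"
    using family_intertwining_shift[OF open_UNIV _ h, of "\<lambda>_. s"] by simp
  have i: "integrable lborel (\<lambda>x. sin_pow (s + 1) x * h (t + arccot x))"
     "integrable lborel (\<lambda>x. sin_pow (s + 2 + 1) x * intertwining_shift s h (t + arccot x))"
    using integrable_intertwining[OF s h] integrable_intertwining[OF _ h', of "s + 2"] s by auto
  have G: "integrable lborel G"
    unfolding G_def using i by auto
  have der: "(F has_vector_derivative G x) (at x)" for x
  proof -
    have hd: "((\<lambda>x. h (t + arccot x)) has_vector_derivative - sin_pow 2 x * dv h (t + arccot x)) (at x)"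
      using arccot_chain[of h "dv h (t + arccot x)" t x] family_has_dv[OF h, of 0] by simp
    have hdd: "((\<lambda>x. dv h (t + arccot x)) has_vector_derivative - sin_pow 2 x * dv (dv h) (t + arccot x)) (at x)"
      using arccot_chain[of "dv h" "dv (dv h) (t + arccot x)" t x] family_has_dv[OF family_dv[OF h], of 0] by simp
    have c: "((\<lambda>x. complex_of_real (cos (arccot x))) has_vector_derivative sin_pow 2 x * of_real (sin (arccot x))) (at x)"
    proof -
      have "((\<lambda>x. cos (arccot x)) has_real_derivative inverse (1 + x\<^sup>2) * sin (arccot x)) (at x)"
        using DERIV_chain2[OF DERIV_cos arccot_has_derivative, of x] by (simp add: mult.commute)
      then have "((\<lambda>x. cos (arccot x)) has_vector_derivative inverse (1 + x\<^sup>2) * sin (arccot x)) (at x)"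
        by (simp add: has_real_derivative_iff_has_vector_derivative)
      from has_vector_derivative_of_real[OF this[folded has_real_derivative_iff_has_vector_derivative], where 'a = complex] show ?thesis by (simp add: sin_pow_2)
    qed
    have e: "sin_pow 2 x = of_real (sin (arccot x)) * of_real (sin (arccot x))"
       "sin_pow (s + 1) x = sin_pow s x * of_real (sin (arccot x))"
       "sin_pow (s + 1 + 1) x = sin_pow s x * of_real (sin (arccot x)) * of_real (sin (arccot x))"
       "sin_pow (s + 2 + 1) x = sin_pow s x * of_real (sin (arccot x)) * of_real (sin (arccot x)) * of_real (sin (arccot x))"
    proof -
      show e1: "sin_pow 2 x = of_real (sin (arccot x)) * of_real (sin (arccot x))"
        using sin_pow_add[of 1 1 x] by (simp add: sin_pow_1)
      show "sin_pow (s + 1) x = sin_pow s x * of_real (sin (arccot x))"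
        by (simp only: sin_pow_add[of s 1] sin_pow_1)
      show "sin_pow (s + 1 + 1) x = sin_pow s x * of_real (sin (arccot x)) * of_real (sin (arccot x))"
        by (simp only: sin_pow_add[of "s + 1" 1] sin_pow_add[of s 1] sin_pow_1)
      show "sin_pow (s + 2 + 1) x = sin_pow s x * of_real (sin (arccot x)) * of_real (sin (arccot x)) * of_real (sin (arccot x))"
        by (simp only: sin_pow_add[of "s + 2" 1] sin_pow_add[of s 2] sin_pow_1 e1 mult.assoc)
    qed
    define S C :: complex where "S = of_real (sin (arccot x))" and "C = of_real (cos (arccot x))"
    have SC: "C * C + S * S = 1"
      unfolding S_def C_def using sin_cos_squared_add2[of "arccot x"]
      by (simp add: power2_eq_square flip: of_real_mult of_real_add)
    have key: "p * S * (- (S * S) * h2) + - (s + 1) * C * (p * S * S) * h1 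
        - ((s + 1) * C * (p * (- (S * S) * h1) + - s * C * (p * S) * h0) + ((s + 1) * (S * S * S) + 0 * C) * (p * h0))
        = s * (s + 1) * (p * S * h0) - p * S * S * S * (h2 + (s + 1)\<^sup>2 * h0)" for p h0 h1 h2
      using SC by algebra
    show ?thesis unfolding F_def[abs_def]
      by (rule has_vector_derivative_eq_rhs, rule has_vector_derivative_diff[OF has_vector_derivative_mult[OF sin_pow_has_vector_derivative hdd]
          has_vector_derivative_mult[OF has_vector_derivative_mult[OF has_vector_derivative_const c]
            has_vector_derivative_mult[OF sin_pow_has_vector_derivative hd]]])
         (simp only: G_def intertwining_shift_def e S_def[symmetric] C_def[symmetric] key)
  qed
  obtain B where B: "\<And>t. norm (h t) \<le> B" using family_const_bound[OF h] by blast
  obtain B' where B': "\<And>t. norm (dv h t) \<le> B'" using family_const_bound[OF family_dv[OF h]] by blast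
  have B0: "B \<ge> 0" using B[of 0] norm_ge_zero order_trans by blast
  have F_eq: "F = (\<lambda>x. sin_pow (s + 1) x * dv h (t + arccot x) 
      - (s + 1) * (sin_pow s x * (of_real (cos (arccot x)) * h (t + arccot x))))"
    by (auto simp: F_def)
  have bd: "norm (of_real (cos (arccot x)) * h (t + arccot x)) \<le> 1 * B" for x
    unfolding norm_mult using B by (intro mult_mono) auto
  have lim: "(F \<longlongrightarrow> 0 - (s + 1) * 0) at_bot" "(F \<longlongrightarrow> 0 - (s + 1) * 0) at_top"
    unfolding F_eq using s B' bd
    by (intro tendsto_diff tendsto_mult_left sin_pow_mult_tendsto_0[where B = B'] sin_pow_mult_tendsto_0[where B = "1 * B"]; simp)+
  have cont: "continuous_on UNIV G"
    unfolding G_def 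
    using continuous_arccot_compose[OF family_const_continuous[OF h]] 
      continuous_arccot_compose[OF family_const_continuous[OF h']]
    by (intro continuous_intros) auto
  have "(LINT x|lborel. G x) = 0"
    using integral_derivative_UNIV[OF der cont G lim] by simp
  then show ?thesis using i by (simp add: G_def intertwining_integral_def)
qed

text \<open>The integral is a convolution in \<open>t\<close>, so differentiation in
  \<open>t\<close> passes to \<open>\<Phi>\<close> and each derivative is an integral of the same
  kind.\<close>

lemma family_intertwining_integral:
  assumes U: "open U" and pos: "\<And>s. s \<in> U \<Longrightarrow> Re s > 0" and \<Phi>: "family U \<Phi>"
  shows "family U (\<lambda>s. intertwining_integral s (\<Phi> s))"
proof -
  have int: "integrable lborel (\<lambda>x. sin_pow (s + 1) x * \<Psi> s (t + arccot x))" 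
    if \<Psi>: "family U \<Psi>" and s: "s \<in> U" for s t \<Psi>
  proof -
    obtain B where "\<And>t. norm (\<Psi> s t) \<le> B" using bounded_family_bound[OF family_bounded[OF \<Psi>] s] by meson
    moreover have "continuous_on UNIV (\<Psi> s)" using family_bounded[OF \<Psi>] s by (auto simp: bounded_family_def)
    ultimately show ?thesis using pos[OF s] continuous_arccot_compose[of "\<Psi> s"]
      by (intro integrable_sin_pow_mult[of _ _ B]) auto
  qed
  have d: "(intertwining_integral s (\<Psi> s) has_vector_derivative intertwining_integral s (dv (\<Psi> s)) t) (at t)"
    if \<Psi>: "family U \<Psi>" and s: "s \<in> U" for \<Psi> s t
  proof -
    obtain B where B: "\<And>t. norm (dv (\<Psi> s) t) \<le> B"
      using bounded_family_bound[OF family_bounded[OF family_dv[OF \<Psi>]] s] by meson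
    show ?thesis unfolding intertwining_integral_def[abs_def]
    proof (rule has_vector_derivative_integral)
      fix t x
      have "((\<lambda>t. \<Psi> s (t + arccot x)) has_vector_derivative dv (\<Psi> s) (t + arccot x)) (at t)"
        using vector_diff_chain_at[OF has_vector_derivative_add[OF has_vector_derivative_id has_vector_derivative_const]
            family_has_dv[OF \<Psi> s], of "arccot x" t]
        by (simp add: o_def)
      then show "((\<lambda>t. sin_pow (s + 1) x * \<Psi> s (t + arccot x)) has_vector_derivative sin_pow (s + 1) x * dv (\<Psi> s) (t + arccot x)) (at t)"
        by (rule has_vector_derivative_mult_right)
      show "norm (sin_pow (s + 1) x * dv (\<Psi> s) (t + arccot x)) \<le> (1 + x\<^sup>2) powr (- (Re s + 1) / 2) * B"
        using B by (simp add: norm_mult norm_sin_pow mult_left_mono)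
    next
      show "integrable lborel (\<lambda>x. (1 + x\<^sup>2) powr (- (Re s + 1) / 2) * B)"
        using integrable_one_plus_sq_powr[of "Re s + 1"] pos[OF s] by simp
    qed (use int[OF \<Psi> s] int[OF family_dv[OF \<Psi>] s] in auto)
  qed
  have b: "bounded_family U (\<lambda>s. intertwining_integral s (\<Psi> s))" if \<Psi>: "family U \<Psi>" for \<Psi>
    unfolding bounded_family_def
  proof (intro conjI allI ballI)
    fix t show "(\<lambda>s. intertwining_integral s (\<Psi> s) t) holomorphic_on U"
      using holomorphic_kernel_integral[OF U pos family_bounded[OF \<Psi>], of "\<lambda>_. 1" t]
      by (simp add: intertwining_integral_def)
  next
    fix s assume s: "s \<in> U"
    show "continuous_on UNIV (intertwining_integral s (\<Psi> s))"
      using d[OF \<Psi> s] by (meson has_vector_derivative_continuous continuous_at_imp_continuous_on)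
    obtain e B where e: "e > 0" "\<And>s' t. s' \<in> ball s e \<inter> U \<Longrightarrow> norm (\<Psi> s' t) \<le> B"
      using family_bounded[OF \<Psi>] s unfolding bounded_family_def by meson
    define c where "c = Re s / 2"
    have c: "c > 0" using pos[OF s] by (simp add: c_def)
    have "\<forall>s'\<in>ball s (min e c) \<inter> U. \<forall>t. norm (intertwining_integral s' (\<Psi> s') t) \<le> (LINT x|lborel. (1 + x\<^sup>2) powr (- (c + 1) / 2) * B)"
    proof (intro ballI allI)
      fix s' t assume s': "s' \<in> ball s (min e c) \<inter> U"
      have "\<bar>Re s - Re s'\<bar> < c" using s' abs_Re_le_cmod[of "s - s'"] by (auto simp: dist_norm)
      then have r: "Re (s' + 1) \<ge> c + 1" unfolding c_def plus_complex.sel one_complex.sel by arith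
      show "norm (intertwining_integral s' (\<Psi> s') t) \<le> (LINT x|lborel. (1 + x\<^sup>2) powr (- (c + 1) / 2) * B)"
        unfolding intertwining_integral_def
      proof (rule Bochner_Integration.integral_norm_bound_integral)
        show "integrable lborel (\<lambda>x. (1 + x\<^sup>2) powr (- (c + 1) / 2) * B)"
          using integrable_one_plus_sq_powr[of "c + 1"] c by simp
        fix x
        have "norm (\<Psi> s' (t + arccot x)) \<le> B" using e(2)[of s'] s' by auto
        then show "norm (sin_pow (s' + 1) x * \<Psi> s' (t + arccot x)) \<le> (1 + x\<^sup>2) powr (- (c + 1) / 2) * B"
          unfolding norm_mult using norm_sin_pow_le[OF r, of x]
          by (intro mult_mono) (auto intro: order_trans[OF norm_ge_zero])
      qed (use int[OF \<Psi>, of s'] s' in auto)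
    qed
    moreover have "min e c > 0" using c e(1) by simp
    ultimately show "\<exists>e>0. \<exists>B. \<forall>s'\<in>ball s e \<inter> U. \<forall>t. norm (intertwining_integral s' (\<Psi> s') t) \<le> B"
      by blast
  qed
  have "family_Ck k U (\<lambda>s. intertwining_integral s (\<Psi> s))" if "family U \<Psi>" for k \<Psi>
    using that
  proof (induction k arbitrary: \<Psi>)
    case (Suc k)
    show ?case
      by (rule family_Ck_SucI[OF b[OF Suc.prems] d[OF Suc.prems] Suc.IH[OF family_dv[OF Suc.prems]]])
  qed (use b in auto)
  then show ?thesis using \<Phi> by (simp add: family_def)
qed


section \<open>Entire continuation of the two integrals\<close>

text \<open>A recurrence step moves the parameter from \<open>s\<close> to \<open>s + c\<close>. The
  inductions below apply their hypothesis in the variable \<open>z = s + c\<close>, on the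
  translated set.\<close>

lemma family_shift:
  assumes "open U" "family U \<Phi>"
  shows "open {z. z - c \<in> U}" "family {z. z - c \<in> U} (\<lambda>z. \<Phi> (z - c))"
proof -
  have "{z. z - c \<in> U} = (\<lambda>z. z - c) -` U" by auto
  also have "open \<dots>" by (rule open_vimage[OF assms(1)]) (intro continuous_intros)
  finally show "open {z. z - c \<in> U}" .
  show "family {z. z - c \<in> U} (\<lambda>z. \<Phi> (z - c))"
    by (rule family_compose[OF assms(2)]) (auto intro!: holomorphic_intros)
qed

lemma family_const_intertwining_shift:
  "family UNIV (\<lambda>_. h) \<Longrightarrow> family UNIV (\<lambda>_. intertwining_shift s h)"
  using family_intertwining_shift[OF open_UNIV, of "\<lambda>_. s" "\<lambda>_. h"] by simp

lemma family_const_whittaker_shift: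
  "family UNIV (\<lambda>_. h) \<Longrightarrow> family UNIV (\<lambda>_. whittaker_shift s h)"
  using family_whittaker_shift[OF open_UNIV, of "\<lambda>_. s" "\<lambda>_. h"] by simp

text \<open>The factor \<open>s * (s + 1)\<close> of the recurrence is absorbed by the
  normalisation, since \<open>rGamma s = s * (s + 1) * rGamma (s + 2)\<close>; the steps are then
  free of denominators.\<close>

primrec intertwining_iter :: "nat \<Rightarrow> complex \<Rightarrow> (real \<Rightarrow> complex) \<Rightarrow> real \<Rightarrow> complex" where
  "intertwining_iter 0 s h = (\<lambda>t. rGamma s * intertwining_integral s h t)"
| "intertwining_iter (Suc n) s h = intertwining_iter n (s + 2) (intertwining_shift s h)"

text \<open>The section has to move with \<open>s\<close>: after one step
  \<open>intertwining_shift s h\<close> depends on \<open>s\<close> even if \<open>h\<close> does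
  not.\<close>

lemma family_intertwining_iter:
  assumes "open U" "\<And>s. s \<in> U \<Longrightarrow> Re s > - 2 * real n" "family U \<Phi>"
  shows "family U (\<lambda>s. intertwining_iter n s (\<Phi> s))"
  using assms
proof (induction n arbitrary: U \<Phi>)
  case 0
  have "family U (\<lambda>s t. rGamma s * intertwining_integral s (\<Phi> s) t)"
    using 0 by (intro family_mult family_scalar family_intertwining_integral holomorphic_intros) auto
  then show ?case by simp
next
  case (Suc n)
  let ?V = "{z. z - 2 \<in> U}"
  have V: "open ?V" "family ?V (\<lambda>z. intertwining_shift (z - 2) (\<Phi> (z - 2)))"
    using family_shift[of U \<Phi> 2] Suc.prems by (auto intro!: family_intertwining_shift holomorphic_intros)
  have hol: "(\<lambda>s. s + 2) holomorphic_on U" by (intro holomorphic_intros)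
  have "family ?V (\<lambda>z. intertwining_iter n z (intertwining_shift (z - 2) (\<Phi> (z - 2))))"
  proof (rule Suc.IH[OF V(1) _ V(2)])
    fix z assume "z \<in> ?V"
    then show "Re z > - 2 * real n" using Suc.prems(2)[of "z - 2"] by auto
  qed
  from family_compose[OF this hol] show ?case
    by (simp add: image_subset_iff)
qed

lemma intertwining_iter_Suc:
  assumes "Re s > - 2 * real n" "family UNIV (\<lambda>_. h)"
  shows "intertwining_iter (Suc n) s h t = intertwining_iter n s h t"
  using assms
proof (induction n arbitrary: s h)
  case 0
  have "rGamma s = s * ((s + 1) * rGamma (s + 2))"
    using rGamma_plus1[of s] rGamma_plus1[of "s + 1"] by (simp add: add.assoc)
  then show ?case using intertwining_integral_recurrence[of s h t] 0 by (simp add: mult_ac)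
next
  case (Suc n)
  have "intertwining_iter (Suc n) (s + 2) (intertwining_shift s h) t = intertwining_iter n (s + 2) (intertwining_shift s h) t"
    using Suc.prems by (intro Suc.IH family_const_intertwining_shift) auto
  then show ?case by simp
qed

lemma intertwining_iter_le:
  assumes "m \<le> n" "Re s > - 2 * real m" "family UNIV (\<lambda>_. h)"
  shows "intertwining_iter n s h t = intertwining_iter m s h t"
  using assms
proof (induction n rule: dec_induct)
  case (step n)
  then have "Re s > - 2 * real n" by (smt (verit) of_nat_mono)
  with step show ?case using intertwining_iter_Suc by metis
qed simp

text \<open>By \<open>intertwining_entire_eq\<close> every \<open>n\<close> with
  \<open>Re s > - 2 * real n\<close> gives the same value; the number used here qualifies for every
  \<open>s\<close>.\<close>

definition intertwining_entire :: "complex \<Rightarrow> (real \<Rightarrow> complex) \<Rightarrow> real \<Rightarrow> complex" where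
  "intertwining_entire s = intertwining_iter (nat \<lceil>\<bar>Re s\<bar>\<rceil> + 1) s"

lemma intertwining_entire_eq:
  assumes "Re s > - 2 * real n" "family UNIV (\<lambda>_. h)"
  shows "intertwining_entire s h = intertwining_iter n s h"
proof -
  let ?m = "nat \<lceil>\<bar>Re s\<bar>\<rceil> + 1"
  have "real ?m = real_of_int \<lceil>\<bar>Re s\<bar>\<rceil> + 1" by simp
  then have "Re s > - real ?m"
    using le_of_int_ceiling[of "\<bar>Re s\<bar>"] abs_ge_minus_self[of "Re s"] abs_ge_zero[of "Re s"] by linarith
  moreover have "real ?m \<ge> 0" by (rule of_nat_0_le_iff)
  ultimately have "Re s > - 2 * real ?m" by argo
  then show ?thesis
    using intertwining_iter_le[of ?m n s h] intertwining_iter_le[of n ?m s h] assms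
    by (cases "?m \<le> n") (auto simp: intertwining_entire_def fun_eq_iff)
qed

lemma intertwining_entire_pos:
  assumes "Re s > 0" "family UNIV (\<lambda>_. h)"
  shows "intertwining_entire s h t = rGamma s * intertwining_integral s h t"
  using intertwining_entire_eq[of 0 s h] assms by simp

lemma family_intertwining_entire:
  assumes h: "family UNIV (\<lambda>_. h)"
  shows "family UNIV (\<lambda>s. intertwining_entire s h)"
proof (rule family_local)
  fix s :: complex
  obtain n where n: "- Re s < real n" using reals_Archimedean2 by blast
  let ?V = "{z. Re z > - 2 * real n}"
  have V: "open ?V" by (rule open_halfspace_Re_gt)
  have "family ?V (\<lambda>s. intertwining_iter n s h)"
    using family_intertwining_iter[OF V _ family_const[OF h], of n] by auto
  then have "family ?V (\<lambda>s. intertwining_entire s h)"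
    using family_cong[of ?V "\<lambda>s. intertwining_entire s h" "\<lambda>s. intertwining_iter n s h"]
      intertwining_entire_eq[OF _ h] by auto
  then show "\<exists>V. open V \<and> s \<in> V \<and> family V (\<lambda>s. intertwining_entire s h)"
    using V n by (intro exI[of _ ?V]) auto
qed

text \<open>In contrast to \<open>intertwining_iter\<close>, the divisor
  \<open>\<i> * of_real a\<close> is independent of \<open>s\<close>, so the continuation is entire
  without a Gamma factor.\<close>

primrec whittaker_iter :: "nat \<Rightarrow> real \<Rightarrow> complex \<Rightarrow> (real \<Rightarrow> complex) \<Rightarrow> complex" where
  "whittaker_iter 0 a s h = whittaker_integral a s h"
| "whittaker_iter (Suc n) a s h = inverse (\<i> * of_real a) * whittaker_iter n a (s + 1) (whittaker_shift s h)"

text \<open>The section moves with \<open>s\<close> for two reasons: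
  \<open>whittaker_shift s h\<close> depends on \<open>s\<close>, and the functional equation later
  inserts \<open>intertwining_entire\<close>.\<close>

lemma holomorphic_whittaker_iter:
  assumes "open U" "\<And>s. s \<in> U \<Longrightarrow> Re s > - real n" "family U \<Phi>"
  shows "(\<lambda>s. whittaker_iter n a s (\<Phi> s)) holomorphic_on U"
  using assms
proof (induction n arbitrary: U \<Phi>)
  case 0
  then show ?case
    using holomorphic_kernel_integral[of U \<Phi> "\<lambda>x. inverse (psi a x)" 0]
    by (simp add: whittaker_integral_def family_bounded continuous_on_inverse_psi)
next
  case (Suc n)
  let ?V = "{z. z - 1 \<in> U}"
  have V: "open ?V" "family ?V (\<lambda>z. whittaker_shift (z - 1) (\<Phi> (z - 1)))"
    using family_shift[of U \<Phi> 1] Suc.prems by (auto intro!: family_whittaker_shift holomorphic_intros)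
  have "(\<lambda>z. whittaker_iter n a z (whittaker_shift (z - 1) (\<Phi> (z - 1)))) holomorphic_on ?V"
  proof (rule Suc.IH[OF V(1) _ V(2)])
    fix z assume "z \<in> ?V"
    then show "Re z > - real n" using Suc.prems(2)[of "z - 1"] by auto
  qed
  then have "(\<lambda>z. whittaker_iter n a z (whittaker_shift (z - 1) (\<Phi> (z - 1)))) \<circ> (\<lambda>s. s + 1) holomorphic_on U"
    by (intro holomorphic_on_compose_gen[where t = ?V]) (auto intro!: holomorphic_intros)
  then show ?case by (auto simp: o_def intro!: holomorphic_intros)
qed

lemma whittaker_iter_Suc:
  assumes "Re s > - real n" "a \<noteq> 0" "family UNIV (\<lambda>_. h)"
  shows "whittaker_iter (Suc n) a s h = whittaker_iter n a s h"
  using assms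
proof (induction n arbitrary: s h)
  case 0
  then show ?case using whittaker_integral_recurrence[of s a h] by simp
next
  case (Suc n)
  have "whittaker_iter (Suc n) a (s + 1) (whittaker_shift s h) = whittaker_iter n a (s + 1) (whittaker_shift s h)"
    using Suc.prems by (intro Suc.IH family_const_whittaker_shift) auto
  then show ?case by simp
qed

lemma whittaker_iter_le:
  assumes "m \<le> n" "Re s > - real m" "a \<noteq> 0" "family UNIV (\<lambda>_. h)"
  shows "whittaker_iter n a s h = whittaker_iter m a s h"
  using assms
proof (induction n rule: dec_induct)
  case (step n)
  then have "Re s > - real n" by (smt (verit) of_nat_mono)
  with step show ?case using whittaker_iter_Suc by metis
qed simp

text \<open>A step gains one unit of Re s here, and the number of steps still exceeds \<bar>Re
  s\<bar>.\<close>

definition whittaker_entire :: "real \<Rightarrow> complex \<Rightarrow> (real \<Rightarrow> complex) \<Rightarrow> complex" where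
  "whittaker_entire a s = whittaker_iter (nat \<lceil>\<bar>Re s\<bar>\<rceil> + 1) a s"

lemma whittaker_entire_eq:
  assumes "Re s > - real n" "a \<noteq> 0" "family UNIV (\<lambda>_. h)"
  shows "whittaker_entire a s h = whittaker_iter n a s h"
proof -
  let ?m = "nat \<lceil>\<bar>Re s\<bar>\<rceil> + 1"
  have "real ?m = real_of_int \<lceil>\<bar>Re s\<bar>\<rceil> + 1" by simp
  then have "Re s > - real ?m"
    using le_of_int_ceiling[of "\<bar>Re s\<bar>"] abs_ge_minus_self[of "Re s"] abs_ge_zero[of "Re s"] by linarith
  then show ?thesis
    using whittaker_iter_le[of ?m n s a h] whittaker_iter_le[of n ?m s a h] assms
    by (cases "?m \<le> n") (auto simp: whittaker_entire_def)
qed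

lemma family_at:
  assumes "family U \<Phi>" "s \<in> U"
  shows "family UNIV (\<lambda>_. \<Phi> s)"
  using family_compose[OF assms(1), of "\<lambda>_. s" UNIV] assms(2) by auto

lemma whittaker_entire_pos:
  assumes "Re s > 0" "a \<noteq> 0" "family UNIV (\<lambda>_. h)"
  shows "whittaker_entire a s h = whittaker_integral a s h"
  using whittaker_entire_eq[of 0 s a h] assms by simp

lemma holomorphic_whittaker_entire:
  assumes \<Phi>: "family UNIV \<Phi>" and a: "a \<noteq> 0"
  shows "(\<lambda>s. whittaker_entire a s (\<Phi> s)) holomorphic_on UNIV"
  unfolding holomorphic_on_def
proof
  fix s :: complex
  obtain n where n: "- Re s < real n" using reals_Archimedean2 by blast
  let ?V = "{z. Re z > - real n}"
  have V: "open ?V" by (rule open_halfspace_Re_gt)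
  have "(\<lambda>s. whittaker_iter n a s (\<Phi> s)) holomorphic_on ?V"
    using holomorphic_whittaker_iter[OF V _ family_subset[OF \<Phi>], of n] by auto
  then have "(\<lambda>s. whittaker_entire a s (\<Phi> s)) holomorphic_on ?V"
    by (subst holomorphic_cong[OF refl]) (auto intro!: whittaker_entire_eq a family_at[OF \<Phi>])
  then show "(\<lambda>s. whittaker_entire a s (\<Phi> s)) field_differentiable (at s within UNIV)"
    using V n by (intro holomorphic_on_imp_differentiable_at[of _ ?V]) auto
qed


section \<open>The Mellin transform of a character\<close>

text \<open>The linear bound serves near 0 and the constant one at infinity; together they give
  integrability of \<open>mellin_integrand\<close> at both ends.\<close>

lemma norm_one_minus_exp_le:
  assumes "Re w \<ge> 0"
  shows "norm (1 - exp (- w)) \<le> norm w" "norm (1 - exp (- w)) \<le> 2"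
proof -
  have "norm (exp (- 0) - exp (- w)) \<le> 1 * norm (0 - w)"
  proof (rule field_differentiable_bound[where f = "\<lambda>z. exp (- z)" and f' = "\<lambda>z. - exp (- z)" and S = "{z. Re z \<ge> 0}"])
    show "convex {z. Re z \<ge> 0}" by (rule convex_halfspace_Re_ge)
  qed (use assms in \<open>auto intro!: derivative_eq_intros\<close>)
  then show "norm (1 - exp (- w)) \<le> norm w" by simp
  show "norm (1 - exp (- w)) \<le> 2"
    using norm_triangle_ineq4[of 1 "exp (- w)"] assms by (auto intro: order_trans)
qed

text \<open>The Mellin integral of exp (- z v) converges only conditionally on the imaginary axis.
  Integrating by parts once, with the primitive of the exponential that vanishes at 0, gives
  \<open>1 - \<sigma>\<close> times the integral of this function, which converges absolutely for Re
  z \<ge> 0 and z \<noteq> 0.\<close>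

definition mellin_integrand :: "real \<Rightarrow> complex \<Rightarrow> real \<Rightarrow> complex" where
  "mellin_integrand \<sigma> z v = indicator {0<..} v *\<^sub>R (of_real (v powr (\<sigma> - 2)) * ((1 - exp (- (z * of_real v))) / z))"

definition mellin_bound :: "real \<Rightarrow> real \<Rightarrow> real \<Rightarrow> real" where
  "mellin_bound \<sigma> C v = indicator {0<..1} v *\<^sub>R (v powr (\<sigma> - 1)) + C * (indicator {1..} v *\<^sub>R (v powr (\<sigma> - 2)))"

lemma integrable_powr_near_0:
  assumes "c > -1" shows "integrable lborel (\<lambda>v::real. indicator {0<..1} v *\<^sub>R (v powr c))"
proof -
  have "(\<lambda>v. v powr c) integrable_on {0<..1}"
    using integrable_on_powr_from_0'[of c 1] assms by auto
  then have "set_integrable lebesgue {0<..1} (\<lambda>v. v powr c)"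
    by (intro nonnegative_absolutely_integrable_1) auto
  then have "integrable lebesgue (\<lambda>v::real. indicator {0<..1} v *\<^sub>R (v powr c))" by (simp add: set_integrable_def)
  moreover have "(\<lambda>v::real. indicator {0<..1} v *\<^sub>R (v powr c)) \<in> borel_measurable lborel" by measurable
  ultimately show ?thesis using integrable_completion by blast
qed

lemma integrable_powr_at_top:
  assumes "c < -1" shows "integrable lborel (\<lambda>v::real. indicator {1..} v *\<^sub>R (v powr c))"
proof -
  have "(\<lambda>v. v powr c) integrable_on {1..}"
    using has_integral_powr_to_inf[of c 1] assms by (auto simp: integrable_on_def)
  then have "set_integrable lebesgue {1..} (\<lambda>v. v powr c)"
    by (intro nonnegative_absolutely_integrable_1) auto
  then have "integrable lebesgue (\<lambda>v::real. indicator {1..} v *\<^sub>R (v powr c))" by (simp add: set_integrable_def)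
  moreover have "(\<lambda>v::real. indicator {1..} v *\<^sub>R (v powr c)) \<in> borel_measurable lborel" by measurable
  ultimately show ?thesis using integrable_completion by blast
qed

lemma integrable_mellin_bound:
  assumes "0 < \<sigma>" "\<sigma> < 1" shows "integrable lborel (mellin_bound \<sigma> C)"
  unfolding mellin_bound_def[abs_def]
  using integrable_powr_near_0[of "\<sigma> - 1"] integrable_powr_at_top[of "\<sigma> - 2"] assms by auto

lemma mellin_measurable: "mellin_integrand \<sigma> z \<in> borel_measurable borel"
  unfolding mellin_integrand_def[abs_def] by measurable

text \<open>The bound depends on \<open>z\<close> only through a lower bound for its norm, so it
  survives the passage to the imaginary axis.\<close>

lemma norm_mellin_integrand_le:
  assumes "Re z \<ge> 0" "norm z \<ge> r" "r > 0"
  shows "norm (mellin_integrand \<sigma> z v) \<le> mellin_bound \<sigma> (2 / r) v"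
proof (cases "v > 0")
  case True
  have z: "norm z > 0" using assms by linarith
  have "Re (z * of_real v) \<ge> 0" using assms True by simp
  note b = norm_one_minus_exp_le[OF this]
  show ?thesis
  proof (cases "v < 1")
    case v1: True
    have "norm ((1 - exp (- (z * of_real v))) / z) \<le> v"
      using b(1) z True by (simp add: norm_divide norm_mult divide_le_eq mult.commute)
    then have "norm (mellin_integrand \<sigma> z v) \<le> v powr (\<sigma> - 2) * v"
      using True by (simp add: mellin_integrand_def norm_mult mult_left_mono del: norm_divide times_divide_eq_right)
    also have "v powr (\<sigma> - 2) * v = v powr (\<sigma> - 1)"
      using powr_add[of v "\<sigma> - 2" 1] True by simp
    finally show ?thesis using True v1 by (simp add: mellin_bound_def)
  next
    case False
    have "norm ((1 - exp (- (z * of_real v))) / z) \<le> 2 / r"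
      unfolding norm_divide using b(2) assms z by (intro frac_le) auto
    then have "norm (mellin_integrand \<sigma> z v) \<le> v powr (\<sigma> - 2) * (2 / r)"
      using True by (simp add: mellin_integrand_def norm_mult mult_left_mono del: norm_divide times_divide_eq_right)
    also have "\<dots> \<le> mellin_bound \<sigma> (2 / r) v" using False True by (simp add: mellin_bound_def mult.commute)
    finally show ?thesis .
  qed
next
  case False
  then show ?thesis by (simp add: mellin_integrand_def mellin_bound_def)
qed

lemma integrable_mellin:
  assumes "0 < \<sigma>" "\<sigma> < 1" "Re z \<ge> 0" "z \<noteq> 0"
  shows "integrable lborel (mellin_integrand \<sigma> z)"
proof (rule Bochner_Integration.integrable_bound[OF integrable_mellin_bound[OF assms(1,2), of "2 / norm z"]])
  show "mellin_integrand \<sigma> z \<in> borel_measurable lborel" using mellin_measurable by simp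
  show "AE v in lborel. norm (mellin_integrand \<sigma> z v) \<le> norm (mellin_bound \<sigma> (2 / norm z) v)"
    using norm_mellin_integrand_le[of z "norm z"] assms 
    by (intro AE_I2) (auto intro: order_trans[OF _ abs_ge_self])
qed

definition incomplete_gamma :: "real \<Rightarrow> complex \<Rightarrow> real \<Rightarrow> complex" where
  "incomplete_gamma \<sigma> z B = (LINT v|lborel. indicator {0<..<B} v *\<^sub>R (of_real (v powr (\<sigma> - 1)) * exp (- (z * of_real v))))"

lemma incomplete_gamma_integrable:
  assumes "0 < \<sigma>" "Re z \<ge> 0"
  shows "integrable lborel (\<lambda>v. indicator {0<..<B} v *\<^sub>R (of_real (v powr (\<sigma> - 1)) * exp (- (z * of_real v))))"
proof -
  define C where "C = max 1 (B powr (\<sigma> - 1))"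
  have i: "integrable lborel (\<lambda>v::real. indicator {0<..1} v *\<^sub>R (v powr (\<sigma> - 1)) + C * indicator {0..B} v)"
    using assms by (intro Bochner_Integration.integrable_add integrable_powr_near_0 integrable_mult_right)
      (auto intro!: integrable_real_indicator simp: emeasure_lborel_Icc_eq)
  show ?thesis
  proof (rule Bochner_Integration.integrable_bound[OF i])
    have "v powr (\<sigma> - 1) \<le> C" if "1 < v" "v < B" for v
    proof (cases "\<sigma> \<ge> 1")
      case True
      then have "v powr (\<sigma> - 1) \<le> B powr (\<sigma> - 1)" using that by (intro powr_mono2) auto
      then show ?thesis by (simp add: C_def)
    next
      case False
      then have "v powr (\<sigma> - 1) \<le> v powr 0" using that by (intro powr_mono) auto
      then show ?thesis using that by (simp add: C_def)
    qed
    moreover have "C \<ge> 0" by (simp add: C_def)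
    ultimately show "AE v in lborel. norm (indicator {0<..<B} v *\<^sub>R (of_real (v powr (\<sigma> - 1)) * exp (- (z * of_real v))))
      \<le> norm (indicator {0<..1} v *\<^sub>R (v powr (\<sigma> - 1)) + C * indicator {0..B} v)"
    proof (intro AE_I2)
      fix v :: real
      assume C: "\<And>v. 1 < v \<Longrightarrow> v < B \<Longrightarrow> v powr (\<sigma> - 1) \<le> C" "C \<ge> 0"
      have "norm (of_real (v powr (\<sigma> - 1)) * exp (- (z * of_real v))) \<le> v powr (\<sigma> - 1) * 1" if "v > 0"
        unfolding norm_mult using that assms by (intro mult_mono) auto
      then show "norm (indicator {0<..<B} v *\<^sub>R (of_real (v powr (\<sigma> - 1)) * exp (- (z * of_real v))))
        \<le> norm (indicator {0<..1} v *\<^sub>R (v powr (\<sigma> - 1)) + C * indicator {0..B} v)"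
        using C by (cases "v \<le> 1") (auto simp: indicator_def intro: order_trans)
    qed
    show "(\<lambda>v. indicator {0<..<B} v *\<^sub>R (complex_of_real (v powr (\<sigma> - 1)) * exp (- (z * of_real v)))) \<in> borel_measurable lborel"
      by measurable
  qed
qed

text \<open>Integration by parts with the primitive \<open>q\<close> of the exponential. Since
  \<open>q v\<close> is at most \<open>v\<close> in norm, the boundary term at 0 is of order
  \<open>v powr \<sigma>\<close> and vanishes.\<close>

lemma incomplete_gamma_eq:
  assumes \<sigma>: "0 < \<sigma>" "\<sigma> < 1" and z: "Re z \<ge> 0" "z \<noteq> 0" and B: "B > 0"
  shows "incomplete_gamma \<sigma> z B = of_real (B powr (\<sigma> - 1)) * ((1 - exp (- (z * of_real B))) / z)
    + of_real (1 - \<sigma>) * (LINT v|lborel. indicator {..<B} v *\<^sub>R mellin_integrand \<sigma> z v)"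
proof -
  define q where "q v = (1 - exp (- (z * of_real v))) / z" for v :: real
  define F where "F v = of_real (v powr (\<sigma> - 1)) * q v" for v
  define f where "f v = of_real (v powr (\<sigma> - 1)) * exp (- (z * of_real v)) + of_real (\<sigma> - 1) * (of_real (v powr (\<sigma> - 2)) * q v)" for v :: real
  have dq: "(q has_vector_derivative exp (- (z * of_real v))) (at v)" for v
  proof -
    have "((\<lambda>v. (1 - exp (- (z * of_real v))) / z) has_vector_derivative of_real 1 * exp (- (z * of_real v))) (at v)"
      using z by (intro has_vector_derivative_chain_of_real[where u = "\<lambda>v. v" and g = "\<lambda>w. (1 - exp (- (z * w))) / z"])
        (auto intro!: derivative_eq_intros)
    then show ?thesis by (simp add: q_def[abs_def])
  qed
  have dF: "(F has_vector_derivative f v) (at v)" if "v > 0" for v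
  proof -
    have "((\<lambda>v. v powr (\<sigma> - 1)) has_real_derivative (\<sigma> - 1) * v powr (\<sigma> - 2)) (at v)"
      using has_real_derivative_powr[OF that, of "\<sigma> - 1"] by (simp add: algebra_simps)
    then have "((\<lambda>v. complex_of_real (v powr (\<sigma> - 1))) has_vector_derivative of_real ((\<sigma> - 1) * v powr (\<sigma> - 2))) (at v)"
      by (rule has_vector_derivative_of_real)
    from has_vector_derivative_mult[OF this dq] show ?thesis
      unfolding F_def[abs_def] f_def by (simp add: mult_ac)
  qed
  have m: "indicator {..<B} v *\<^sub>R mellin_integrand \<sigma> z v = indicator {0<..<B} v *\<^sub>R (of_real (v powr (\<sigma> - 2)) * q v)" for v
    by (auto simp: mellin_integrand_def indicator_def q_def)
  have im: "integrable lborel (\<lambda>v. indicator {..<B} v *\<^sub>R mellin_integrand \<sigma> z v)"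
    using integrable_mellin[OF \<sigma> z] by (intro integrable_mult_indicator) auto
  have ig: "integrable lborel (\<lambda>v. indicator {0<..<B} v *\<^sub>R (of_real (v powr (\<sigma> - 1)) * exp (- (z * of_real v))))"
    by (rule incomplete_gamma_integrable) (use \<sigma> z in auto)
  have fe: "(\<lambda>v. indicator {0<..<B} v *\<^sub>R f v) = (\<lambda>v. indicator {0<..<B} v *\<^sub>R (of_real (v powr (\<sigma> - 1)) * exp (- (z * of_real v)))
     + of_real (\<sigma> - 1) * (indicator {..<B} v *\<^sub>R mellin_integrand \<sigma> z v))"
    unfolding m f_def by (auto simp: indicator_def)
  have "(LBINT v=ereal 0..ereal B. f v) = F B - 0"
  proof (rule interval_integral_FTC_integrable)
    show "ereal 0 < ereal B" using B by simp
    show "(F has_vector_derivative f v) (at v)" if "ereal 0 < ereal v" "ereal v < ereal B" for v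
      using dF that by simp
    show "isCont f v" if "ereal 0 < ereal v" "ereal v < ereal B" for v
      unfolding f_def q_def using that z by (intro continuous_intros) auto
    show "set_integrable lborel (einterval (ereal 0) (ereal B)) f"
      unfolding set_integrable_def einterval_eq fe by (intro Bochner_Integration.integrable_add integrable_mult_right im ig)
    have "isCont F B" using has_vector_derivative_continuous[OF dF[OF B]] .
    then have "(F \<longlongrightarrow> F B) (at_left B)" by (simp add: isCont_def filterlim_at_split)
    then show "((F \<circ> real_of_ereal) \<longlongrightarrow> F B) (at_left (ereal B))"
      by (simp add: ereal_tendsto_simps)
    have "((\<lambda>v. v powr \<sigma>) \<longlongrightarrow> 0) (at_right 0)" using \<sigma> by real_asymp
    then have "(F \<longlongrightarrow> 0) (at_right 0)"
    proof (rule Lim_null_comparison[rotated])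
      show "eventually (\<lambda>v. norm (F v) \<le> v powr \<sigma>) (at_right 0)"
        unfolding eventually_at_right_field
      proof (intro exI[of _ 1] conjI allI impI)
        fix v :: real assume v: "v > 0" "v < 1"
        have "norm (q v) \<le> v"
          using norm_one_minus_exp_le(1)[of "z * of_real v"] z v 
          by (simp add: q_def norm_divide norm_mult divide_le_eq mult.commute)
        then have "norm (F v) \<le> v powr (\<sigma> - 1) * v"
          by (simp add: F_def norm_mult mult_left_mono)
        also have "\<dots> = v powr \<sigma>" using powr_add[of v "\<sigma> - 1" 1] v by simp
        finally show "norm (F v) \<le> v powr \<sigma>" .
      qed auto
    qed
    then show "((F \<circ> real_of_ereal) \<longlongrightarrow> 0) (at_right (ereal 0))"
      by (simp add: ereal_tendsto_simps)
  qed
  then have "(LINT v|lborel. indicator {0<..<B} v *\<^sub>R f v) = F B"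
    using B by (simp add: interval_lebesgue_integral_def set_lebesgue_integral_def einterval_eq)
  then have "incomplete_gamma \<sigma> z B + of_real (\<sigma> - 1) * (LINT v|lborel. indicator {..<B} v *\<^sub>R mellin_integrand \<sigma> z v) = F B"
    unfolding fe incomplete_gamma_def
    by (simp only: Bochner_Integration.integral_add[OF ig integrable_mult_right[OF im]] integral_mult_right_zero)
  then show ?thesis by (simp add: F_def q_def algebra_simps)
qed

text \<open>The boundary term at \<open>B\<close> decays because \<open>\<sigma> < 1\<close>, and
  the remaining integral converges absolutely, for imaginary \<open>z\<close> as well.\<close>

lemma incomplete_gamma_tendsto:
  assumes \<sigma>: "0 < \<sigma>" "\<sigma> < 1" and z: "Re z \<ge> 0" "z \<noteq> 0"
  shows "(incomplete_gamma \<sigma> z \<longlongrightarrow> of_real (1 - \<sigma>) * (LINT v|lborel. mellin_integrand \<sigma> z v)) at_top"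
proof -
  have "((\<lambda>B. LINT v|lborel. indicator {..<B} v *\<^sub>R mellin_integrand \<sigma> z v) \<longlongrightarrow> (LINT v|lborel. mellin_integrand \<sigma> z v)) at_top"
    using integrable_mellin[OF \<sigma> z] eventually_gt_at_top by (intro truncated_integral_tendsto) auto
  moreover have "((\<lambda>B. of_real (B powr (\<sigma> - 1)) * ((1 - exp (- (z * of_real B))) / z)) \<longlongrightarrow> 0) at_top"
  proof (rule Lim_null_comparison)
    show "eventually (\<lambda>B. norm (of_real (B powr (\<sigma> - 1)) * ((1 - exp (- (z * of_real B))) / z)) \<le> B powr (\<sigma> - 1) * (2 / norm z)) at_top"
      using eventually_gt_at_top[of 0]
    proof eventually_elim
      case (elim B)
      have "norm ((1 - exp (- (z * of_real B))) / z) \<le> 2 / norm z"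
        unfolding norm_divide using norm_one_minus_exp_le(2)[of "z * of_real B"] z elim by (intro divide_right_mono) auto
      then show ?case by (simp only: norm_mult norm_of_real abs_of_nonneg[OF powr_ge_zero] mult_left_mono powr_ge_zero)
    qed
    have "((\<lambda>B. B powr (\<sigma> - 1)) \<longlongrightarrow> 0) at_top" using \<sigma> by real_asymp
    then show "((\<lambda>B. B powr (\<sigma> - 1) * (2 / norm z)) \<longlongrightarrow> 0) at_top" by (rule tendsto_mult_left_zero)
  qed
  ultimately have "((\<lambda>B. of_real (B powr (\<sigma> - 1)) * ((1 - exp (- (z * of_real B))) / z)
    + of_real (1 - \<sigma>) * (LINT v|lborel. indicator {..<B} v *\<^sub>R mellin_integrand \<sigma> z v)) \<longlongrightarrow> 0 + of_real (1 - \<sigma>) * (LINT v|lborel. mellin_integrand \<sigma> z v)) at_top"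
    by (intro tendsto_intros)
  moreover have "eventually (\<lambda>B. of_real (B powr (\<sigma> - 1)) * ((1 - exp (- (z * of_real B))) / z)
    + of_real (1 - \<sigma>) * (LINT v|lborel. indicator {..<B} v *\<^sub>R mellin_integrand \<sigma> z v) = incomplete_gamma \<sigma> z B) at_top"
    using eventually_gt_at_top[of 0] by eventually_elim (use incomplete_gamma_eq[OF assms] in auto)
  ultimately show ?thesis using Lim_transform_eventually by fastforce
qed

text \<open>Euler's integral, rescaled by \<open>r\<close>, gives a second evaluation of the limit
  of \<open>incomplete_gamma\<close>.\<close>

lemma mellin_real:
  assumes \<sigma>: "0 < \<sigma>" "\<sigma> < 1" and r: "r > 0"
  shows "of_real (1 - \<sigma>) * (LINT v|lborel. mellin_integrand \<sigma> (of_real r) v) = Gamma (of_real \<sigma>) * of_real r powr (- of_real \<sigma>)"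
proof -
  define g where "g v = indicator {0<..} v *\<^sub>R (v powr (\<sigma> - 1) / exp v)" for v :: real
  have g0: "g v = indicator {0..} v *\<^sub>R (v powr (\<sigma> - 1) / exp v)" for v
    by (auto simp: g_def indicator_def)
  have h: "((\<lambda>t. t powr (\<sigma> - 1) / exp t) has_integral Gamma \<sigma>) {0..}"
    using Gamma_integral_real[of \<sigma>] \<sigma> by simp
  then have s: "set_integrable lebesgue {0..} (\<lambda>t. t powr (\<sigma> - 1) / exp t)"
    by (intro nonnegative_absolutely_integrable_1) auto
  then have "(LINT t:{0..}|lebesgue. t powr (\<sigma> - 1) / exp t) = Gamma \<sigma>"
    using set_lebesgue_integral_eq_integral(2)[OF s] integral_unique[OF h] by simp
  then have gl: "integrable lebesgue g" "(LINT v|lebesgue. g v) = Gamma \<sigma>"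
    using s by (simp_all add: g0[abs_def] set_integrable_def set_lebesgue_integral_def)
  have gm: "g \<in> borel_measurable lborel" unfolding g_def by measurable
  have gi: "integrable lborel g" "(LINT v|lborel. g v) = Gamma \<sigma>"
    using gl integrable_completion[OF gm] integral_completion[OF gm] by auto
  define k where "k v = indicator {0<..} v *\<^sub>R (v powr (\<sigma> - 1) / exp (r * v))" for v :: real
  have k: "k v = r powr (1 - \<sigma>) * g (0 + r * v)" for v
    using r by (auto simp: k_def g_def indicator_def zero_less_mult_iff powr_mult powr_diff field_simps)
  have "(LINT v|lborel. g v) = \<bar>r\<bar> *\<^sub>R (LINT v|lborel. g (0 + r * v))"
    using r by (intro lborel_integral_real_affine) auto
  then have "(LINT v|lborel. g (0 + r * v)) = Gamma \<sigma> / r" using r gi by (simp add: field_simps)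
  then have "(LINT v|lborel. k v) = r powr (1 - \<sigma>) * (Gamma \<sigma> / r)" by (simp add: k)
  also have "\<dots> = Gamma \<sigma> * r powr (- \<sigma>)" using r by (simp add: powr_diff powr_minus field_simps)
  finally have kI: "(LINT v|lborel. k v) = Gamma \<sigma> * r powr (- \<sigma>)" .
  have ki: "integrable lborel k"
    unfolding k using lborel_integrable_real_affine[OF gi(1), of r 0] r by auto
  have kc: "indicator {0<..<B} v *\<^sub>R (of_real (v powr (\<sigma> - 1)) * exp (- (of_real r * complex_of_real v))) = 
     indicator {..<B} v *\<^sub>R complex_of_real (k v)" for v B
    by (auto simp: k_def indicator_def exp_minus divide_inverse simp flip: exp_of_real)
  have "((\<lambda>B. LINT v|lborel. indicator {..<B} v *\<^sub>R complex_of_real (k v)) \<longlongrightarrow> (LINT v|lborel. complex_of_real (k v))) at_top"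
    using ki eventually_gt_at_top by (intro truncated_integral_tendsto) auto
  then have "(incomplete_gamma \<sigma> (of_real r) \<longlongrightarrow> of_real (Gamma \<sigma> * r powr (- \<sigma>))) at_top"
    unfolding incomplete_gamma_def[abs_def] kc using kI ki by (simp del: of_real_mult)
  moreover have "(incomplete_gamma \<sigma> (of_real r) \<longlongrightarrow> of_real (1 - \<sigma>) * (LINT v|lborel. mellin_integrand \<sigma> (of_real r) v)) at_top"
    using r \<sigma> by (intro incomplete_gamma_tendsto) auto
  ultimately have "of_real (1 - \<sigma>) * (LINT v|lborel. mellin_integrand \<sigma> (of_real r) v) = of_real (Gamma \<sigma> * r powr (- \<sigma>))"
    using tendsto_unique trivial_limit_at_top_linorder by blast
  also have "\<dots> = Gamma (of_real \<sigma>) * of_real r powr (- of_real \<sigma>)"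
    using r by (simp add: Gamma_complex_of_real powr_of_real[symmetric])
  finally show ?thesis .
qed

lemma holomorphic_mellin:
  assumes \<sigma>: "0 < \<sigma>" "\<sigma> < 1"
  shows "(\<lambda>z. LINT v|lborel. mellin_integrand \<sigma> z v) holomorphic_on {z. Re z > 0}"
proof (rule holomorphic_on_integral)
  show "open {z. Re z > 0}" by (rule open_halfspace_Re_gt)
  show "(\<lambda>z. mellin_integrand \<sigma> z v) holomorphic_on {z. Re z > 0}" for v
    unfolding mellin_integrand_def scaleR_conv_of_real by (intro holomorphic_intros) auto
  show "mellin_integrand \<sigma> z \<in> borel_measurable lborel" for z
    using mellin_measurable by simp
  fix z assume "z \<in> {z. Re z > 0}"
  then have z: "Re z > 0" by simp
  define d where "d = norm z / 2"
  have d: "d > 0" using z by (auto simp: d_def)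
  have "norm z' \<ge> d" if "z' \<in> ball z d" for z'
    using that norm_triangle_ineq2[of z z'] by (auto simp: d_def dist_norm norm_minus_commute)
  then show "\<exists>e>0. \<exists>g. integrable lborel g \<and> (\<forall>z'\<in>ball z e \<inter> {z. 0 < Re z}. \<forall>v\<in>space lborel. norm (mellin_integrand \<sigma> z' v) \<le> g v)"
    using d by (intro exI[of _ d] exI[of _ "mellin_bound \<sigma> (2 / d)"] conjI d ballI integrable_mellin_bound[OF \<sigma>] norm_mellin_integrand_le) auto
qed

text \<open>Both sides are holomorphic on the half plane and agree on the positive reals.\<close>

lemma mellin_right_half_plane:
  assumes \<sigma>: "0 < \<sigma>" "\<sigma> < 1" and z: "Re z > 0"
  shows "of_real (1 - \<sigma>) * (LINT v|lborel. mellin_integrand \<sigma> z v) = Gamma (of_real \<sigma>) * z powr (- of_real \<sigma>)"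
proof -
  let ?S = "{z. Re z > 0}"
  let ?f = "\<lambda>z. of_real (1 - \<sigma>) * (LINT v|lborel. mellin_integrand \<sigma> z v) - Gamma (of_real \<sigma>) * z powr (- of_real \<sigma>)"
  have "?f z = 0"
  proof (rule analytic_continuation[of ?f ?S "of_real ` {0<..}" 1])
    show "?f holomorphic_on ?S"
      by (intro holomorphic_intros holomorphic_mellin \<sigma>) (auto simp: complex_nonpos_Reals_iff)
    show "open ?S" by (rule open_halfspace_Re_gt)
    show "connected ?S" by (intro convex_connected convex_halfspace_Re_gt)
    show "(1::complex) islimpt of_real ` {0<..}"
      unfolding islimpt_sequential
    proof (intro exI[of _ "\<lambda>n. of_real (1 + 1 / real (Suc n))"] conjI allI)
      have "(\<lambda>n. complex_of_real (1 + 1 / real (Suc n))) \<longlonglongrightarrow> of_real 1"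
        by (intro tendsto_of_real) real_asymp
      then show "(\<lambda>n. complex_of_real (1 + 1 / real (Suc n))) \<longlonglongrightarrow> 1" by simp
      fix n
      have "1 + 1 / real (Suc n) > 0" "1 + 1 / real (Suc n) \<noteq> 1" by (simp_all add: add_pos_pos)
      then show "complex_of_real (1 + 1 / real (Suc n)) \<in> of_real ` {0<..} - {1}"
        by (metis DiffI greaterThan_iff image_eqI of_real_eq_1_iff singletonD)
    qed
    show "?f w = 0" if "w \<in> of_real ` {0<..}" for w
      using that mellin_real[OF \<sigma>] by auto
  qed (use z in auto)
  then show ?thesis by simp
qed

text \<open>Continuity from the right up to the imaginary axis. The principal power is continuous
  there because its cut is the negative real axis, and this fixes the phase of the answer.\<close>

lemma mellin_imaginary:
  assumes \<sigma>: "0 < \<sigma>" "\<sigma> < 1" and a: "a \<noteq> 0"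
  shows "of_real (1 - \<sigma>) * (LINT v|lborel. mellin_integrand \<sigma> (- \<i> * of_real a) v) = Gamma (of_real \<sigma>) * (- \<i> * of_real a) powr (- of_real \<sigma>)"
proof -
  define z where "z \<delta> = of_real \<delta> - \<i> * of_real a" for \<delta> :: real
  have nz: "norm (z \<delta>) \<ge> \<bar>a\<bar>" for \<delta> using abs_Im_le_cmod[of "z \<delta>"] by (simp add: z_def)
  have zlim: "(z \<longlongrightarrow> - \<i> * of_real a) (at_right 0)"
    unfolding z_def[abs_def] by (auto intro!: tendsto_eq_intros)
  have "((\<lambda>\<delta>. LINT v|lborel. mellin_integrand \<sigma> (z \<delta>) v) \<longlongrightarrow> (LINT v|lborel. mellin_integrand \<sigma> (- \<i> * of_real a) v)) (at_right 0)"
  proof (rule tendsto_integral_at[where g = "mellin_bound \<sigma> (2 / \<bar>a\<bar>)"])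
    show "eventually (\<lambda>\<delta>. mellin_integrand \<sigma> (z \<delta>) \<in> borel_measurable lborel \<and>
        (\<forall>v\<in>space lborel. norm (mellin_integrand \<sigma> (z \<delta>) v) \<le> mellin_bound \<sigma> (2 / \<bar>a\<bar>) v)) (at_right 0)"
      using eventually_at_right_less[of 0]
    proof eventually_elim
      case (elim \<delta>)
      then have "Re (z \<delta>) \<ge> 0" by (simp add: z_def)
      then show ?case using norm_mellin_integrand_le[OF _ nz] a mellin_measurable by simp
    qed
    show "((\<lambda>\<delta>. mellin_integrand \<sigma> (z \<delta>) v) \<longlongrightarrow> mellin_integrand \<sigma> (- \<i> * of_real a) v) (at_right 0)" for v
      unfolding mellin_integrand_def using a by (intro tendsto_intros zlim) auto
  qed (use integrable_mellin_bound[OF \<sigma>] mellin_measurable in auto)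
  then have "((\<lambda>\<delta>. of_real (1 - \<sigma>) * (LINT v|lborel. mellin_integrand \<sigma> (z \<delta>) v)) \<longlongrightarrow> of_real (1 - \<sigma>) * (LINT v|lborel. mellin_integrand \<sigma> (- \<i> * of_real a) v)) (at_right 0)"
    by (intro tendsto_intros)
  moreover have "eventually (\<lambda>\<delta>. of_real (1 - \<sigma>) * (LINT v|lborel. mellin_integrand \<sigma> (z \<delta>) v) = Gamma (of_real \<sigma>) * z \<delta> powr (- of_real \<sigma>)) (at_right 0)"
    using eventually_at_right_less[of 0]
    by eventually_elim (use mellin_right_half_plane[OF \<sigma>] in \<open>simp add: z_def\<close>)
  ultimately have "((\<lambda>\<delta>. Gamma (of_real \<sigma>) * z \<delta> powr (- of_real \<sigma>)) \<longlongrightarrow> of_real (1 - \<sigma>) * (LINT v|lborel. mellin_integrand \<sigma> (- \<i> * of_real a) v)) (at_right 0)"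
    by (rule Lim_transform_eventually)
  moreover have "((\<lambda>\<delta>. Gamma (of_real \<sigma>) * z \<delta> powr (- of_real \<sigma>)) \<longlongrightarrow> Gamma (of_real \<sigma>) * (- \<i> * of_real a) powr (- of_real \<sigma>)) (at_right 0)"
    using a by (intro tendsto_intros tendsto_powr_complex zlim) (auto simp: complex_nonpos_Reals_iff)
  ultimately show ?thesis
    using tendsto_unique[OF trivial_limit_at_right_real] by blast
qed


section \<open>Convolution with a homogeneous kernel\<close>

lemma arccot_bounds: "0 < arccot x" "arccot x < pi"
  using arctan_bounded[of x] by (auto simp: arccot_def)

lemma arccot_cot:
  assumes "0 < \<theta>" "\<theta> < pi"
  shows "arccot (cos \<theta> / sin \<theta>) = \<theta>"
proof -
  have "arctan (tan (pi / 2 - \<theta>)) = pi / 2 - \<theta>"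
    using assms by (intro arctan_tan) auto
  moreover have "tan (pi / 2 - \<theta>) = cos \<theta> / sin \<theta>"
    by (simp add: tan_def sin_diff cos_diff)
  ultimately show ?thesis by (simp add: arccot_def)
qed

text \<open>Addition formula of the cotangent. The sum of the two angles lies between 0 and 2 pi and
  has to be reduced by pi once it leaves the half period; this is where the quasiperiod of
  \<open>h\<close> enters.\<close>

lemma arccot_add:
  shows "w + x > 0 \<Longrightarrow> arccot ((x * w - 1) / (w + x)) = arccot w + arccot x"
    and "w + x < 0 \<Longrightarrow> arccot ((x * w - 1) / (w + x)) = arccot w + arccot x - pi"
proof -
  define \<theta> where "\<theta> = arccot w + arccot x"
  define r where "r = sqrt (1 + w\<^sup>2) * sqrt (1 + x\<^sup>2)"
  have r: "r > 0" using one_plus_sq_pos[of w] one_plus_sq_pos[of x] by (simp add: r_def)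
  have s: "sin \<theta> = (w + x) / r" and c: "cos \<theta> = (x * w - 1) / r"
    using one_plus_sq_pos[of w] one_plus_sq_pos[of x]
    by (simp_all add: \<theta>_def sin_add cos_add sin_arccot cos_arccot r_def field_simps)
  have b: "0 < \<theta>" "\<theta> < 2 * pi" using arccot_bounds[of w] arccot_bounds[of x] by (auto simp: \<theta>_def)
  have q: "cos \<theta> / sin \<theta> = (x * w - 1) / (w + x)" using r by (simp add: s c)
  show "arccot ((x * w - 1) / (w + x)) = arccot w + arccot x" if "w + x > 0"
  proof -
    have "sin \<theta> > 0" using that r by (simp add: s)
    then have "\<theta> < pi" using b sin_le_zero[of \<theta>] by fastforce
    then show ?thesis using arccot_cot[of \<theta>] b q by (simp add: \<theta>_def)
  qed
  show "arccot ((x * w - 1) / (w + x)) = arccot w + arccot x - pi" if "w + x < 0"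
  proof -
    have "sin \<theta> < 0" using that r by (simp add: s divide_neg_pos)
    then have "\<theta> > pi" using b sin_ge_zero[of \<theta>] by fastforce
    then have "arccot (cos (\<theta> - pi) / sin (\<theta> - pi)) = \<theta> - pi" using b by (intro arccot_cot) auto
    then show ?thesis using q by (simp add: \<theta>_def sin_diff cos_diff)
  qed
qed

text \<open>Transfers the change of variables for absolutely integrable functions to
  \<open>lborel\<close>. Integrability is assumed on the side of the pulled back function because
  that is the side known to be integrable in the application.\<close>

lemma integral_substitution_lborel:
  fixes f :: "real \<Rightarrow> complex" and g h :: "real \<Rightarrow> real"
  assumes S: "S \<in> sets borel" and gS: "g ` S \<in> sets borel"
    and g: "\<And>x. x \<in> S \<Longrightarrow> (g has_real_derivative h x) (at x)" and inj: "inj_on g S"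
    and f: "f \<in> borel_measurable borel"
    and int: "integrable lborel (\<lambda>x. indicator S x *\<^sub>R (\<bar>h x\<bar> *\<^sub>R f (g x)))"
  shows "integrable lborel (\<lambda>y. indicator (g ` S) y *\<^sub>R f y)"
    and "(LINT y|lborel. indicator (g ` S) y *\<^sub>R f y) = (LINT x|lborel. indicator S x *\<^sub>R (\<bar>h x\<bar> *\<^sub>R f (g x)))"
proof -
  have m1: "(\<lambda>x. indicator S x *\<^sub>R (\<bar>h x\<bar> *\<^sub>R f (g x))) \<in> borel_measurable lborel"
    using int by auto
  have m2: "(\<lambda>y. indicator (g ` S) y *\<^sub>R f y) \<in> borel_measurable lborel"
    using f gS by measurable
  have ai: "(\<lambda>x. \<bar>h x\<bar> *\<^sub>R f (g x)) absolutely_integrable_on S"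
    unfolding set_integrable_def using int integrable_completion[OF m1] by simp
  have "f absolutely_integrable_on g ` S \<and> integral (g ` S) f = integral S (\<lambda>x. \<bar>h x\<bar> *\<^sub>R f (g x))"
    using has_absolute_integral_change_of_variables_real[of S g h f "integral S (\<lambda>x. \<bar>h x\<bar> *\<^sub>R f (g x))"]
      S inj ai g by (auto intro: has_field_derivative_at_within)
  then have fa: "f absolutely_integrable_on g ` S" 
    and eq: "integral (g ` S) f = integral S (\<lambda>x. \<bar>h x\<bar> *\<^sub>R f (g x))" by auto
  show "integrable lborel (\<lambda>y. indicator (g ` S) y *\<^sub>R f y)"
    using fa integrable_completion[OF m2] by (simp add: set_integrable_def)
  have "(LINT y|lborel. indicator (g ` S) y *\<^sub>R f y) = integral (g ` S) f"
    using set_lebesgue_integral_eq_integral(2)[OF fa] integral_completion[OF m2]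
    by (simp add: set_lebesgue_integral_def)
  also have "\<dots> = (LINT x|lborel. indicator S x *\<^sub>R (\<bar>h x\<bar> *\<^sub>R f (g x)))"
    using set_lebesgue_integral_eq_integral(2)[OF ai] integral_completion[OF m1] eq
    by (simp add: set_lebesgue_integral_def)
  finally show "(LINT y|lborel. indicator (g ` S) y *\<^sub>R f y) = (LINT x|lborel. indicator S x *\<^sub>R (\<bar>h x\<bar> *\<^sub>R f (g x)))" .
qed

text \<open>Here \<open>v\<close> stands for - 1 / u with u the integration variable of the
  intertwining operator. By \<open>principal_series_cell\<close> the phase sits at u > 0, hence at
  negative \<open>v\<close>.\<close>

definition homogeneous_kernel :: "real \<Rightarrow> complex \<Rightarrow> real \<Rightarrow> complex" where
  "homogeneous_kernel \<sigma> e v = of_real (\<bar>v\<bar> powr (\<sigma> - 1)) * (if v > 0 then 1 else e)"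

lemma measurable_homogeneous_kernel [measurable]: "homogeneous_kernel \<sigma> e \<in> borel_measurable borel"
  unfolding homogeneous_kernel_def[abs_def] by measurable

lemma minus_inverse_image: "(c::real) \<noteq> 0 \<Longrightarrow> (\<lambda>w. - c / (w + x)) ` (- {- x}) = - {0}"
proof safe
  fix v :: real assume "c \<noteq> 0" "v \<notin> (\<lambda>w. - c / (w + x)) ` (- {- x})"
  moreover have "v = - c / ((- c / v - x) + x)" "- c / v - x \<in> - {- x}" if "v \<noteq> 0"
    using that \<open>c \<noteq> 0\<close> by auto
  ultimately show "v = 0" by blast
qed auto

text \<open>The substitution v = - (1 + x^2) / (w + x) makes x + v the cotangent of
  \<open>arccot x + arccot w\<close>, and the powers recombine. Passing from one sign of
  \<open>w + x\<close> to the other changes the kernel by a factor \<open>e\<close> and, by the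
  quasiperiod, \<open>h\<close> by the inverse factor, so the factor \<open>e\<close> comes out
  uniformly.\<close>

lemma homogeneous_kernel_convolution:
  assumes \<sigma>: "0 < \<sigma>" "\<sigma> < 1" and e: "e * e = - 1" and h: "family UNIV (\<lambda>_. h)"
    and per: "\<And>t. h (t + pi) = - e * h t"
  shows "integrable lborel (\<lambda>v. homogeneous_kernel \<sigma> e v * (sin_pow (of_real \<sigma> + 1) (x + v) * h (arccot (x + v))))" (is ?A)
    and "(LINT v|lborel. homogeneous_kernel \<sigma> e v * (sin_pow (of_real \<sigma> + 1) (x + v) * h (arccot (x + v))))
      = e * sin_pow (1 - of_real \<sigma>) x * intertwining_integral (of_real \<sigma>) h (arccot x)" (is ?B)
proof -
  define f where "f v = homogeneous_kernel \<sigma> e v * (sin_pow (of_real \<sigma> + 1) (x + v) * h (arccot (x + v)))" for v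
  define k where "k w = e * sin_pow (1 - of_real \<sigma>) x * (sin_pow (of_real \<sigma> + 1) w * h (arccot x + arccot w))" for w
  define S where "S = - {- x}"
  define g where "g w = - (1 + x\<^sup>2) / (w + x)" for w
  define g' where "g' w = (1 + x\<^sup>2) / (w + x)\<^sup>2" for w
  have r: "1 + x\<^sup>2 > 0" by (rule one_plus_sq_pos)
  have key: "\<bar>g' w\<bar> *\<^sub>R f (g w) = k w" if w: "w \<in> S" for w
  proof -
    have wx: "w + x \<noteq> 0" using w by (auto simp: S_def)
    have y: "x + g w = (x * w - 1) / (w + x)"
      using wx by (simp add: g_def field_simps power2_eq_square)
    have sq: "1 + (x + g w)\<^sup>2 = (1 + x\<^sup>2) * (1 + w\<^sup>2) / (w + x)\<^sup>2"
    proof -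
      have "1 + (x + g w)\<^sup>2 = ((w + x)\<^sup>2 + (x * w - 1)\<^sup>2) / (w + x)\<^sup>2"
        unfolding y using wx by (simp add: power_divide add_divide_distrib)
      also have "(w + x)\<^sup>2 + (x * w - 1)\<^sup>2 = (1 + x\<^sup>2) * (1 + w\<^sup>2)"
        by (simp add: power2_eq_square algebra_simps)
      finally show ?thesis .
    qed
    \<comment> \<open>For \<open>w + x < 0\<close> the angle is reduced by pi; then \<open>h\<close>
      at the reduced angle is \<open>e\<close> times \<open>h\<close> at the sum, because
      \<open>e * e = - 1\<close>. This supplies the \<open>e\<close> that the kernel lacks for
      positive \<open>v\<close>.\<close>
    have ph: "(if g w > 0 then 1 else e) * h (arccot (x + g w)) = e * h (arccot x + arccot w)"
    proof (cases "w + x > 0")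
      case True
      then have "g w < 0" using r by (simp add: g_def divide_neg_pos)
      then show ?thesis using arccot_add(1)[OF True] by (simp add: y add.commute)
    next
      case False
      then have wn: "w + x < 0" using wx by simp
      then have "g w > 0" using r by (simp add: g_def divide_neg_neg)
      moreover have "h (arccot x + arccot w) = - e * h (arccot w + arccot x - pi)"
        using per[of "arccot w + arccot x - pi"] by (simp add: add.commute)
      then have "e * h (arccot x + arccot w) = h (arccot w + arccot x - pi)"
        using e by (simp add: mult.assoc[symmetric])
      ultimately show ?thesis using arccot_add(2)[OF wn] by (simp add: y)
    qed
    have sr: "sin_pow (of_real \<sigma> + 1) z = of_real ((1 + z\<^sup>2) powr (- (\<sigma> + 1) / 2))"
      "sin_pow (1 - of_real \<sigma>) z = of_real ((1 + z\<^sup>2) powr (- (1 - \<sigma>) / 2))" for z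
      using sin_pow_of_real[of "\<sigma> + 1" z] sin_pow_of_real[of "1 - \<sigma>" z] by simp_all
    \<comment> \<open>With all three quantities written as exponentials, the identity between powers
      becomes a linear identity between exponents.\<close>
    define X W D where "X = ln (1 + x\<^sup>2)" and "W = ln (1 + w\<^sup>2)" and "D = ln \<bar>w + x\<bar>"
    have D2: "(w + x)\<^sup>2 = exp (2 * D)" using wx by (simp add: D_def exp_double)
    have Xe: "1 + x\<^sup>2 = exp X" and We: "1 + w\<^sup>2 = exp W" and De: "\<bar>w + x\<bar> = exp D"
      using r one_plus_sq_pos[of w] wx by (simp_all add: X_def W_def D_def)
    have ga: "\<bar>g w\<bar> = exp (X - D)" unfolding g_def abs_divide De abs_minus_cancel
      using r by (simp add: Xe exp_diff)
    have g'a: "\<bar>g' w\<bar> = exp (X - 2 * D)" unfolding g'_def D2 Xe by (simp add: exp_diff)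
    have s2: "1 + (x + g w)\<^sup>2 = exp (X + W - 2 * D)" unfolding sq D2 Xe We by (simp add: exp_diff exp_add)
    have "\<bar>g' w\<bar> * (\<bar>g w\<bar> powr (\<sigma> - 1) * (1 + (x + g w)\<^sup>2) powr (- (\<sigma> + 1) / 2))
      = (1 + x\<^sup>2) powr (- (1 - \<sigma>) / 2) * (1 + w\<^sup>2) powr (- (\<sigma> + 1) / 2)"
      unfolding ga g'a s2 Xe We powr_def by (simp add: exp_add[symmetric] field_simps)
    then have R: "complex_of_real (\<bar>g' w\<bar>) * (of_real (\<bar>g w\<bar> powr (\<sigma> - 1)) * of_real ((1 + (x + g w)\<^sup>2) powr (- (\<sigma> + 1) / 2)))
      = of_real ((1 + x\<^sup>2) powr (- (1 - \<sigma>) / 2)) * of_real ((1 + w\<^sup>2) powr (- (\<sigma> + 1) / 2))"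
      by (simp only: of_real_mult[symmetric])
    have "\<bar>g' w\<bar> *\<^sub>R f (g w) = complex_of_real (\<bar>g' w\<bar>) * (of_real (\<bar>g w\<bar> powr (\<sigma> - 1)) * of_real ((1 + (x + g w)\<^sup>2) powr (- (\<sigma> + 1) / 2)))
       * ((if g w > 0 then 1 else e) * h (arccot (x + g w)))"
      by (simp only: f_def homogeneous_kernel_def sr scaleR_conv_of_real mult_ac)
    also have "\<dots> = k w" unfolding R ph k_def sr by (simp only: mult_ac)
    finally show ?thesis .
  qed
  have fm: "f \<in> borel_measurable borel"
  proof -
    have c: "continuous_on UNIV (\<lambda>v. sin_pow (of_real \<sigma> + 1) (x + v))" "continuous_on UNIV (\<lambda>v. h (arccot (x + v)))"
      using continuous_arccot_compose[OF family_const_continuous[OF h], of 0]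
      by (auto intro!: continuous_on_compose2[OF continuous_on_sin_pow[of UNIV]] continuous_intros
          continuous_on_compose2[of UNIV "\<lambda>z. h (arccot z)" UNIV "\<lambda>v. x + v"])
    show ?thesis unfolding f_def[abs_def]
      by (intro borel_measurable_times measurable_homogeneous_kernel borel_measurable_continuous_onI c)
  qed
  have ki: "integrable lborel k"
    unfolding k_def[abs_def] using integrable_intertwining[of "of_real \<sigma>" h "arccot x"] \<sigma> h by auto
  have AES: "AE w in lborel. w \<in> S"
    using AE_lborel_singleton[of "- x"] by eventually_elim (simp add: S_def)
  have Sb: "S \<in> sets borel" by (simp add: S_def)
  have fSe: "(\<lambda>w. indicator S w *\<^sub>R (\<bar>g' w\<bar> *\<^sub>R f (g w))) = (\<lambda>w. indicator S w *\<^sub>R k w)"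
    using key by (auto simp: indicator_def)
  have fi: "integrable lborel (\<lambda>w. indicator S w *\<^sub>R k w)"
    using ki Sb by (intro integrable_mult_indicator) auto
  have fI: "(LINT w|lborel. indicator S w *\<^sub>R k w) = (LINT w|lborel. k w)"
    using AES fi ki by (intro integral_cong_AE) auto
  have gS: "g ` S = - {0}" using minus_inverse_image[of "1 + x\<^sup>2" x] r by (simp add: g_def[abs_def] S_def)
  have inj: "inj_on g S" using r by (auto simp: inj_on_def g_def S_def field_simps)
  have der: "(g has_real_derivative g' w) (at w)" if "w \<in> S" for w
    using that unfolding g_def[abs_def] g'_def S_def 
    by (auto intro!: derivative_eq_intros simp: field_simps power2_eq_square)
  note sub = integral_substitution_lborel[OF Sb _ der inj fm, unfolded fSe, OF _ _ fi, unfolded gS]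
  have sub1: "integrable lborel (\<lambda>y. indicator (- {0}) y *\<^sub>R f y)" 
    and sub2: "(LINT y|lborel. indicator (- {0}) y *\<^sub>R f y) = (LINT w|lborel. indicator S w *\<^sub>R k w)"
    using sub by auto
  have AE0: "AE v in lborel. indicator (- {0}) v *\<^sub>R f v = f v"
    using AE_lborel_singleton[of 0] by eventually_elim simp
  have "integrable lborel f"
    using integrable_cong_AE[OF _ _ AE0] sub1 fm by auto
  then show ?A by (simp add: f_def[abs_def])
  have "(LINT v|lborel. f v) = (LINT y|lborel. indicator (- {0}) y *\<^sub>R f y)"
    using AE0 sub1 fm by (intro integral_cong_AE) auto
  also have "\<dots> = (LINT w|lborel. k w)" using sub2 fI by simp
  also have "\<dots> = e * sin_pow (1 - of_real \<sigma>) x * intertwining_integral (of_real \<sigma>) h (arccot x)"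
    by (simp add: k_def intertwining_integral_def)
  finally show ?B by (simp add: f_def)
qed

section \<open>Truncated Fourier transforms of the kernel and the functional equation on (0,
  1)\<close>

lemma incomplete_gamma_nonpos: "B \<le> 0 \<Longrightarrow> incomplete_gamma \<sigma> z B = 0"
  by (simp add: incomplete_gamma_def)

lemma incomplete_gamma_bounded:
  assumes \<sigma>: "0 < \<sigma>" "\<sigma> < 1" and z: "Re z \<ge> 0" "z \<noteq> 0"
  obtains M where "\<And>B. norm (incomplete_gamma \<sigma> z B) \<le> M"
proof -
  define I where "I = (LINT v|lborel. norm (mellin_integrand \<sigma> z v))"
  have "norm (incomplete_gamma \<sigma> z B) \<le> (1 + 2 / norm z) + (1 - \<sigma>) * I" for B
  proof (cases "B > 0")
    case True
    define q where "q = (1 - exp (- (z * of_real B))) / z"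
    have q: "norm q \<le> B" "norm q \<le> 2 / norm z"
      unfolding q_def norm_divide using norm_one_minus_exp_le[of "z * of_real B"] z True
      by (auto simp: norm_mult divide_le_eq mult.commute divide_right_mono)
    have "norm (of_real (B powr (\<sigma> - 1)) * q) \<le> 1 + 2 / norm z"
    proof (cases "B \<le> 1")
      case B1: True
      have "norm (of_real (B powr (\<sigma> - 1)) * q) \<le> B powr (\<sigma> - 1) * B"
        using q by (simp add: norm_mult mult_left_mono)
      also have "\<dots> = B powr \<sigma>" using powr_add[of B "\<sigma> - 1" 1] True by simp
      also have "\<dots> \<le> 1" using powr_le1[of \<sigma> B] \<sigma> True B1 by simp
      finally show ?thesis by (smt (verit) divide_nonneg_nonneg norm_ge_zero)
    next
      case False
      have "B powr (\<sigma> - 1) \<le> B powr 0" using False \<sigma> by (intro powr_mono) auto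
      then have "B powr (\<sigma> - 1) \<le> 1" using True by simp
      then have "B powr (\<sigma> - 1) * norm q \<le> 1 * (2 / norm z)"
        using q by (intro mult_mono) auto
      then show ?thesis by (simp add: norm_mult)
    qed
    moreover have "norm (LINT v|lborel. indicator {..<B} v *\<^sub>R mellin_integrand \<sigma> z v) \<le> I"
      unfolding I_def
    proof (rule Bochner_Integration.integral_norm_bound_integral)
      show "integrable lborel (\<lambda>v. indicator {..<B} v *\<^sub>R mellin_integrand \<sigma> z v)"
        using integrable_mellin[OF \<sigma> z] by (intro integrable_mult_indicator) auto
      show "integrable lborel (\<lambda>v. norm (mellin_integrand \<sigma> z v))"
        using integrable_mellin[OF \<sigma> z] by (rule integrable_norm)
    qed (auto simp: indicator_def)
    then have "norm (of_real (1 - \<sigma>) * (LINT v|lborel. indicator {..<B} v *\<^sub>R mellin_integrand \<sigma> z v)) \<le> (1 - \<sigma>) * I"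
      unfolding norm_mult norm_of_real using \<sigma> by (simp add: mult_left_mono)
    ultimately show ?thesis
      unfolding incomplete_gamma_eq[OF \<sigma> z True] q_def[symmetric] by (rule norm_triangle_mono)
  next
    case False
    have "I \<ge> 0" unfolding I_def by (intro Bochner_Integration.integral_nonneg) auto
    then have "0 \<le> (1 - \<sigma>) * I" using \<sigma> by simp
    then show ?thesis using False by (simp add: incomplete_gamma_nonpos add_nonneg_nonneg)
  qed
  then show ?thesis by (rule that)
qed

lemma incomplete_gamma_imaginary_tendsto:
  assumes \<sigma>: "0 < \<sigma>" "\<sigma> < 1" and a: "a \<noteq> 0"
  shows "(incomplete_gamma \<sigma> (- \<i> * of_real a) \<longlongrightarrow> Gamma (of_real \<sigma>) * (- \<i> * of_real a) powr (- of_real \<sigma>)) at_top"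
  using incomplete_gamma_tendsto[OF \<sigma>, of "- \<i> * of_real a"] a unfolding mellin_imaginary[OF \<sigma> a] by simp

text \<open>The character is not inverted here: substituting x = y - v in the truncated Whittaker
  integral gives \<open>inverse (psi a x) = psi a v * inverse (psi a y)\<close>.\<close>

definition kernel_transform :: "real \<Rightarrow> complex \<Rightarrow> real \<Rightarrow> real \<Rightarrow> real \<Rightarrow> complex" where
  "kernel_transform \<sigma> e a \<alpha> \<beta> = (LINT v|lborel. indicator {\<alpha><..<\<beta>} v *\<^sub>R (homogeneous_kernel \<sigma> e v * psi a v))"

text \<open>The interval is split at 0, and reflection of the negative part replaces
  \<open>a\<close> by \<open>- a\<close>. As \<open>incomplete_gamma\<close> vanishes for
  nonpositive upper limits, one formula covers every position of the interval relative to 0.\<close>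

lemma kernel_transform_eq:
  assumes \<sigma>: "0 < \<sigma>" "\<sigma> < 1" and ab: "\<alpha> < \<beta>"
  shows "kernel_transform \<sigma> e a \<alpha> \<beta> =
    (incomplete_gamma \<sigma> (- \<i> * of_real a) \<beta> - incomplete_gamma \<sigma> (- \<i> * of_real a) \<alpha>)
    + e * (incomplete_gamma \<sigma> (- \<i> * of_real (- a)) (- \<alpha>) - incomplete_gamma \<sigma> (- \<i> * of_real (- a)) (- \<beta>))"
proof -
  define p where "p a B v = indicator {0<..<B} v *\<^sub>R (of_real (v powr (\<sigma> - 1)) * exp (- (- \<i> * complex_of_real a * of_real v)))" for a B v :: real
  have pi: "integrable lborel (p a B)" for a B
    unfolding p_def[abs_def] by (rule incomplete_gamma_integrable) (use \<sigma> in auto)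
  have pi': "integrable lborel (\<lambda>v. p a B (- v))" for a B
    using lborel_integrable_real_affine[OF pi[of a B], of "- 1" 0] by simp
  have pI: "(LINT v|lborel. p a B v) = incomplete_gamma \<sigma> (- \<i> * of_real a) B" for a B
    by (simp add: p_def incomplete_gamma_def)
  have pI': "(LINT v|lborel. p a B (- v)) = incomplete_gamma \<sigma> (- \<i> * of_real a) B" for a B
    using lborel_integral_real_affine[of "- 1" "p a B" 0] by (simp add: pI)
  have AEn: "AE v in lborel. v \<noteq> 0 \<and> v \<noteq> \<alpha> \<and> v \<noteq> \<beta>"
    using AE_lborel_singleton[of 0] AE_lborel_singleton[of \<alpha>] AE_lborel_singleton[of \<beta>] by eventually_elim simp
  have "kernel_transform \<sigma> e a \<alpha> \<beta> = (LINT v|lborel. (p a \<beta> v - p a \<alpha> v) + e * (p (- a) (- \<alpha>) (- v) - p (- a) (- \<beta>) (- v)))"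
    unfolding kernel_transform_def
  proof (rule integral_cong_AE)
    show "(\<lambda>v. indicator {\<alpha><..<\<beta>} v *\<^sub>R (homogeneous_kernel \<sigma> e v * psi a v)) \<in> borel_measurable lborel"
      unfolding psi_def by measurable
    show "(\<lambda>v. (p a \<beta> v - p a \<alpha> v) + e * (p (- a) (- \<alpha>) (- v) - p (- a) (- \<beta>) (- v))) \<in> borel_measurable lborel"
      using pi pi' by (intro borel_measurable_add borel_measurable_diff borel_measurable_times) auto
    show "AE v in lborel. indicator {\<alpha><..<\<beta>} v *\<^sub>R (homogeneous_kernel \<sigma> e v * psi a v) =
        (p a \<beta> v - p a \<alpha> v) + e * (p (- a) (- \<alpha>) (- v) - p (- a) (- \<beta>) (- v))"
      using AEn
    proof eventually_elim
      case (elim v)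
      have "psi a v = exp (- (- \<i> * complex_of_real a * of_real v))" by (simp add: psi_def mult_ac)
      moreover have "psi a v = exp (- (- \<i> * complex_of_real (- a) * of_real (- v)))" by (simp add: psi_def mult_ac)
      ultimately show ?case using elim ab
        by (auto simp: p_def homogeneous_kernel_def indicator_def)
    qed
  qed
  also have "\<dots> = (incomplete_gamma \<sigma> (- \<i> * of_real a) \<beta> - incomplete_gamma \<sigma> (- \<i> * of_real a) \<alpha>)
    + e * (incomplete_gamma \<sigma> (- \<i> * of_real (- a)) (- \<alpha>) - incomplete_gamma \<sigma> (- \<i> * of_real (- a)) (- \<beta>))"
    using pi pi' pI pI' by simp
  finally show ?thesis .
qed

text \<open>The Fourier transform of the kernel divided by \<open>Gamma s\<close>; this quotient is
  entire in \<open>s\<close>, as the identity theorem requires.\<close>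

definition kernel_factor :: "complex \<Rightarrow> complex \<Rightarrow> real \<Rightarrow> complex" where
  "kernel_factor s e a = (- \<i> * of_real a) powr (- s) + e * (- \<i> * of_real (- a)) powr (- s)"

lemma kernel_transform_tendsto:
  assumes \<sigma>: "0 < \<sigma>" "\<sigma> < 1" and a: "a \<noteq> 0"
  shows "((\<lambda>R. kernel_transform \<sigma> e a (y - R) (y + R)) \<longlongrightarrow> Gamma (of_real \<sigma>) * kernel_factor (of_real \<sigma>) e a) at_top"
proof -
  let ?P = "\<lambda>a. incomplete_gamma \<sigma> (- \<i> * of_real a)"
  let ?L = "\<lambda>a. Gamma (of_real \<sigma>) * (- \<i> * complex_of_real a) powr (- of_real \<sigma>)"
  have f: "filterlim (\<lambda>R. y + R) at_top at_top" "filterlim (\<lambda>R. R - y) at_top at_top" by real_asymp+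
  have "((\<lambda>R. ?P a (y + R) + e * ?P (- a) (R - y)) \<longlongrightarrow> ?L a + e * ?L (- a)) at_top"
    using filterlim_compose[OF incomplete_gamma_imaginary_tendsto[OF \<sigma> a] f(1)]
      filterlim_compose[OF incomplete_gamma_imaginary_tendsto[OF \<sigma>, of "- a"] f(2)] a
    by (intro tendsto_intros) auto
  moreover have "eventually (\<lambda>R. ?P a (y + R) + e * ?P (- a) (R - y) = kernel_transform \<sigma> e a (y - R) (y + R)) at_top"
    using eventually_gt_at_top[of "\<bar>y\<bar>"]
  proof eventually_elim
    case (elim R)
    then have "y - R < y + R" "y - R \<le> 0" "- (y + R) \<le> 0" by auto
    then show ?case by (simp add: kernel_transform_eq[OF \<sigma>] incomplete_gamma_nonpos)
  qed
  ultimately have "((\<lambda>R. kernel_transform \<sigma> e a (y - R) (y + R)) \<longlongrightarrow> ?L a + e * ?L (- a)) at_top"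
    by (rule Lim_transform_eventually)
  then show ?thesis by (simp add: kernel_factor_def algebra_simps)
qed

text \<open>After Fubini the interval is centred at the outer variable, so the dominating constant
  must hold for all intervals at once.\<close>

lemma kernel_transform_bounded:
  assumes \<sigma>: "0 < \<sigma>" "\<sigma> < 1" and a: "a \<noteq> 0"
  obtains M where "\<And>\<alpha> \<beta>. \<alpha> < \<beta> \<Longrightarrow> norm (kernel_transform \<sigma> e a \<alpha> \<beta>) \<le> M"
proof -
  obtain M1 where M1: "\<And>B. norm (incomplete_gamma \<sigma> (- \<i> * of_real a) B) \<le> M1"
    using incomplete_gamma_bounded[OF \<sigma>, of "- \<i> * of_real a"] a by auto
  obtain M2 where M2: "\<And>B. norm (incomplete_gamma \<sigma> (- \<i> * of_real (- a)) B) \<le> M2"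
    using incomplete_gamma_bounded[OF \<sigma>, of "- \<i> * of_real (- a)"] a by auto
  have "norm (kernel_transform \<sigma> e a \<alpha> \<beta>) \<le> (M1 + M1) + norm e * (M2 + M2)" if "\<alpha> < \<beta>" for \<alpha> \<beta>
    unfolding kernel_transform_eq[OF \<sigma> that]
  proof (rule norm_triangle_mono)
    show "norm (incomplete_gamma \<sigma> (- \<i> * of_real a) \<beta> - incomplete_gamma \<sigma> (- \<i> * of_real a) \<alpha>) \<le> M1 + M1"
      using norm_triangle_ineq4 M1 by (meson add_mono order_trans)
    have "norm (incomplete_gamma \<sigma> (- \<i> * of_real (- a)) (- \<alpha>) - incomplete_gamma \<sigma> (- \<i> * of_real (- a)) (- \<beta>)) \<le> M2 + M2"
      using norm_triangle_ineq4 M2 by (meson add_mono order_trans)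
    then show "norm (e * (incomplete_gamma \<sigma> (- \<i> * of_real (- a)) (- \<alpha>) - incomplete_gamma \<sigma> (- \<i> * of_real (- a)) (- \<beta>))) \<le> norm e * (M2 + M2)"
      unfolding norm_mult by (intro mult_left_mono) auto
  qed
  then show ?thesis by (rule that)
qed

text \<open>The truncation of \<open>x\<close> to a bounded interval is what makes the double
  integral absolutely convergent: over all of the line the kernel is not integrable.\<close>

lemma kernel_fubini:
  assumes \<sigma>: "0 < \<sigma>" "\<sigma> < 1" and \<phi>: "integrable lborel \<phi>"
  shows "(LINT x|lborel. indicator {-R<..<R} x *\<^sub>R (inverse (psi a x) * (LINT v|lborel. homogeneous_kernel \<sigma> e v * \<phi> (x + v))))
    = (LINT y|lborel. kernel_transform \<sigma> e a (y - R) (y + R) * (inverse (psi a y) * \<phi> y))"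
proof -
  define F where "F y x = indicator {-R<..<R} x *\<^sub>R (inverse (psi a x) * (homogeneous_kernel \<sigma> e (y - x) * \<phi> y))" for x y
  have \<phi>m [measurable]: "\<phi> \<in> borel_measurable borel" using \<phi> by auto
  have Fm: "case_prod F \<in> borel_measurable (lborel \<Otimes>\<^sub>M lborel)"
    unfolding F_def psi_def case_prod_beta' by measurable
  define C where "C = 1 + norm e"
  define k1 where "k1 v = indicator {0<..1} v *\<^sub>R (v powr (\<sigma> - 1))" for v :: real
  have k1i: "integrable lborel k1" unfolding k1_def[abs_def] using \<sigma> by (intro integrable_powr_near_0) auto
  \<comment> \<open>The kernel is bounded for \<bar>v\<bar> \<ge> 1 and integrable near 0, so on the
    bounded range of \<open>x\<close> it is dominated by \<open>b y x\<close>. By translation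
    invariance the integral of \<open>b y\<close> is the same number \<open>D\<close> for every
    \<open>y\<close>.\<close>
  define b where "b y x = C * (indicator {-R<..<R} x + (k1 (y - x) + k1 (x - y)))" for x y
  have k1t: "integrable lborel (\<lambda>x. k1 (y - x))" "integrable lborel (\<lambda>x. k1 (x - y))" for y
    using lborel_integrable_real_affine[OF k1i, of "- 1" y] lborel_integrable_real_affine[OF k1i, of 1 "- y"] by simp_all
  have k1I: "(LINT x|lborel. k1 (y - x)) = (LINT x|lborel. k1 x)" "(LINT x|lborel. k1 (x - y)) = (LINT x|lborel. k1 x)" for y
    using lborel_integral_real_affine[of "- 1" k1 y] lborel_integral_real_affine[of 1 k1 "- y"] by simp_all
  have ii: "integrable lborel (indicator {-R<..<R} :: real \<Rightarrow> real)"
    by (cases "-R \<le> R") (auto intro!: integrable_real_indicator)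
  have bi: "integrable lborel (b y)" for y
    unfolding b_def[abs_def] using k1t[of y] ii by (intro integrable_mult_right Bochner_Integration.integrable_add) auto
  define D where "D = C * ((LINT x|lborel. indicator {-R<..<R} x) + ((LINT x|lborel. k1 x) + (LINT x|lborel. k1 x)))"
  have bI: "(LINT x|lborel. b y x) = D" for y
    unfolding b_def D_def using k1t[of y] k1I[of y] ii by simp
  have k1pos: "k1 v \<ge> 0" for v by (simp add: k1_def)
  have kb: "norm (homogeneous_kernel \<sigma> e v) \<le> C * (1 + (k1 v + k1 (- v)))" for v
  proof -
    have "\<bar>v\<bar> powr (\<sigma> - 1) \<le> 1 + (k1 v + k1 (- v))"
    proof (cases "\<bar>v\<bar> \<le> 1")
      case True
      then show ?thesis using k1pos[of v] k1pos[of "- v"] by (cases "v = 0") (auto simp: k1_def indicator_def)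
    next
      case False
      then have "\<bar>v\<bar> powr (\<sigma> - 1) \<le> \<bar>v\<bar> powr 0" using \<sigma> by (intro powr_mono) auto
      then show ?thesis using False k1pos[of v] k1pos[of "- v"] by (auto split: if_splits)
    qed
    then have "\<bar>v\<bar> powr (\<sigma> - 1) * norm (if v > 0 then 1 else e) \<le> (1 + (k1 v + k1 (- v))) * C"
      using k1pos[of v] k1pos[of "- v"] by (intro mult_mono) (auto simp: C_def)
    then show ?thesis by (simp add: homogeneous_kernel_def norm_mult mult.commute)
  qed
  have Fb: "norm (F y x) \<le> b y x * norm (\<phi> y)" for x y
  proof (cases "x \<in> {-R<..<R}")
    case True
    have "norm (homogeneous_kernel \<sigma> e (y - x)) \<le> b y x"
      using kb[of "y - x"] True by (simp add: b_def)
    then show ?thesis using True by (simp add: F_def norm_mult mult_right_mono)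
  next
    case False
    have "C \<ge> 0" by (simp add: C_def)
    then show ?thesis using False k1pos by (auto simp: F_def b_def intro!: mult_nonneg_nonneg add_nonneg_nonneg)
  qed
  have Fmy: "F y \<in> borel_measurable lborel" for y unfolding F_def psi_def by measurable
  have Fi: "integrable lborel (F y)" for y
    by (rule Bochner_Integration.integrable_bound[OF integrable_mult_left[OF bi[of y], of "norm (\<phi> y)"] Fmy])
       (use Fb[of y] in \<open>auto intro!: AE_I2 intro: order_trans[OF _ abs_ge_self]\<close>)
  have Fprod: "integrable (lborel \<Otimes>\<^sub>M lborel) (case_prod F)"
  proof (rule lborel_pair.Fubini_integrable[OF Fm])
    show "integrable lborel (\<lambda>y. LINT x|lborel. norm (case_prod F (y, x)))"
    proof (rule Bochner_Integration.integrable_bound[of _ "\<lambda>y. D * norm (\<phi> y)"])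
      show "integrable lborel (\<lambda>y. D * norm (\<phi> y))" using \<phi> by auto
      show "(\<lambda>y. LINT x|lborel. norm (case_prod F (y, x))) \<in> borel_measurable lborel"
        using Fm by measurable
      show "AE y in lborel. norm (LINT x|lborel. norm (case_prod F (y, x))) \<le> norm (D * norm (\<phi> y))"
      proof (rule AE_I2)
        fix y
        have "(LINT x|lborel. norm (F y x)) \<le> (LINT x|lborel. b y x * norm (\<phi> y))"
          using Fi[of y] bi[of y] Fb[of y] by (intro integral_mono) auto
        also have "\<dots> = D * norm (\<phi> y)" using bI[of y] by simp
        finally have "(LINT x|lborel. norm (F y x)) \<le> D * norm (\<phi> y)" .
        moreover have "0 \<le> (LINT x|lborel. norm (F y x))" by (intro Bochner_Integration.integral_nonneg) auto
        ultimately show "norm (LINT x|lborel. norm (case_prod F (y, x))) \<le> norm (D * norm (\<phi> y))" by simp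
      qed
    qed
  qed (use Fi in simp)
  have "(LINT x|lborel. LINT y|lborel. F y x) = (LINT y|lborel. LINT x|lborel. F y x)"
    by (rule lborel_pair.Fubini_integral[OF Fprod])
  moreover have "(LINT y|lborel. F y x) = indicator {-R<..<R} x *\<^sub>R (inverse (psi a x) * (LINT v|lborel. homogeneous_kernel \<sigma> e v * \<phi> (x + v)))" for x
    using lborel_integral_real_affine[of 1 "\<lambda>y. homogeneous_kernel \<sigma> e (y - x) * \<phi> y" x]
    by (simp add: F_def)
  moreover have "(LINT x|lborel. F y x) = kernel_transform \<sigma> e a (y - R) (y + R) * (inverse (psi a y) * \<phi> y)" for y
  proof -
    have "(LINT x|lborel. F y x) = (LINT v|lborel. F y (y - v))"
      using lborel_integral_real_affine[of "- 1" "F y" y] by simp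
    also have "\<dots> = (LINT v|lborel. indicator {y - R<..<y + R} v *\<^sub>R (homogeneous_kernel \<sigma> e v * psi a v) * (inverse (psi a y) * \<phi> y))"
    proof (rule Bochner_Integration.integral_cong[OF refl])
      fix v
      have "inverse (psi a (y - v)) = psi a v * inverse (psi a y)"
        by (simp add: psi_def exp_minus[symmetric] exp_add[symmetric] algebra_simps)
      moreover have "indicator {-R<..<R} (y - v) = (indicator {y - R<..<y + R} v :: real)" by (auto simp: indicator_def)
      ultimately show "F y (y - v) = indicator {y - R<..<y + R} v *\<^sub>R (homogeneous_kernel \<sigma> e v * psi a v) * (inverse (psi a y) * \<phi> y)"
        by (simp add: F_def mult_ac)
    qed
    also have "\<dots> = kernel_transform \<sigma> e a (y - R) (y + R) * (inverse (psi a y) * \<phi> y)"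
      unfolding kernel_transform_def by (rule integral_mult_left_zero)
    finally show ?thesis .
  qed
  ultimately show ?thesis by simp
qed

text \<open>At the parameter \<open>- of_real \<sigma>\<close> the integrand has order \<bar>x\<bar>
  to the power \<open>\<sigma> - 1\<close> and tends to 0, but absolute integrability may fail. One
  integration by parts on (- R, R) leaves an absolutely convergent integral, which is the one-step
  continuation \<open>whittaker_iter 1\<close>.\<close>

lemma truncated_whittaker_tendsto:
  assumes \<sigma>: "0 < \<sigma>" "\<sigma> < 1" and a: "a \<noteq> 0" and k: "family UNIV (\<lambda>_. k)"
  shows "((\<lambda>R. LINT x|lborel. indicator {-R<..<R} x *\<^sub>R (sin_pow (1 - of_real \<sigma>) x * (inverse (psi a x) * k (arccot x))))
    \<longlongrightarrow> whittaker_entire a (- of_real \<sigma>) k) at_top"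
proof -
  let ?s = "- complex_of_real \<sigma>"
  define F where "F x = sin_pow (?s + 1) x * (inverse (psi a x) * k (arccot x))" for x
  define G where "G x = sin_pow (?s + 1 + 1) x * (inverse (psi a x) * whittaker_shift ?s k (arccot x))" for x
  have k': "family UNIV (\<lambda>_. whittaker_shift ?s k)" by (rule family_const_whittaker_shift[OF k])
  have der: "(F has_vector_derivative G x - \<i> * of_real a * F x) (at x)" for x
    using whittaker_integrand_has_vector_derivative[OF k, of ?s a x] by (simp only: F_def[abs_def] G_def)
  obtain B where B: "\<And>t. norm (k t) \<le> B" using family_const_bound[OF k] by blast
  obtain B' where B': "\<And>t. norm (whittaker_shift ?s k t) \<le> B'" using family_const_bound[OF k'] by blast
  have lim: "(F \<longlongrightarrow> 0) at_bot" "(F \<longlongrightarrow> 0) at_top"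
    unfolding F_def[abs_def] using \<sigma> B
    by (intro sin_pow_mult_tendsto_0[where B = B]; simp add: norm_mult)+
  have cF: "continuous_on UNIV F" and cG: "continuous_on UNIV G"
    unfolding F_def[abs_def] G_def[abs_def]
    using continuous_arccot_compose[OF family_const_continuous[OF k], of 0] 
      continuous_arccot_compose[OF family_const_continuous[OF k'], of 0]
    by (auto intro!: continuous_intros continuous_on_inverse_psi)
  have Gi: "integrable lborel G"
    unfolding G_def[abs_def] using \<sigma> B' continuous_arccot_compose[OF family_const_continuous[OF k'], of 0]
    by (intro integrable_sin_pow_mult[of _ _ B']) (auto simp: norm_mult intro!: continuous_intros continuous_on_inverse_psi)
  have ind: "integrable lborel (\<lambda>x. indicator {-R<..<R} x *\<^sub>R H x)" if "continuous_on UNIV H" for H :: "real \<Rightarrow> complex" and R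
  proof -
    have "set_integrable lborel {-R..R} H" by (rule borel_integrable_atLeastAtMost') (rule continuous_on_subset[OF that], simp)
    then have "set_integrable lborel {-R<..<R} H" by (rule set_integrable_subset) auto
    then show ?thesis by (simp add: set_integrable_def)
  qed
  have eq: "(LINT x|lborel. indicator {-R<..<R} x *\<^sub>R F x) 
      = inverse (\<i> * of_real a) * ((LINT x|lborel. indicator {-R<..<R} x *\<^sub>R G x) - (F R - F (- R)))" if R: "R > 0" for R
  proof -
    have "(LBINT x=ereal (- R)..ereal R. G x - \<i> * of_real a * F x) = F R - F (- R)"
      using R by (intro interval_integral_FTC_finite)
        (auto intro!: continuous_on_subset[OF cF] continuous_on_subset[OF cG] continuous_intros has_vector_derivative_at_within der)
    then have "(LINT x|lborel. indicator {-R<..<R} x *\<^sub>R (G x - \<i> * of_real a * F x)) = F R - F (- R)"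
      using R by (simp add: interval_lebesgue_integral_def set_lebesgue_integral_def einterval_eq)
    also have "(\<lambda>x. indicator {-R<..<R} x *\<^sub>R (G x - \<i> * of_real a * F x)) = 
        (\<lambda>x. indicator {-R<..<R} x *\<^sub>R G x - \<i> * of_real a * (indicator {-R<..<R} x *\<^sub>R F x))"
      by (auto simp: indicator_def)
    finally have "(LINT x|lborel. indicator {-R<..<R} x *\<^sub>R G x) - \<i> * of_real a * (LINT x|lborel. indicator {-R<..<R} x *\<^sub>R F x) = F R - F (- R)"
      by (simp only: Bochner_Integration.integral_diff[OF ind[OF cG] integrable_mult_right[OF ind[OF cF]]] integral_mult_right_zero)
    then show ?thesis using a by (simp add: field_simps)
  qed
  have "((\<lambda>R. LINT x|lborel. indicator {-R<..<R} x *\<^sub>R G x) \<longlongrightarrow> (LINT x|lborel. G x)) at_top"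
  proof (rule truncated_integral_tendsto[OF Gi])
    fix x :: real
    show "eventually (\<lambda>R. x \<in> {-R<..<R}) at_top"
      using eventually_gt_at_top[of "\<bar>x\<bar>"] by eventually_elim auto
  qed auto
  moreover have "((\<lambda>R. F R - F (- R)) \<longlongrightarrow> 0 - 0) at_top"
    by (intro tendsto_diff lim filterlim_compose[OF lim(1) filterlim_uminus_at_bot_at_top])
  ultimately have "((\<lambda>R. inverse (\<i> * of_real a) * ((LINT x|lborel. indicator {-R<..<R} x *\<^sub>R G x) - (F R - F (- R))))
     \<longlongrightarrow> inverse (\<i> * of_real a) * ((LINT x|lborel. G x) - (0 - 0))) at_top"
    by (rule tendsto_mult_left[OF tendsto_diff])
  moreover have "eventually (\<lambda>R. inverse (\<i> * of_real a) * ((LINT x|lborel. indicator {-R<..<R} x *\<^sub>R G x) - (F R - F (- R)))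
      = (LINT x|lborel. indicator {-R<..<R} x *\<^sub>R F x)) at_top"
    using eventually_gt_at_top[of 0] by eventually_elim (simp add: eq)
  ultimately have "((\<lambda>R. LINT x|lborel. indicator {-R<..<R} x *\<^sub>R F x) \<longlongrightarrow> inverse (\<i> * of_real a) * ((LINT x|lborel. G x) - (0 - 0))) at_top"
    by (rule Lim_transform_eventually)
  moreover have "whittaker_entire a ?s k = inverse (\<i> * of_real a) * (LINT x|lborel. G x)"
    using whittaker_entire_eq[of 1 ?s a k] \<sigma> a k by (simp add: G_def whittaker_integral_def)
  ultimately show ?thesis by (simp add: F_def)
qed

lemma functional_equation_segment:
  assumes \<sigma>: "0 < \<sigma>" "\<sigma> < 1" and a: "a \<noteq> 0" and e: "e * e = - 1" and h: "family UNIV (\<lambda>_. h)"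
    and per: "\<And>t. h (t + pi) = - e * h t"
  shows "e * whittaker_entire a (- of_real \<sigma>) (intertwining_entire (of_real \<sigma>) h)
    = kernel_factor (of_real \<sigma>) e a * whittaker_entire a (of_real \<sigma>) h"
proof -
  let ?s = "complex_of_real \<sigma>"
  define k where "k = intertwining_entire ?s h"
  have k: "family UNIV (\<lambda>_. k)" unfolding k_def by (rule family_at[OF family_intertwining_entire[OF h]]) simp
  define \<phi> where "\<phi> y = sin_pow (?s + 1) y * h (arccot y)" for y
  have \<phi>: "integrable lborel \<phi>"
    using integrable_intertwining[of ?s h 0] \<sigma> h by (simp add: \<phi>_def[abs_def])
  have G0: "rGamma ?s \<noteq> 0" using \<sigma> by (auto simp: rGamma_eq_zero_iff nonpos_Ints_def dest: arg_cong[of _ _ Re])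
  have Gr: "Gamma ?s * rGamma ?s = 1" using G0 by (simp add: rGamma_inverse_Gamma)
  have conv: "(LINT v|lborel. homogeneous_kernel \<sigma> e v * \<phi> (x + v)) = e * Gamma ?s * (sin_pow (1 - ?s) x * k (arccot x))" for x
  proof -
    have "intertwining_integral ?s h (arccot x) = Gamma ?s * k (arccot x)"
      using intertwining_entire_pos[of ?s h] \<sigma> h Gr by (simp add: k_def mult.assoc[symmetric])
    then show ?thesis using homogeneous_kernel_convolution(2)[OF \<sigma> e h per, of x] by (simp add: \<phi>_def)
  qed
  \<comment> \<open>Left side of \<open>kernel_fubini\<close>: the inner convolution is the
    intertwining integral, so the truncations converge to the continued Whittaker
    functional.\<close>
  have L: "((\<lambda>R. LINT x|lborel. indicator {-R<..<R} x *\<^sub>R (inverse (psi a x) * (LINT v|lborel. homogeneous_kernel \<sigma> e v * \<phi> (x + v))))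
     \<longlongrightarrow> e * Gamma ?s * whittaker_entire a (- ?s) k) at_top"
  proof -
    have "(\<lambda>R. LINT x|lborel. indicator {-R<..<R} x *\<^sub>R (inverse (psi a x) * (LINT v|lborel. homogeneous_kernel \<sigma> e v * \<phi> (x + v))))
      = (\<lambda>R. e * Gamma ?s * (LINT x|lborel. indicator {-R<..<R} x *\<^sub>R (sin_pow (1 - ?s) x * (inverse (psi a x) * k (arccot x)))))"
      unfolding conv integral_mult_right_zero[symmetric] by (simp add: mult_ac)
    then show ?thesis using tendsto_mult_left[OF truncated_whittaker_tendsto[OF \<sigma> a k], of "e * Gamma ?s"] by simp
  qed
  obtain M where M: "\<And>\<alpha> \<beta>. \<alpha> < \<beta> \<Longrightarrow> norm (kernel_transform \<sigma> e a \<alpha> \<beta>) \<le> M"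
    using kernel_transform_bounded[OF \<sigma> a] by blast
  have "(\<lambda>y. inverse (psi a y)) \<in> borel_measurable lborel"
    using borel_measurable_continuous_onI[OF continuous_on_inverse_psi] by simp
  then have "(\<lambda>y. inverse (psi a y) * \<phi> y) \<in> borel_measurable lborel"
    using \<phi> by (intro borel_measurable_times) auto
  then have \<psi>\<phi>: "integrable lborel (\<lambda>y. inverse (psi a y) * \<phi> y)"
    by (rule Bochner_Integration.integrable_bound[OF \<phi>]) (simp add: norm_mult)
  \<comment> \<open>Right side of \<open>kernel_fubini\<close>: the transform is bounded uniformly
    in \<open>y\<close> and \<open>R\<close> and \<open>\<phi>\<close> is integrable, so the limit
    passes under the integral sign.\<close>
  have R: "((\<lambda>R. LINT y|lborel. kernel_transform \<sigma> e a (y - R) (y + R) * (inverse (psi a y) * \<phi> y))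
     \<longlongrightarrow> (LINT y|lborel. Gamma ?s * kernel_factor (of_real \<sigma>) e a * (inverse (psi a y) * \<phi> y))) at_top"
  proof (rule integral_dominated_convergence_at_top[where w = "\<lambda>y. M * norm (\<phi> y)"])
    show "(\<lambda>y. kernel_transform \<sigma> e a (y - R) (y + R) * (inverse (psi a y) * \<phi> y)) \<in> borel_measurable lborel" for R
    proof -
      have [measurable]: "(\<lambda>x. inverse (psi a x) * \<phi> x) \<in> borel_measurable lborel" using \<psi>\<phi> by auto
      have "(\<lambda>y. kernel_transform \<sigma> e a (y - R) (y + R)) \<in> borel_measurable lborel"
      proof -
        \<comment> \<open>With the moving interval written as a condition on the pair (y, v), this
          is an integral with a jointly measurable integrand, hence measurable in
          \<open>y\<close>.\<close>
        have "(\<lambda>y. kernel_transform \<sigma> e a (y - R) (y + R)) =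
          (\<lambda>y. LINT v|lborel. (if y - R < v \<and> v < y + R then homogeneous_kernel \<sigma> e v * exp (\<i> * of_real (a * v)) else 0))"
          unfolding kernel_transform_def psi_def
          by (intro ext Bochner_Integration.integral_cong) (auto simp: indicator_def)
        also have "\<dots> \<in> borel_measurable lborel" by measurable
        finally show ?thesis .
      qed
      then show ?thesis by measurable
    qed
    show "eventually (\<lambda>R. AE y in lborel. norm (kernel_transform \<sigma> e a (y - R) (y + R) * (inverse (psi a y) * \<phi> y)) \<le> M * norm (\<phi> y)) at_top"
      using eventually_gt_at_top[of 0]
      by eventually_elim (auto simp: norm_mult intro!: AE_I2 mult_right_mono M)
    show "AE y in lborel. ((\<lambda>R. kernel_transform \<sigma> e a (y - R) (y + R) * (inverse (psi a y) * \<phi> y)) \<longlongrightarrow> Gamma ?s * kernel_factor (of_real \<sigma>) e a * (inverse (psi a y) * \<phi> y)) at_top"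
      by (intro AE_I2 tendsto_mult_right kernel_transform_tendsto \<sigma> a)
  qed (use \<phi> \<psi>\<phi> in auto)
  have "e * Gamma ?s * whittaker_entire a (- ?s) k = (LINT y|lborel. Gamma ?s * kernel_factor (of_real \<sigma>) e a * (inverse (psi a y) * \<phi> y))"
    using L R unfolding kernel_fubini[OF \<sigma> \<phi>] using tendsto_unique trivial_limit_at_top_linorder by blast
  also have "\<dots> = Gamma ?s * kernel_factor (of_real \<sigma>) e a * whittaker_entire a ?s h"
    using whittaker_entire_pos[of ?s a h] \<sigma> a h unfolding integral_mult_right_zero
    by (simp add: whittaker_integral_def \<phi>_def mult_ac)
  finally have "Gamma ?s * (e * whittaker_entire a (- ?s) k) = Gamma ?s * (kernel_factor (of_real \<sigma>) e a * whittaker_entire a ?s h)"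
    by (simp add: mult_ac)
  then have "rGamma ?s * Gamma ?s * (e * whittaker_entire a (- ?s) k) = rGamma ?s * Gamma ?s * (kernel_factor (of_real \<sigma>) e a * whittaker_entire a ?s h)"
    by (simp add: mult.assoc)
  then show ?thesis using Gr by (simp add: k_def mult.commute)
qed


section \<open>Closure properties of smooth functions\<close>

lemma differentiable_cong_open:
  assumes "open S" "x \<in> S" "\<And>y. y \<in> S \<Longrightarrow> f y = g y"
  shows "f differentiable (at x) \<Longrightarrow> g differentiable (at x)"
    and "frechet_derivative f (at x) = frechet_derivative g (at x)"
proof -
  have "(f has_derivative D) (at x) \<longleftrightarrow> (g has_derivative D) (at x)" for D
    using has_derivative_transform_within_open[OF _ assms(1,2), of f D UNIV g]
      has_derivative_transform_within_open[OF _ assms(1,2), of g D UNIV f] assms(3) by auto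
  then show "f differentiable (at x) \<Longrightarrow> g differentiable (at x)"
    "frechet_derivative f (at x) = frechet_derivative g (at x)"
    by (auto simp: differentiable_def frechet_derivative_def)
qed

lemma Ck_on_cong_imp:
  assumes "open S" "\<And>x. x \<in> S \<Longrightarrow> f x = g x" "Ck_on k f S"
  shows "Ck_on k g S"
  using assms(2,3)
proof (induction k arbitrary: f g)
  case 0
  then show ?case using continuous_on_cong[OF refl, of S f g] by simp
next
  case (Suc k)
  show ?case
  proof (unfold Ck_on.simps, intro conjI ballI allI)
    fix x assume "x \<in> S"
    then show "g differentiable at x"
      using differentiable_cong_open(1)[OF assms(1), of x f g] Suc.prems by auto
  next
    fix v
    have "frechet_derivative f (at x) v = frechet_derivative g (at x) v" if "x \<in> S" for x
      using differentiable_cong_open(2)[OF assms(1) that, of f g] Suc.prems(1) by simp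
    then show "Ck_on k (\<lambda>x. frechet_derivative g (at x) v) S"
      using Suc.prems(2) Suc.IH[of "\<lambda>x. frechet_derivative f (at x) v" "\<lambda>x. frechet_derivative g (at x) v"]
      unfolding Ck_on.simps(2) by blast
  qed
qed

lemma Ck_on_SucI:
  assumes "open S" "\<And>x. x \<in> S \<Longrightarrow> (f has_derivative f' x) (at x)" "\<And>v. Ck_on k (\<lambda>x. f' x v) S"
  shows "Ck_on (Suc k) f S"
proof (unfold Ck_on.simps, intro conjI ballI allI)
  fix x assume "x \<in> S"
  then show "f differentiable at x" using assms(2) differentiableI by blast
next
  fix v
  have "f' x v = frechet_derivative f (at x) v" if "x \<in> S" for x
    using frechet_derivative_at[OF assms(2)[OF that]] by simp
  then show "Ck_on k (\<lambda>x. frechet_derivative f (at x) v) S"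
    by (rule Ck_on_cong_imp[OF assms(1) _ assms(3)])
qed

lemma Ck_on_SucD:
  assumes "Ck_on (Suc k) f S"
  shows "\<And>x. x \<in> S \<Longrightarrow> (f has_derivative frechet_derivative f (at x)) (at x)"
    and "\<And>v. Ck_on k (\<lambda>x. frechet_derivative f (at x) v) S"
  using assms frechet_derivative_works by auto

lemma Ck_on_mono: "Ck_on (Suc k) f S \<Longrightarrow> Ck_on k f S"
proof (induction k arbitrary: f)
  case 0
  then show ?case by (auto intro!: continuous_at_imp_continuous_on differentiable_imp_continuous_within)
next
  case (Suc k)
  have "\<forall>x\<in>S. f differentiable at x" using Suc.prems unfolding Ck_on.simps(2) by blast
  moreover have "Ck_on (Suc k) (\<lambda>x. frechet_derivative f (at x) v) S" for v using Suc.prems unfolding Ck_on.simps(2)[of "Suc k"] by blast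
  ultimately show ?case using Suc.IH unfolding Ck_on.simps(2) by blast
qed

lemma Ck_on_local:
  assumes "\<And>x. x \<in> S \<Longrightarrow> \<exists>T. open T \<and> x \<in> T \<and> Ck_on k f T"
  shows "Ck_on k f S"
  using assms
proof (induction k arbitrary: f)
  case 0
  show ?case
  proof (simp, rule continuous_at_imp_continuous_on, rule ballI)
    fix x assume "x \<in> S"
    then obtain T where "open T" "x \<in> T" "continuous_on T f" using 0 by auto
    then show "isCont f x" by (simp add: continuous_on_eq_continuous_at)
  qed
next
  case (Suc k)
  show ?case
    unfolding Ck_on.simps
  proof (intro conjI ballI allI)
    fix x assume "x \<in> S"
    then obtain T where "x \<in> T" "Ck_on (Suc k) f T" using Suc.prems by meson
    then show "f differentiable at x" by simp
  next
    fix v show "Ck_on k (\<lambda>x. frechet_derivative f (at x) v) S"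
    proof (rule Suc.IH)
      fix x assume "x \<in> S"
      then obtain T where T: "open T" "x \<in> T" "Ck_on (Suc k) f T" using Suc.prems by meson
      show "\<exists>T. open T \<and> x \<in> T \<and> Ck_on k (\<lambda>x. frechet_derivative f (at x) v) T"
        by (intro exI[of _ T] conjI T(1,2) Ck_on_SucD(2)[OF T(3)])
    qed
  qed
qed

lemma Ck_on_const: "open S \<Longrightarrow> Ck_on k (\<lambda>x. c) S"
proof (induction k arbitrary: c)
  case (Suc k)
  show ?case by (rule Ck_on_SucI[OF Suc.prems has_derivative_const]) (use Suc in auto)
qed simp

lemma Ck_on_bounded_linear:
  assumes "bounded_linear L" "open S" "Ck_on k f S"
  shows "Ck_on k (\<lambda>x. L (f x)) S"
  using assms(3)
proof (induction k arbitrary: f)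
  case 0
  then show ?case using bounded_linear.continuous_on[OF assms(1)] by simp
next
  case (Suc k)
  show ?case
    by (rule Ck_on_SucI[OF assms(2) bounded_linear.has_derivative[OF assms(1) Ck_on_SucD(1)[OF Suc.prems]]])
       (use Suc.IH Ck_on_SucD(2)[OF Suc.prems] in auto)
qed

lemma Ck_on_ident: "open S \<Longrightarrow> Ck_on k (\<lambda>x. x) S"
proof (cases k)
  case (Suc n)
  assume "open S"
  then show ?thesis unfolding Suc
    by (intro Ck_on_SucI[OF _ has_derivative_ident]) (auto intro: Ck_on_const)
qed auto

lemma Ck_on_linear: "bounded_linear L \<Longrightarrow> open S \<Longrightarrow> Ck_on k L S"
  using Ck_on_bounded_linear[of L S k "\<lambda>x. x"] Ck_on_ident by auto

lemma Ck_on_add: "open S \<Longrightarrow> Ck_on k f S \<Longrightarrow> Ck_on k g S \<Longrightarrow> Ck_on k (\<lambda>x. f x + g x) S"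
proof (induction k arbitrary: f g)
  case (Suc k)
  show ?case
    by (rule Ck_on_SucI[OF Suc.prems(1) has_derivative_add[OF Ck_on_SucD(1)[OF Suc.prems(2)] Ck_on_SucD(1)[OF Suc.prems(3)]]])
       (use Suc Ck_on_SucD(2)[OF Suc.prems(2)] Ck_on_SucD(2)[OF Suc.prems(3)] in auto)
qed (auto intro: continuous_on_add)

lemma Ck_on_mult:
  fixes f g :: "'a::real_normed_vector \<Rightarrow> 'b::real_normed_algebra"
  shows "open S \<Longrightarrow> Ck_on k f S \<Longrightarrow> Ck_on k g S \<Longrightarrow> Ck_on k (\<lambda>x. f x * g x) S"
proof (induction k arbitrary: f g)
  case (Suc k)
  note D1 = Ck_on_SucD[OF Suc.prems(2)] and D2 = Ck_on_SucD[OF Suc.prems(3)]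
  show ?case
    by (rule Ck_on_SucI[OF Suc.prems(1) has_derivative_mult[OF D1(1) D2(1)]])
       (auto intro!: Ck_on_add Suc.IH Suc.prems(1) D1(2) D2(2) Ck_on_mono[OF Suc.prems(2)] Ck_on_mono[OF Suc.prems(3)])
qed (auto intro: continuous_on_mult)

text \<open>Source of smoothness for the powers, logarithms and quotients below. The induction
  closes because the derivative of the outer function is again holomorphic.\<close>

lemma Ck_on_holomorphic_compose:
  fixes f :: "'a::real_normed_vector \<Rightarrow> complex"
  assumes "open S" "open V"
  shows "g holomorphic_on V \<Longrightarrow> Ck_on k f S \<Longrightarrow> f ` S \<subseteq> V \<Longrightarrow> Ck_on k (\<lambda>x. g (f x)) S"
proof (induction k arbitrary: g)
  case 0
  then show ?case
    using continuous_on_compose2[OF holomorphic_on_imp_continuous_on, of g V S f] by simp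
next
  case (Suc k)
  have d: "((\<lambda>x. g (f x)) has_derivative (\<lambda>v. deriv g (f x) * frechet_derivative f (at x) v)) (at x)" if "x \<in> S" for x
  proof -
    have "(g has_field_derivative deriv g (f x)) (at (f x))"
      using Suc.prems that assms(2) by (intro holomorphic_derivI[of g V]) auto
    then show ?thesis
      using has_derivative_compose[OF Ck_on_SucD(1)[OF Suc.prems(2) that], of g "(*) (deriv g (f x))"]
      by (simp add: has_field_derivative_def)
  qed
  show ?case
  proof (rule Ck_on_SucI[OF assms(1) d])
    fix v
    have "Ck_on k (\<lambda>x. deriv g (f x)) S"
      by (rule Suc.IH[OF holomorphic_deriv[OF Suc.prems(1) assms(2)] Ck_on_mono[OF Suc.prems(2)] Suc.prems(3)])
    then show "Ck_on k (\<lambda>x. deriv g (f x) * frechet_derivative f (at x) v) S"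
      by (rule Ck_on_mult[OF assms(1) _ Ck_on_SucD(2)[OF Suc.prems(2)]])
  qed
qed

text \<open>A chain rule for curves inside one line: the derivative of \<open>f\<close> is then
  always evaluated in the fixed direction \<open>v\<close>, which fits the recursion of
  \<open>Ck_on\<close> over fixed directions.\<close>

lemma Ck_on_line:
  fixes f :: "'a::real_normed_vector \<Rightarrow> complex" and u :: "real \<Rightarrow> real"
  assumes "open T" "\<And>k. Ck_on k u T" "\<And>t. t \<in> T \<Longrightarrow> p + u t *\<^sub>R v \<in> S"
  shows "Ck_on k f S \<Longrightarrow> Ck_on k (\<lambda>t. f (p + u t *\<^sub>R v)) T"
proof (induction k arbitrary: f)
  case 0
  have "continuous_on T (\<lambda>t. p + u t *\<^sub>R v)"
    using assms(2)[of 0] by (auto intro!: continuous_intros)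
  then show ?case using 0 assms(3) continuous_on_compose2[of S f T "\<lambda>t. p + u t *\<^sub>R v"] by auto
next
  case (Suc k)
  let ?u' = "\<lambda>t. frechet_derivative u (at t)" and ?f' = "\<lambda>x. frechet_derivative f (at x)"
  have d: "((\<lambda>t. f (p + u t *\<^sub>R v)) has_derivative (\<lambda>h. complex_of_real (?u' t h) * ?f' (p + u t *\<^sub>R v) v)) (at t)" if t: "t \<in> T" for t
  proof -
    have "(u has_derivative ?u' t) (at t)" using Ck_on_SucD(1)[OF assms(2) t] .
    then have 1: "((\<lambda>t. p + u t *\<^sub>R v) has_derivative (\<lambda>h. ?u' t h *\<^sub>R v)) (at t)"
      by (auto intro!: derivative_eq_intros)
    have 2: "(f has_derivative ?f' (p + u t *\<^sub>R v)) (at (p + u t *\<^sub>R v))"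
      by (rule Ck_on_SucD(1)[OF Suc.prems assms(3)[OF t]])
    have "?f' (p + u t *\<^sub>R v) (r *\<^sub>R v) = complex_of_real r * ?f' (p + u t *\<^sub>R v) v" for r
      using linear_scale[OF has_derivative_linear[OF 2]] by (simp add: scaleR_conv_of_real)
    then show ?thesis using has_derivative_compose[OF 1 2] by simp
  qed
  show ?case
  proof (rule Ck_on_SucI[OF assms(1) d])
    fix h :: real
    have "Ck_on k (\<lambda>t. complex_of_real (?u' t h)) T"
      using assms(1) Ck_on_SucD(2)[OF assms(2)] by (intro Ck_on_bounded_linear[OF bounded_linear_of_real]) auto
    moreover have "Ck_on k (\<lambda>t. ?f' (p + u t *\<^sub>R v) v) T"
      by (rule Suc.IH[OF Ck_on_SucD(2)[OF Suc.prems]])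
    ultimately show "Ck_on k (\<lambda>t. complex_of_real (?u' t h) * ?f' (p + u t *\<^sub>R v) v) T"
      by (rule Ck_on_mult[OF assms(1)])
  qed
qed

lemma Ck_on_real_holomorphic:
  fixes u :: "real \<Rightarrow> real"
  assumes "open T" "open V" "g holomorphic_on V" "\<And>t. t \<in> T \<Longrightarrow> of_real t \<in> V"
    "\<And>t. t \<in> T \<Longrightarrow> g (of_real t) = of_real (u t)"
  shows "Ck_on k (\<lambda>t. of_real (u t) :: complex) T" "Ck_on k u T"
proof -
  have "Ck_on k (\<lambda>t::real. complex_of_real t) T"
    by (intro Ck_on_linear bounded_linear_of_real assms)
  then have "Ck_on k (\<lambda>t. g (of_real t)) T"
    using assms by (intro Ck_on_holomorphic_compose[OF assms(1,2,3)]) auto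
  then show 1: "Ck_on k (\<lambda>t. of_real (u t) :: complex) T"
    by (rule Ck_on_cong_imp[OF assms(1), rotated]) (use assms in auto)
  have "Ck_on k (\<lambda>t. Re (of_real (u t))) T"
    by (rule Ck_on_bounded_linear[OF bounded_linear_Re assms(1) 1])
  then show "Ck_on k u T" by simp
qed

text \<open>A multiplier of norm 1 makes the norm periodic, so continuity on one period gives
  boundedness on the line; derivatives inherit the same multiplier.\<close>

lemma family_const_of_smooth_quasiperiodic:
  assumes "\<And>k. Ck_on k h UNIV" and per: "\<And>t. h (t + p) = c * h t" and c: "norm c = 1" and p: "p > 0"
  shows "family UNIV (\<lambda>_. h)"
proof -
  have "family_Ck k UNIV (\<lambda>_. h)" if "Ck_on k h UNIV" "\<And>t. h (t + p) = c * h t" for k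
    using that
  proof (induction k arbitrary: h)
    case (0 h)
    then have cont: "continuous_on UNIV h" by simp
    have "compact (h ` {0..p})" by (intro compact_continuous_image continuous_on_subset[OF cont]) auto
    then obtain B where B: "\<And>t. t \<in> {0..p} \<Longrightarrow> norm (h t) \<le> B"
      using compact_imp_bounded bounded_iff by (metis image_eqI)
    have n: "norm (h (t + p)) = norm (h t)" for t using 0 c by (simp add: norm_mult)
    have nn: "norm (h (t + real k * p)) = norm (h t)" for t k
    proof (induction k)
      case (Suc k)
      have eq: "t + real (Suc k) * p = (t + real k * p) + p" by (simp add: algebra_simps)
      show ?case by (simp only: eq n Suc)
    qed simp
    have "norm (h t) \<le> B" for t
    proof -
      define m where "m = \<lfloor>t / p\<rfloor>"
      have m: "0 \<le> t - of_int m * p" "t - of_int m * p \<le> p"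
        using floor_divide_lower[OF p, of t] floor_divide_upper[OF p, of t] by (simp_all add: m_def algebra_simps)
      have "norm (h t) = norm (h (t - of_int m * p))"
      proof (cases "m \<ge> 0")
        case True
        then show ?thesis using nn[of "t - of_int m * p" "nat m"] by simp
      next
        case False
        then show ?thesis using nn[of t "nat (- m)"] by simp
      qed
      then show ?thesis using B m by auto
    qed
    then have "\<exists>e>0. \<exists>B. \<forall>s'\<in>ball s e \<inter> UNIV. \<forall>t. norm (h t) \<le> B" for s :: complex
      using zero_less_one by blast
    then show ?case using cont by (simp add: bounded_family_def)
  next
    case (Suc k h)
    have d: "(h has_vector_derivative dv h t) (at t)" for t
      using Suc.prems(1) by (auto simp: dv_def vector_derivative_works)
    have "dv h (t + p) = c * dv h t" for t
    proof -
      have "((\<lambda>t. h (t + p)) has_vector_derivative dv h (t + p)) (at t)"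
        using vector_diff_chain_at[OF has_vector_derivative_add[OF has_vector_derivative_id has_vector_derivative_const] d, of p t]
        by (simp add: o_def)
      moreover have "((\<lambda>t. c * h t) has_vector_derivative c * dv h t) (at t)"
        by (rule has_vector_derivative_mult_right[OF d])
      ultimately show ?thesis using Suc.prems(2) by (simp add: vector_derivative_unique_at)
    qed
    moreover have "Ck_on k (dv h) UNIV"
    proof -
      have "frechet_derivative h (at t) 1 = dv h t" for t
        using frechet_derivative_at[OF d[unfolded has_vector_derivative_def], of t] by (metis scaleR_one)
      then show ?thesis using Ck_on_SucD(2)[OF Suc.prems(1), of 1] by simp
    qed
    ultimately have 1: "family_Ck k UNIV (\<lambda>_. dv h)" by (intro Suc.IH)
    have "bounded_family UNIV (\<lambda>_. h)"
    proof -
      have "family_Ck k UNIV (\<lambda>_. h)"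
        by (rule Suc.IH[OF Ck_on_mono[OF Suc.prems(1)] Suc.prems(2)])
      then show ?thesis by (rule family_Ck_bounded)
    qed
    then show ?case by (rule family_Ck_SucI[OF _ d 1])
  qed
  then show ?thesis using assms by (simp add: family_def)
qed


section \<open>Functions in the principal series\<close>

lemma mat2_nth [simp]:
  "mat2 a b c d $ 1 $ 1 = a" "mat2 a b c d $ 1 $ 2 = b" "mat2 a b c d $ 2 $ 1 = c" "mat2 a b c d $ 2 $ 2 = d"
  by (simp_all add: mat2_def)

lemma mat2_mult: "mat2 a b c d ** mat2 a' b' c' d' =
    mat2 (a * a' + b * c') (a * b' + b * d') (c * a' + d * c') (c * b' + d * d')"
  by (simp add: matrix_matrix_mult_def vec_eq_iff forall_2 sum_2)

lemma det_mat2: "det (mat2 a b c d) = a * d - b * c"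
  by (simp add: det_2)

lemma mat2_eta: "g = mat2 (g $ 1 $ 1) (g $ 1 $ 2) (g $ 2 $ 1) (g $ 2 $ 2)"
  by (simp add: vec_eq_iff forall_2)

lemma mat2_cong: "a = a' \<Longrightarrow> b = b' \<Longrightarrow> c = c' \<Longrightarrow> d = d' \<Longrightarrow> mat2 a b c d = mat2 a' b' c' d'"
  by simp

lemma kubota_x_mat2: "kubota_x (mat2 a b c d) = (if c \<noteq> 0 then c else d)"
  by (simp add: kubota_x_def)

lemma w0_upper: "w0 ** upper x = mat2 0 1 (- 1) (- x)"
  by (simp add: w0_def upper_def mat2_mult)

lemma w0_upper_Mp: "(w0 ** upper x, 1) \<in> Mp"
  by (simp add: Mp_def w0_upper det_mat2)

lemma hilbert_symbol_nonzero:
  assumes "a \<noteq> 0" "b \<noteq> 0"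
  shows "hilbert_symbol a b = (if a < 0 \<and> b < 0 then - 1 else 1)"
proof (cases "a < 0 \<and> b < 0")
  case True
  have "(x, y, z) = (0, 0, 0)" if eq: "z\<^sup>2 = a * x\<^sup>2 + b * y\<^sup>2" for x y z :: real
  proof -
    have "a * x\<^sup>2 \<le> 0" "b * y\<^sup>2 \<le> 0" using True by (auto simp: mult_nonpos_nonneg)
    moreover have "z\<^sup>2 \<ge> 0" by simp
    ultimately have "z\<^sup>2 = 0" "a * x\<^sup>2 = 0" "b * y\<^sup>2 = 0" using eq by linarith+
    then show ?thesis using True by auto
  qed
  then show ?thesis using True unfolding hilbert_symbol_def by auto
next
  case False
  then consider "a > 0" | "b > 0" using assms by linarith
  then have "\<exists>x y z. (x, y, z) \<noteq> (0, 0, 0) \<and> z\<^sup>2 = a * x\<^sup>2 + b * y\<^sup>2"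
  proof cases
    case 1
    then show ?thesis by (intro exI[of _ 1] exI[of _ 0] exI[of _ "sqrt a"]) auto
  next
    case 2
    then show ?thesis by (intro exI[of _ 0] exI[of _ 1] exI[of _ "sqrt b"]) auto
  qed
  then show ?thesis using False unfolding hilbert_symbol_def by auto
qed

section \<open>Products in the cover and their Kubota signs\<close>

lemma w0_mult_w0:
  assumes "u \<noteq> 0"
  shows "(w0 ** upper u, 1) \<bullet>\<^sub>M (w0 ** upper x, 1) = (mat2 (- 1) (- x) u (u * x - 1), if u > 0 then - 1 else 1)"
  using assms by (simp add: w0_upper mat2_mult kubota_cocycle_def kubota_x_mat2 hilbert_symbol_nonzero algebra_simps)

lemma borel_mult_w0:
  assumes "t \<noteq> 0"
  shows "(mat2 t b 0 (inverse t), \<epsilon>) \<bullet>\<^sub>M (w0 ** upper y, 1) =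
    (mat2 (- b) (t - b * y) (- inverse t) (- y * inverse t), \<epsilon> * (if t < 0 then - 1 else 1))"
  using assms by (simp add: w0_upper mat2_mult kubota_cocycle_def kubota_x_mat2 hilbert_symbol_nonzero algebra_simps)

text \<open>Right factors from the positive torus, like those from the upper unipotents, contribute
  no sign; in a chart the sign therefore comes from the lower unipotent factor.\<close>

lemma kubota_cocycle_torus:
  assumes "c \<noteq> 0 \<or> d \<noteq> 0" "t > 0"
  shows "kubota_cocycle (mat2 a b c d) (torus t) = 1"
  using assms by (cases "c = 0") (auto simp: torus_def mat2_mult kubota_cocycle_def kubota_x_mat2 hilbert_symbol_nonzero
      mult_less_0_iff zero_less_mult_iff)

lemma kubota_cocycle_upper:
  assumes "c \<noteq> 0 \<or> d \<noteq> 0"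
  shows "kubota_cocycle (mat2 a b c d) (upper x) = 1"
  using assms by (cases "c = 0") (auto simp: upper_def mat2_mult kubota_cocycle_def kubota_x_mat2 hilbert_symbol_nonzero)

text \<open>The sign is 1 at \<open>y = 0\<close> and jumps only for \<open>m < 0\<close>, when
  \<open>r + m * y\<close> passes through 0, that is, when the lower row crosses the ray c = 0, d <
  0. In \<open>weight_vector\<close> the cut of the logarithm lies over the same ray.\<close>

lemma kubota_cocycle_lower:
  assumes "r \<noteq> 0 \<or> m \<noteq> 0"
  shows "kubota_cocycle (mat2 p q r m) (lower y) =
    (if m \<ge> 0 then 1 else if r > 0 then (if r + m * y \<le> 0 then - 1 else 1) else (if r + m * y > 0 then - 1 else 1))"
proof -
  define x1 x2 x3 where "x1 = (if r \<noteq> 0 then r else m)" and "x2 = (if y \<noteq> 0 then y else 1)"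
    and "x3 = (if r + m * y \<noteq> 0 then r + m * y else m)"
  have nz: "x1 \<noteq> 0" "x2 \<noteq> 0" "x3 \<noteq> 0" using assms by (auto simp: x1_def x2_def x3_def)
  have kx: "kubota_x (mat2 p q r m) = x1" "kubota_x (lower y) = x2" "kubota_x (mat2 p q r m ** lower y) = x3"
    by (simp_all add: lower_def mat2_mult kubota_x_mat2 x1_def x2_def x3_def)
  have eq: "kubota_cocycle (mat2 p q r m) (lower y) = (if x1 < 0 \<and> x2 < 0 then - 1 else 1) * (if 0 < x1 * x2 \<and> x3 < 0 then - 1 else 1)"
    unfolding kubota_cocycle_def kx using nz by (simp add: hilbert_symbol_nonzero)
  have w: "0 < x1 * x2 \<longleftrightarrow> (x1 > 0 \<and> x2 > 0) \<or> (x1 < 0 \<and> x2 < 0)" by (simp add: zero_less_mult_iff)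
  \<comment> \<open>Naming the product makes the remaining sign conditions linear.\<close>
  define z where "z = m * y"
  have z: "z > 0 \<longleftrightarrow> (m > 0 \<and> y > 0) \<or> (m < 0 \<and> y < 0)" "z < 0 \<longleftrightarrow> (m > 0 \<and> y < 0) \<or> (m < 0 \<and> y > 0)"
    by (auto simp: z_def zero_less_mult_iff mult_less_0_iff)
  have "((x1 < 0 \<and> x2 < 0) \<noteq> ((x1 > 0 \<and> x2 > 0 \<or> x1 < 0 \<and> x2 < 0) \<and> x3 < 0)) \<longleftrightarrow>
    \<not> m \<ge> 0 \<and> (if r > 0 then r + z \<le> 0 else r + z > 0)"
    using z x1_def x2_def x3_def[folded z_def] assms by (smt (verit))
  then show ?thesis
    unfolding eq w z_def[symmetric]
    by (cases "x1 < 0 \<and> x2 < 0"; cases "(x1 > 0 \<and> x2 > 0 \<or> x1 < 0 \<and> x2 < 0) \<and> x3 < 0"; cases "r > 0"; cases "m \<ge> 0"; simp)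
qed

lemma mp_chart_eq:
  assumes "p * m - q * r = 1" "t > 0"
  shows "mp_chart (mat2 p q r m, \<epsilon>) (y, t, x) =
    (mat2 ((p + q * y) * t) ((p + q * y) * t * x + q * inverse t) ((r + m * y) * t) ((r + m * y) * t * x + m * inverse t),
     \<epsilon> * kubota_cocycle (mat2 p q r m) (lower y))"
proof -
  have nz: "r + m * y \<noteq> 0 \<or> m \<noteq> 0" using assms by auto
  have nz': "(r + m * y) * t \<noteq> 0 \<or> m * inverse t \<noteq> 0" using nz assms(2) by auto
  have e1: "mat2 p q r m ** lower y = mat2 (p + q * y) q (r + m * y) m"
    by (simp add: lower_def mat2_mult)
  have e2: "mat2 (p + q * y) q (r + m * y) m ** torus t = mat2 ((p + q * y) * t) (q * inverse t) ((r + m * y) * t) (m * inverse t)"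
    by (simp add: torus_def mat2_mult)
  have e3: "mat2 ((p + q * y) * t) (q * inverse t) ((r + m * y) * t) (m * inverse t) ** upper x =
    mat2 ((p + q * y) * t) ((p + q * y) * t * x + q * inverse t) ((r + m * y) * t) ((r + m * y) * t * x + m * inverse t)"
    by (simp add: upper_def mat2_mult)
  show ?thesis
    by (simp add: mp_chart_def e1 e2 e3 kubota_cocycle_torus[OF nz assms(2)] kubota_cocycle_upper[OF nz'])
qed

lemma mp_smooth_w0_upper:
  assumes "mp_smooth f" shows "Ck_on k (\<lambda>x. f (w0 ** upper x, 1)) UNIV"
proof -
  have "(w0, 1) \<in> Mp" by (simp add: Mp_def w0_def det_mat2)
  then have s: "Ck_on k (\<lambda>p. f (mp_chart (w0, 1) p)) (UNIV \<times> {0<..} \<times> UNIV)"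
    using assms by (auto simp: mp_smooth_def)
  have "Ck_on k (\<lambda>x. f (mp_chart (w0, 1) ((0, 1, 0) + x *\<^sub>R (0, 0, 1)))) UNIV"
    by (rule Ck_on_line[OF open_UNIV Ck_on_ident[OF open_UNIV] _ s]) auto
  moreover have "mp_chart (w0, 1) ((0, 1, 0) + x *\<^sub>R (0, 0, 1)) = (w0 ** upper x, 1)" for x
    using mp_chart_eq[of 0 0 1 "- 1" 1 1 0 x] kubota_cocycle_lower[of "- 1" 0 0 1 0]
    by (simp add: w0_upper) (simp add: w0_def)
  ultimately show ?thesis by simp
qed

lemma mp_smooth_lower:
  assumes "mp_smooth f" shows "Ck_on k (\<lambda>y. f (lower y, 1)) UNIV"
proof -
  have "(mat2 1 0 0 1, 1) \<in> Mp" by (simp add: Mp_def det_mat2)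
  then have s: "Ck_on k (\<lambda>p. f (mp_chart (mat2 1 0 0 1, 1) p)) (UNIV \<times> {0<..} \<times> UNIV)"
    using assms by (auto simp: mp_smooth_def)
  have "Ck_on k (\<lambda>y. f (mp_chart (mat2 1 0 0 1, 1) ((0, 1, 0) + y *\<^sub>R (1, 0, 0)))) UNIV"
    by (rule Ck_on_line[OF open_UNIV Ck_on_ident[OF open_UNIV] _ s]) auto
  moreover have "mp_chart (mat2 1 0 0 1, 1) ((0, 1, 0) + y *\<^sub>R (1, 0, 0)) = (lower y, 1)" for y
    using mp_chart_eq[of 1 1 0 0 1 1 y 0] kubota_cocycle_lower[of 0 1 1 0 y] by (simp add: lower_def)
  ultimately show ?thesis by simp
qed

text \<open>This is \<open>chi (- 1) * inverse (weil_index a (- 1))\<close>, the value of the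
  inducing function at -1. It is a square root of -1, in agreement with the Kubota cocycle on the
  torus.\<close>

definition cell_phase :: "real \<Rightarrow> (real \<Rightarrow> complex) \<Rightarrow> complex" where
  "cell_phase a chi = \<i> * chi (- 1) * of_real (sgn a)"

lemma char_weil_index:
  assumes "a \<noteq> 0" "chi = triv_char \<or> chi = sign_char" "t \<noteq> 0"
  shows "chi t * inverse (weil_index a t) = (if t > 0 then 1 else cell_phase a chi)"
  using assms by (cases "a > 0") (auto simp: cell_phase_def weil_index_def triv_char_def sign_char_def)

lemma cell_phase_sq:
  assumes "a \<noteq> 0" "chi = triv_char \<or> chi = sign_char"
  shows "cell_phase a chi * cell_phase a chi = - 1"
  using assms by (cases "a > 0") (auto simp: cell_phase_def triv_char_def sign_char_def)

lemma principal_series_borel: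
  assumes f: "f \<in> principal_series a chi s" and "a \<noteq> 0" "chi = triv_char \<or> chi = sign_char"
    and "t \<noteq> 0" "\<epsilon> \<in> {1, - 1}" "g \<in> Mp"
  shows "f ((mat2 t b 0 (inverse t), \<epsilon>) \<bullet>\<^sub>M g) = of_int \<epsilon> * of_real \<bar>t\<bar> powr (s + 1) * (if t > 0 then 1 else cell_phase a chi) * f g"
proof -
  have "f ((mat2 t b 0 (inverse t), \<epsilon>) \<bullet>\<^sub>M g) = of_int \<epsilon> * of_real \<bar>t\<bar> powr (s + 1) * (chi t * inverse (weil_index a t)) * f g"
    using f assms(4-6) unfolding principal_series_def mem_Collect_eq mult.assoc by blast
  then show ?thesis using char_weil_index[OF assms(2-4)] by simp
qed

text \<open>Bruhat decomposition of the product computed in \<open>w0_mult_w0\<close>. The torus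
  entry is \<open>- 1 / u\<close>, so the phase appears for \<open>u > 0\<close>.\<close>

lemma principal_series_cell:
  assumes f: "f \<in> principal_series a chi s" and a: "a \<noteq> 0" and chi: "chi = triv_char \<or> chi = sign_char" and u: "u \<noteq> 0"
  shows "f (mat2 (- 1) (- x) u (u * x - 1), if u > 0 then - 1 else 1) =
    of_real \<bar>1 / u\<bar> powr (s + 1) * (if u > 0 then cell_phase a chi else 1) * f (w0 ** upper (x - 1 / u), 1)"
proof -
  have "(mat2 (- 1 / u) 1 0 (inverse (- 1 / u)), 1) \<bullet>\<^sub>M (w0 ** upper (x - 1 / u), 1) = (mat2 (- 1) (- x) u (u * x - 1), if u > 0 then - 1 else 1)"
    using u by (subst borel_mult_w0) (auto simp: divide_less_0_iff field_simps intro!: mat2_cong)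
  then show ?thesis
    using principal_series_borel[OF f a chi, of "- 1 / u" 1 "(w0 ** upper (x - 1 / u), 1)" 1] u w0_upper_Mp
    by (auto simp: zero_less_divide_iff)
qed

text \<open>Bruhat decomposition again. For \<open>y > 0\<close> the torus entry
  \<open>- 1 / y\<close> is negative and the Kubota sign is -1 as well, so phase and sign appear
  together.\<close>

lemma principal_series_lower:
  assumes f: "f \<in> principal_series a chi s" and a: "a \<noteq> 0" and chi: "chi = triv_char \<or> chi = sign_char" and y: "y \<noteq> 0"
  shows "f (lower y, 1) = of_real \<bar>1 / y\<bar> powr (s + 1) * (if y > 0 then - cell_phase a chi else 1) * f (w0 ** upper (1 / y), 1)"
proof -
  have "(mat2 (- 1 / y) (- 1) 0 (inverse (- 1 / y)), if y > 0 then - 1 else 1) \<bullet>\<^sub>M (w0 ** upper (1 / y), 1) = (lower y, 1)"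
    using y by (subst borel_mult_w0) (auto simp: lower_def divide_less_0_iff field_simps intro!: mat2_cong)
  then show ?thesis
    using principal_series_borel[OF f a chi, of "- 1 / y" "if y > 0 then - 1 else 1" "(w0 ** upper (1 / y), 1)" "- 1"] y w0_upper_Mp
    by (auto simp: zero_less_divide_iff split: if_splits)
qed

lemma floor_interval:
  assumes "of_int n * pi < t" "t < (of_int n + 1) * pi"
  shows "\<lfloor>t / pi\<rfloor> = n" "sin t \<noteq> 0"
proof -
  have "of_int n < t / pi" "t / pi < of_int n + 1"
    using assms by (auto simp: field_simps)
  then show fl: "\<lfloor>t / pi\<rfloor> = n" by linarith
  show "sin t \<noteq> 0"
  proof
    assume "sin t = 0"
    then obtain i :: int where "t = of_int i * pi" by (auto simp: sin_zero_iff_int2)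
    then show False using assms fl by (auto simp: mult_less_cancel_right_pos)
  qed
qed

lemma powr_sq_abs:
  assumes "x \<noteq> 0"
  shows "complex_of_real (x\<^sup>2) powr z = of_real \<bar>x\<bar> powr (2 * z)"
proof -
  have "x\<^sup>2 = exp (2 * ln \<bar>x\<bar>)" "\<bar>x\<bar> = exp (ln \<bar>x\<bar>)" using assms by (simp_all add: exp_double)
  then have "complex_of_real (x\<^sup>2) = exp (of_real (2 * ln \<bar>x\<bar>))" "complex_of_real \<bar>x\<bar> = exp (of_real (ln \<bar>x\<bar>))"
    by (simp_all only: exp_of_real of_real_eq_iff)
  moreover have "exp (complex_of_real r) powr z = exp (of_real r * z)" for r z
    by (simp add: powr_def mult.commute)
  ultimately have "complex_of_real (x\<^sup>2) powr z = exp (of_real (2 * ln \<bar>x\<bar>) * z)"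
    "of_real \<bar>x\<bar> powr (2 * z) = exp (of_real (ln \<bar>x\<bar>) * (2 * z))"
    by (simp_all only:)
  then show ?thesis by (simp only: of_real_mult of_real_numeral mult_ac)
qed

lemma of_real_powr_mult:
  assumes "x \<ge> 0" "y \<ge> 0"
  shows "complex_of_real (x * y) powr z = of_real x powr z * of_real y powr z"
  using powr_times_real[of "complex_of_real x" "complex_of_real y" z] assms by simp

text \<open>Smoothness at the multiples of pi, where the big cell ends, comes from the
  charts around the lower unipotent elements.\<close>

lemma principal_series_circle:
  assumes f: "f \<in> principal_series a chi s" and a: "a \<noteq> 0" and chi: "chi = triv_char \<or> chi = sign_char"
  obtains h where "family UNIV (\<lambda>_. h)" "\<And>t. h (t + pi) = - cell_phase a chi * h t"
    "\<And>x. f (w0 ** upper x, 1) = sin_pow (s + 1) x * h (arccot x)"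
proof -
  define e where "e = cell_phase a chi"
  define c where "c = - e"
  have ee: "e * e = - 1" unfolding e_def by (rule cell_phase_sq[OF a chi])
  have c0: "c \<noteq> 0" using ee by (auto simp: c_def)
  have ce: "c * e = 1" using ee by (simp add: c_def)
  define \<phi> L where "\<phi> x = f (w0 ** upper x, 1)" and "L y = f (lower y, 1)" for x y
  have sm: "mp_smooth f" using f by (simp add: principal_series_def)
  have \<phi>k: "Ck_on k \<phi> UNIV" and Lk: "Ck_on k L UNIV" for k
    using mp_smooth_w0_upper[OF sm] mp_smooth_lower[OF sm] by (simp_all add: \<phi>_def[abs_def] L_def[abs_def])
  have L: "L y = of_real \<bar>1 / y\<bar> powr (s + 1) * (if y > 0 then c else 1) * \<phi> (1 / y)" if "y \<noteq> 0" for y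
    unfolding L_def \<phi>_def c_def e_def by (rule principal_series_lower[OF f a chi that])
  define z where "z = - (s + 1) / 2"
  \<comment> \<open>The floor counts which translate of the big cell contains \<open>t\<close>, and
    the power of \<open>c\<close> enforces the quasiperiod. At multiples of pi the value is read off
    from the lower unipotents; the factor \<open>e\<close> is the inverse of
    \<open>c\<close>.\<close>
  define h where "h t = c powi \<lfloor>t / pi\<rfloor> * (if sin t = 0 then e * L 0 else of_real ((sin t)\<^sup>2) powr z * \<phi> (cos t / sin t))" for t
  have h1: "h t = c powi n * (of_real ((sin t)\<^sup>2) powr z * \<phi> (cos t / sin t))"
    if "of_int n * pi < t" "t < (of_int n + 1) * pi" for n t
    using floor_interval[OF that] by (simp add: h_def)
  \<comment> \<open>The same function near a multiple of pi, in the tangent instead of the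
    cotangent. Across the multiple of pi the exponent of \<open>c\<close> changes by one, and
    \<open>principal_series_lower\<close> changes by the matching factor, so both sides follow one
    formula.\<close>
  have h2: "h t = c powi n * (e * (of_real ((cos t)\<^sup>2) powr z * L (sin t / cos t)))" 
    if t: "\<bar>t - of_int n * pi\<bar> < pi / 2" for n t
  proof -
    define \<tau> where "\<tau> = t - of_int n * pi"
    have sc: "sin t = (if even n then sin \<tau> else - sin \<tau>)" "cos t = (if even n then cos \<tau> else - cos \<tau>)"
      unfolding \<tau>_def by (auto simp: sin_diff cos_diff sin_int_times_real cos_int_times_real mult.commute)
    have q: "sin t / cos t = sin \<tau> / cos \<tau>" "cos t / sin t = cos \<tau> / sin \<tau>" "(sin t)\<^sup>2 = (sin \<tau>)\<^sup>2" "(cos t)\<^sup>2 = (cos \<tau>)\<^sup>2"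
      using sc by auto
    have cp: "cos \<tau> > 0" using t unfolding \<tau>_def[symmetric] by (intro cos_gt_zero_pi) auto
    have key: "of_real ((cos \<tau>)\<^sup>2) powr z * of_real \<bar>1 / (sin \<tau> / cos \<tau>)\<bar> powr (s + 1) = of_real ((sin \<tau>)\<^sup>2) powr z" if sp: "sin \<tau> \<noteq> 0"
    proof -
      define y where "y = sin \<tau> / cos \<tau>"
      have y: "y \<noteq> 0" using sp cp by (simp add: y_def)
      have iy: "1 / y = cos \<tau> / sin \<tau>" by (simp add: y_def)
      have "of_real ((cos \<tau>)\<^sup>2) powr z * of_real \<bar>1 / y\<bar> powr (s + 1) = of_real ((sin \<tau>)\<^sup>2) powr z"
      proof -
        have "complex_of_real ((cos \<tau>)\<^sup>2) powr z = of_real ((sin \<tau> * (1 / y))\<^sup>2) powr z"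
          unfolding iy using sp by simp
        also have "\<dots> = of_real (\<bar>sin \<tau>\<bar> * \<bar>1 / y\<bar>) powr (2 * z)"
          using sp y by (subst powr_sq_abs) (auto simp: abs_mult)
        also have "\<dots> = of_real \<bar>sin \<tau>\<bar> powr (2 * z) * of_real \<bar>1 / y\<bar> powr (2 * z)"
          by (rule of_real_powr_mult) auto
        also have "complex_of_real \<bar>sin \<tau>\<bar> powr (2 * z) = of_real ((sin \<tau>)\<^sup>2) powr z"
          using sp by (subst powr_sq_abs) auto
        finally have "complex_of_real ((cos \<tau>)\<^sup>2) powr z = of_real ((sin \<tau>)\<^sup>2) powr z * of_real \<bar>1 / y\<bar> powr (2 * z)" .
        moreover have "of_real \<bar>1 / y\<bar> powr (2 * z) * complex_of_real \<bar>1 / y\<bar> powr (s + 1) = 1"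
        proof -
          have "2 * z + (s + 1) = 0" by (simp add: z_def field_simps)
          then have "of_real \<bar>1 / y\<bar> powr (2 * z) * complex_of_real \<bar>1 / y\<bar> powr (s + 1) = complex_of_real \<bar>1 / y\<bar> powr 0"
            by (metis powr_add)
          then show ?thesis using y by simp
        qed
        ultimately show ?thesis by (simp add: mult.assoc)
      qed
      then show ?thesis by (simp only: y_def)
    qed
    consider "\<tau> = 0" | "\<tau> > 0" | "\<tau> < 0" by linarith
    then show ?thesis
    proof cases
      case 1
      then have "t = of_int n * pi" by (simp add: \<tau>_def)
      then show ?thesis using 1 sc q by (simp add: h_def)
    next
      case 2
      have sp: "sin \<tau> > 0" using 2 t unfolding \<tau>_def[symmetric] by (intro sin_gt_zero) auto
      define y where "y = sin \<tau> / cos \<tau>"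
      have y: "y > 0" using sp cp by (simp add: y_def)
      have iy: "1 / y = cos \<tau> / sin \<tau>" by (simp add: y_def)
      note key = key[OF less_imp_neq[OF sp, symmetric], folded y_def]
      have "of_real ((cos \<tau>)\<^sup>2) powr z * L y = of_real ((sin \<tau>)\<^sup>2) powr z * (c * \<phi> (1 / y))"
        using L[of y] y key by (simp add: mult.assoc[symmetric])
      then have "e * (of_real ((cos \<tau>)\<^sup>2) powr z * L y) = (c * e) * (of_real ((sin \<tau>)\<^sup>2) powr z * \<phi> (1 / y))"
        by (simp add: mult_ac)
      moreover have "h t = c powi n * (of_real ((sin t)\<^sup>2) powr z * \<phi> (cos t / sin t))"
        by (rule h1) (use 2 t in \<open>auto simp: \<tau>_def algebra_simps\<close>)
      ultimately show ?thesis unfolding q iy y_def[symmetric] by (simp add: ce y_def)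
    next
      case 3
      have "sin (- \<tau>) > 0" using 3 t unfolding \<tau>_def[symmetric] by (intro sin_gt_zero) auto
      then have sp: "sin \<tau> < 0" by simp
      define y where "y = sin \<tau> / cos \<tau>"
      have y: "y < 0" using sp cp by (simp add: y_def divide_neg_pos)
      have iy: "1 / y = cos \<tau> / sin \<tau>" by (simp add: y_def)
      note key = key[OF less_imp_neq[OF sp], folded y_def]
      have "of_real ((cos \<tau>)\<^sup>2) powr z * L y = of_real ((sin \<tau>)\<^sup>2) powr z * \<phi> (1 / y)"
        using L[of y] y key by (simp add: mult.assoc[symmetric])
      then have "c powi n * (e * (of_real ((cos \<tau>)\<^sup>2) powr z * L y)) = (c powi n * e) * (of_real ((sin \<tau>)\<^sup>2) powr z * \<phi> (1 / y))"
        by (simp add: mult_ac)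
      \<comment> \<open>To the left of the multiple of pi the floor is \<open>n - 1\<close>; the
        extra factor \<open>c\<close> is absorbed by \<open>c * e = 1\<close>.\<close>
      also have "c powi n * e = c powi (n - 1) * (c * e)"
        using c0 by (simp add: power_int_diff)
      finally have "c powi n * (e * (of_real ((cos \<tau>)\<^sup>2) powr z * L y)) = c powi (n - 1) * (of_real ((sin \<tau>)\<^sup>2) powr z * \<phi> (1 / y))"
        by (simp add: ce)
      moreover have "h t = c powi (n - 1) * (of_real ((sin t)\<^sup>2) powr z * \<phi> (cos t / sin t))"
        by (rule h1) (use 3 t in \<open>auto simp: \<tau>_def algebra_simps\<close>)
      ultimately show ?thesis unfolding q iy y_def[symmetric] by (simp add: y_def)
    qed
  qed
  have per: "h (t + pi) = c * h t" for t
  proof -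
    have "(t + pi) / pi = t / pi + 1" by (simp add: add_divide_distrib)
    then have "\<lfloor>(t + pi) / pi\<rfloor> = \<lfloor>t / pi\<rfloor> + 1" by simp
    then show ?thesis using c0 by (simp add: h_def power_int_add)
  qed
  have powk: "Ck_on k (\<lambda>t. complex_of_real ((u t)\<^sup>2) powr z) T"
    if "open T" "\<And>t. t \<in> T \<Longrightarrow> u t \<noteq> 0" and g: "g holomorphic_on UNIV" "\<And>t. g (of_real t) = complex_of_real (u t)" for k T u g
  proof -
    have "Ck_on k (\<lambda>t. complex_of_real ((u t)\<^sup>2)) T"
      by (rule Ck_on_real_holomorphic(1)[OF that(1) open_UNIV, of "\<lambda>w. (g w)\<^sup>2"]) (use g in \<open>auto intro!: holomorphic_intros\<close>)
    then show ?thesis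
      by (rule Ck_on_holomorphic_compose[OF that(1) _ _ , of "- \<real>\<^sub>\<le>\<^sub>0" "\<lambda>w. w powr z", rotated 2])
         (use that(2) in \<open>auto intro!: holomorphic_intros simp: complex_nonpos_Reals_iff simp flip: of_real_power\<close>)
  qed
  have quok: "Ck_on k (\<lambda>t. u t / v t) T" 
    if T: "open T" "\<And>t. t \<in> T \<Longrightarrow> v t \<noteq> 0" and g: "p holomorphic_on UNIV" "\<And>t. p (of_real t) = complex_of_real (u t)"
      "q holomorphic_on UNIV" "\<And>t. q (of_real t) = complex_of_real (v t)" for k T and u v :: "real \<Rightarrow> real" and p q
  proof -
    have "open {w. q w \<noteq> 0}"
      using g(3) by (intro open_Collect_neq continuous_intros holomorphic_on_imp_continuous_on)
    then show ?thesis
      by (rule Ck_on_real_holomorphic(2)[OF T(1), of _ "\<lambda>w. p w / q w"])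
         (use T g in \<open>auto intro!: holomorphic_intros intro: holomorphic_on_subset\<close>)
  qed
  have hk: "Ck_on k h UNIV" for k
  proof (rule Ck_on_local)
    fix t :: real
    define n where "n = \<lfloor>t / pi\<rfloor>"
    have n: "of_int n * pi \<le> t" "t < (of_int n + 1) * pi"
      using floor_divide_lower[of pi t] floor_divide_upper[of pi t] by (simp_all add: n_def)
    show "\<exists>T. open T \<and> t \<in> T \<and> Ck_on k h T"
    proof (cases "of_int n * pi = t")
      case False
      define T where "T = {of_int n * pi<..<(of_int n + 1) * pi}"
      have T: "open T" "t \<in> T" using n False by (auto simp: T_def)
      have nz: "sin x \<noteq> 0" if "x \<in> T" for x using floor_interval(2)[of n x] that by (simp add: T_def)
      have "Ck_on k (\<lambda>x. cos x / sin x) T" for k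
        by (rule quok[where u = cos and v = sin and p = cos and q = sin, OF T(1) nz]) (auto intro!: holomorphic_intros simp: cos_of_real sin_of_real)
      from Ck_on_line[OF T(1) this, where p = 0 and v = 1 and S = UNIV and f = \<phi>, OF _ \<phi>k]
      have "Ck_on k (\<lambda>x. \<phi> (cos x / sin x)) T" by simp
      then have "Ck_on k (\<lambda>x. c powi n * (of_real ((sin x)\<^sup>2) powr z * \<phi> (cos x / sin x))) T"
        by (intro Ck_on_mult T(1) Ck_on_const powk[where u = sin and g = sin, OF T(1) nz]) (auto intro!: holomorphic_intros simp: sin_of_real)
      then have "Ck_on k h T"
        by (rule Ck_on_cong_imp[OF T(1), rotated]) (rule h1[symmetric], auto simp: T_def)
      then show ?thesis using T by blast
    next
      case True
      define T where "T = {of_int n * pi - pi / 2<..<of_int n * pi + pi / 2}"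
      have T: "open T" "t \<in> T" using True by (auto simp: T_def)
      have nz: "cos x \<noteq> 0" if "x \<in> T" for x
      proof -
        have "cos (x - of_int n * pi) > 0" using that by (intro cos_gt_zero_pi) (auto simp: T_def)
        moreover have "cos x = (if even n then cos (x - of_int n * pi) else - cos (x - of_int n * pi))"
          by (auto simp: cos_diff sin_int_times_real cos_int_times_real mult.commute)
        ultimately show ?thesis by (auto split: if_splits)
      qed
      have "Ck_on k (\<lambda>x. sin x / cos x) T" for k
        by (rule quok[where u = sin and v = cos and p = sin and q = cos, OF T(1) nz]) (auto intro!: holomorphic_intros simp: cos_of_real sin_of_real)
      from Ck_on_line[OF T(1) this, where p = 0 and v = 1 and S = UNIV and f = L, OF _ Lk]
      have "Ck_on k (\<lambda>x. L (sin x / cos x)) T" by simp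
      then have "Ck_on k (\<lambda>x. c powi n * (e * (of_real ((cos x)\<^sup>2) powr z * L (sin x / cos x)))) T"
        by (intro Ck_on_mult T(1) Ck_on_const powk[where u = cos and g = cos, OF T(1) nz]) (auto intro!: holomorphic_intros simp: cos_of_real)
      then have "Ck_on k h T"
        by (rule Ck_on_cong_imp[OF T(1), rotated]) (rule h2[symmetric], simp only: T_def greaterThanLessThan_iff abs_less_iff, linarith)
      then show ?thesis using T by blast
    qed
  qed
  have "c * c = - 1" using ee by (simp add: c_def)
  then have "norm c * norm c = 1" by (simp flip: norm_mult)
  then have "norm c = 1 \<or> norm c = - 1" by (simp only: square_eq_1_iff)
  then have nc: "norm c = 1" using norm_ge_zero[of c] by linarith
  have "family UNIV (\<lambda>_. h)"
    by (rule family_const_of_smooth_quasiperiodic[OF hk per nc]) simp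
  moreover have "f (w0 ** upper x, 1) = sin_pow (s + 1) x * h (arccot x)" for x
  proof -
    have sq: "sin (arccot x) \<noteq> 0" "(sin (arccot x))\<^sup>2 = inverse (1 + x\<^sup>2)" "cos (arccot x) / sin (arccot x) = x"
      using one_plus_sq_pos[of x] by (auto simp: sin_arccot cos_arccot power_divide inverse_eq_divide)
    have "h (arccot x) = c powi 0 * (of_real ((sin (arccot x))\<^sup>2) powr z * \<phi> (cos (arccot x) / sin (arccot x)))"
      by (rule h1) (use arccot_bounds[of x] in auto)
    then have "h (arccot x) = of_real (inverse (1 + x\<^sup>2)) powr z * \<phi> x" by (simp only: sq power_int_0_right mult_1)
    also have "complex_of_real (inverse (1 + x\<^sup>2)) powr z = inverse (of_real (1 + x\<^sup>2) powr z)"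
    proof -
      have "complex_of_real (1 + x\<^sup>2) powr z * of_real (inverse (1 + x\<^sup>2)) powr z = of_real ((1 + x\<^sup>2) * inverse (1 + x\<^sup>2)) powr z"
        using one_plus_sq_pos[of x] by (intro of_real_powr_mult[symmetric]) auto
      also have "(1 + x\<^sup>2) * inverse (1 + x\<^sup>2) = 1" using one_plus_sq_pos[of x] by simp
      finally show ?thesis by (simp add: inverse_unique)
    qed
    also have "of_real (1 + x\<^sup>2) powr z = sin_pow (s + 1) x" by (simp add: sin_pow_def z_def)
    moreover have "sin_pow (s + 1) x \<noteq> 0" using one_plus_sq_nz[of x] by (simp add: sin_pow_def)
    ultimately show ?thesis by (simp add: \<phi>_def)
  qed
  ultimately show ?thesis using that[of h] per by (simp add: c_def e_def)
qed


section \<open>The functional equation\<close>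

text \<open>Makes the definite descriptions in \<open>mero_cont\<close> and
  \<open>local_coeff\<close> unambiguous. The identity theorem applies to the difference with its
  singularities removed; equality at the poles holds because the value there is fixed to be
  0.\<close>

lemma nicely_meromorphic_unique:
  assumes f: "f nicely_meromorphic_on UNIV" and g: "g nicely_meromorphic_on UNIV"
    and eq: "frequently (\<lambda>z. f z = g z) (at z0)"
  shows "f = g"
proof
  fix z
  define d where "d w = f w - g w" for w
  have fm: "f meromorphic_on UNIV" and gm: "g meromorphic_on UNIV"
    using f g by (auto simp: nicely_meromorphic_on_def)
  have dm: "d meromorphic_on UNIV" unfolding d_def[abs_def] using fm gm by (intro meromorphic_intros)
  have rd: "remove_sings d nicely_meromorphic_on UNIV" by (rule remove_sings_nicely_meromorphic[OF dm])
  have ev: "eventually (\<lambda>w. remove_sings d w = d w) (at w0)" for w0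
    using eventually_cosparse_imp_eventually_at[OF eventually_remove_sings_eq[OF dm]] by simp
  have "frequently (\<lambda>w. remove_sings d w = 0) (at z0)"
    using frequently_eventually_frequently[OF eq ev[of z0]] by (rule frequently_elim1) (auto simp: d_def)
  then have z: "remove_sings d w = 0" for w
    by (rule frequently_eq_meromorphic_imp_constant[OF _ rd open_UNIV connected_UNIV UNIV_I UNIV_I])
  have e: "eventually (\<lambda>w. f w = g w) (at z)"
    using ev[of z] by eventually_elim (simp add: z d_def)
  have pole: "is_pole f z \<longleftrightarrow> is_pole g z" by (rule is_pole_cong[OF e refl])
  have F: "is_pole f z \<and> f z = 0 \<or> f \<midarrow>z\<rightarrow> f z" and G: "is_pole g z \<and> g z = 0 \<or> g \<midarrow>z\<rightarrow> g z"
    using f g by (auto simp: nicely_meromorphic_on_def)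
  show "f z = g z"
  proof (cases "is_pole f z")
    case True
    then have "\<not> f \<midarrow>z\<rightarrow> f z" "\<not> g \<midarrow>z\<rightarrow> g z"
      using pole unfolding is_pole_def by (metis at_neq_bot not_tendsto_and_filterlim_at_infinity)+
    then show ?thesis using F G by simp
  next
    case False
    then have "f \<midarrow>z\<rightarrow> f z" "g \<midarrow>z\<rightarrow> g z" using F G pole by auto
    moreover from this(1) have "g \<midarrow>z\<rightarrow> f z" by (rule Lim_transform_eventually[OF _ e])
    ultimately show ?thesis using LIM_unique by blast
  qed
qed

text \<open>\<open>remove_sings\<close> changes nothing at points where \<open>G\<close> is
  analytic, so \<open>G\<close> itself may be evaluated at \<open>s0\<close>.\<close>

lemma mero_cont_eqI:
  assumes G: "G meromorphic_on UNIV" and pos: "\<And>s. Re s > 0 \<Longrightarrow> G analytic_on {s} \<and> G s = F s"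
    and s0: "G analytic_on {s0}"
  shows "mero_cont F s0 = G s0"
proof -
  have R: "remove_sings G nicely_meromorphic_on UNIV" by (rule remove_sings_nicely_meromorphic[OF G])
  have RF: "remove_sings G s = F s" if "Re s > 0" for s using pos[OF that] by simp
  have "mero_cont F = remove_sings G"
    unfolding mero_cont_def
  proof (rule the_equality)
    fix H assume H: "H nicely_meromorphic_on UNIV \<and> (\<forall>s. Re s > 0 \<longrightarrow> H s = F s)"
    have "eventually (\<lambda>s::complex. s \<in> {s. Re s > 0}) (at 1)"
      by (intro eventually_at_in_open' open_halfspace_Re_gt) auto
    then have "eventually (\<lambda>s. H s = remove_sings G s) (at 1)"
      by eventually_elim (use H RF in auto)
    then show "H = remove_sings G"
      using H R by (intro nicely_meromorphic_unique[of _ _ 1] eventually_frequently) auto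
  qed (use R RF in auto)
  then show ?thesis using s0 by simp
qed

text \<open>The constant \<open>C\<close> is 1 for a vector of the principal series and
  \<open>cell_phase a chi * Gamma s\<close> for its image under the intertwining operator, to which
  the lemma is applied at \<open>- s\<close>.\<close>

lemma whittaker_eq:
  assumes F: "\<And>x. F (w0 ** upper x, 1) = C * (sin_pow (s0 + 1) x * h (arccot x))"
    and h: "family UNIV (\<lambda>_. h)" and a: "a \<noteq> 0"
  shows "whittaker a s0 F = C * whittaker_entire a s0 h"
proof -
  have hol: "(\<lambda>s. C * whittaker_entire a s h) holomorphic_on UNIV"
    by (intro holomorphic_intros holomorphic_whittaker_entire[OF h a])
  then have an: "(\<lambda>s. C * whittaker_entire a s h) analytic_on A" for A
    using analytic_on_open[OF open_UNIV] analytic_on_subset by blast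
  have flat: "flat_section s0 F s (w0 ** upper x, 1) * inverse (psi a x) = C * (sin_pow (s + 1) x * (inverse (psi a x) * h (arccot x)))" for s x
  proof -
    have "complex_of_real (1 + x\<^sup>2) powr ((s0 - s) / 2) = sin_pow (s - s0) x" by (simp add: sin_pow_def)
    moreover have "s0 + 1 + (s - s0) = s + 1" by simp
    then have "sin_pow (s0 + 1) x * sin_pow (s - s0) x = sin_pow (s + 1) x" by (simp only: sin_pow_add[symmetric])
    ultimately have "sin_pow (s0 + 1) x * complex_of_real (1 + x\<^sup>2) powr ((s0 - s) / 2) = sin_pow (s + 1) x" by simp
    moreover have "flat_section s0 F s (w0 ** upper x, 1) = F (w0 ** upper x, 1) * complex_of_real (1 + x\<^sup>2) powr ((s0 - s) / 2)"
      by (simp add: flat_section_def w0_upper)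
    ultimately show ?thesis unfolding F by (simp add: mult_ac)
  qed
  show ?thesis unfolding whittaker_def flat
  proof (rule mero_cont_eqI[OF analytic_on_imp_meromorphic_on[OF an] _ an])
    fix s :: complex assume "Re s > 0"
    then show "(\<lambda>s. C * whittaker_entire a s h) analytic_on {s} \<and> C * whittaker_entire a s h =
       (LINT x|lborel. C * (sin_pow (s + 1) x * (inverse (psi a x) * h (arccot x))))"
      using an whittaker_entire_pos[OF _ a h] by (simp add: whittaker_integral_def)
  qed
qed

lemma of_real_exp_powr: "complex_of_real (exp r) powr z = exp (of_real r * z)"
  by (simp add: powr_def mult.commute flip: exp_of_real)

text \<open>The substitution u = (w + x) / (1 + x^2) is affine and corresponds to the one in
  \<open>homogeneous_kernel_convolution\<close> under v = - 1 / u. The lower row (u, u x - 1) of the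
  product has squared length (1 + w^2) / (1 + x^2), so the factor that makes the section flat fits
  as well.\<close>

lemma flat_section_intertwining_integral:
  assumes f: "f \<in> principal_series a chi s0" and a: "a \<noteq> 0" and chi: "chi = triv_char \<or> chi = sign_char"
    and h: "family UNIV (\<lambda>_. h)" and per: "\<And>t. h (t + pi) = - cell_phase a chi * h t"
    and fh: "\<And>x. f (w0 ** upper x, 1) = sin_pow (s0 + 1) x * h (arccot x)"
    and s: "Re s > 0"
  shows "(LINT u|lborel. flat_section s0 f s ((w0 ** upper u, 1) \<bullet>\<^sub>M (w0 ** upper x, 1)))
    = cell_phase a chi * (sin_pow (1 - s) x * intertwining_integral s h (arccot x))"
proof -
  define e where "e = cell_phase a chi"
  have ee: "e * e = - 1" unfolding e_def by (rule cell_phase_sq[OF a chi])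
  define I where "I u = flat_section s0 f s ((w0 ** upper u, 1) \<bullet>\<^sub>M (w0 ** upper x, 1))" for u
  define k where "k w = e * sin_pow (1 - s) x * (sin_pow (s + 1) w * h (arccot x + arccot w))" for w
  define r where "r = 1 + x\<^sup>2"
  have r: "r > 0" unfolding r_def by (rule one_plus_sq_pos)
  have key: "I (x / r + (1 / r) * w) = of_real r * k w" if w: "w \<noteq> - x" for w
  proof -
    \<comment> \<open>\<open>y\<close> is the cotangent of \<open>arccot x + arccot w\<close>. The
      excluded value \<open>w = - x\<close> is u = 0, where the product leaves the big cell.\<close>
    define u y where "u = (w + x) / r" and "y = x - 1 / u"
    have wx: "w + x \<noteq> 0" using w by auto
    have u0: "u \<noteq> 0" using wx r by (simp add: u_def)
    have yw: "y = (x * w - 1) / (w + x)"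
      using wx r by (simp add: y_def u_def r_def field_simps power2_eq_square)
    have ph: "(if u > 0 then e else 1) * h (arccot y) = e * h (arccot x + arccot w)"
    proof (cases "w + x > 0")
      case True
      then have "u > 0" using r by (simp add: u_def)
      then show ?thesis using arccot_add(1)[OF True] by (simp add: yw add.commute)
    next
      case False
      then have wn: "w + x < 0" using wx by simp
      then have "\<not> u > 0" using r by (simp add: u_def zero_less_divide_iff)
      moreover have "h (arccot x + arccot w) = - e * h (arccot w + arccot x - pi)"
        using per[of "arccot w + arccot x - pi"] by (simp add: add.commute e_def)
      then have "e * h (arccot x + arccot w) = h (arccot w + arccot x - pi)"
        using ee by (simp add: mult.assoc[symmetric])
      ultimately show ?thesis using arccot_add(2)[OF wn] by (simp add: yw)
    qed
    define X W D where "X = ln (1 + x\<^sup>2)" and "W = ln (1 + w\<^sup>2)" and "D = ln \<bar>w + x\<bar>"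
    have D2: "(w + x)\<^sup>2 = exp (2 * D)" using wx by (simp add: D_def exp_double)
    have Xe: "1 + x\<^sup>2 = exp X" and We: "1 + w\<^sup>2 = exp W" and De: "\<bar>w + x\<bar> = exp D"
      using r one_plus_sq_pos[of w] wx by (simp_all add: X_def W_def D_def r_def)
    have ua: "\<bar>1 / u\<bar> = exp (X - D)"
      unfolding u_def abs_divide De using r by (simp add: r_def Xe exp_diff)
    have N: "u\<^sup>2 + (u * x - 1)\<^sup>2 = exp (W - X)"
    proof -
      have ux: "u * x - 1 = (w * x - 1) / r" using r by (simp add: u_def r_def field_simps power2_eq_square)
      have "u\<^sup>2 + (u * x - 1)\<^sup>2 = ((w + x)\<^sup>2 + (w * x - 1)\<^sup>2) / r\<^sup>2"
        unfolding ux unfolding u_def power_divide by (rule add_divide_distrib[symmetric])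
      also have "(w + x)\<^sup>2 + (w * x - 1)\<^sup>2 = (1 + w\<^sup>2) * r" by (simp add: r_def power2_eq_square algebra_simps)
      also have "(1 + w\<^sup>2) * r / r\<^sup>2 = (1 + w\<^sup>2) / r" using r by (simp add: power2_eq_square)
      finally show ?thesis by (simp add: We r_def Xe exp_diff)
    qed
    have y2: "1 + y\<^sup>2 = exp (X + W - 2 * D)"
    proof -
      have "1 + y\<^sup>2 = ((w + x)\<^sup>2 + (x * w - 1)\<^sup>2) / (w + x)\<^sup>2"
        unfolding yw using wx by (simp add: power_divide add_divide_distrib)
      also have "(w + x)\<^sup>2 + (x * w - 1)\<^sup>2 = (1 + x\<^sup>2) * (1 + w\<^sup>2)"
        by (simp add: power2_eq_square algebra_simps)
      finally show ?thesis unfolding D2 Xe We by (simp add: exp_diff exp_add)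
    qed
    have E: "of_real \<bar>1 / u\<bar> powr (s0 + 1) * (sin_pow (s0 + 1) y * of_real (u\<^sup>2 + (u * x - 1)\<^sup>2) powr ((s0 - s) / 2))
      = of_real r * (sin_pow (1 - s) x * sin_pow (s + 1) w)"
    proof -
      have "complex_of_real r = exp (of_real X)" by (simp add: r_def Xe exp_of_real)
      then show ?thesis
        unfolding sin_pow_def ua N y2 Xe We of_real_exp_powr by (simp add: exp_add[symmetric] field_simps)
    qed
    have "x / r + (1 / r) * w = u" by (simp add: u_def add_divide_distrib add.commute)
    then have "I (x / r + (1 / r) * w) = f (mat2 (- 1) (- x) u (u * x - 1), if u > 0 then - 1 else 1) * of_real (u\<^sup>2 + (u * x - 1)\<^sup>2) powr ((s0 - s) / 2)"
      by (simp only: I_def w0_mult_w0[OF u0] flat_section_def fst_conv mat2_nth)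
    also have "f (mat2 (- 1) (- x) u (u * x - 1), if u > 0 then - 1 else 1) = of_real \<bar>1 / u\<bar> powr (s0 + 1) * (if u > 0 then e else 1) * (sin_pow (s0 + 1) y * h (arccot y))"
      unfolding principal_series_cell[OF f a chi u0] fh y_def e_def ..
    also have "\<dots> * of_real (u\<^sup>2 + (u * x - 1)\<^sup>2) powr ((s0 - s) / 2) =
       (of_real \<bar>1 / u\<bar> powr (s0 + 1) * (sin_pow (s0 + 1) y * of_real (u\<^sup>2 + (u * x - 1)\<^sup>2) powr ((s0 - s) / 2))) * ((if u > 0 then e else 1) * h (arccot y))"
      by (simp only: mult_ac)
    also have "\<dots> = of_real r * k w"
      unfolding E ph k_def by (simp only: mult_ac)
    finally show ?thesis .
  qed
  have "continuous_on UNIV k"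
    unfolding k_def using continuous_arccot_compose[OF family_const_continuous[OF h]]
    by (intro continuous_intros)
  then have km: "k \<in> borel_measurable borel" by (rule borel_measurable_continuous_onI)
  \<comment> \<open>Measurability is read off from a function that is continuous up to one
    exceptional value at \<open>w = - x\<close>.\<close>
  have Ie: "(\<lambda>w. I (x / r + (1 / r) * w)) = (\<lambda>w. if w = - x then I (x / r + (1 / r) * (- x)) else of_real r * k w)"
    using key by auto
  have "(LINT u|lborel. I u) = \<bar>1 / r\<bar> *\<^sub>R (LINT w|lborel. I (x / r + (1 / r) * w))"
    using r by (intro lborel_integral_real_affine) auto
  also have "(LINT w|lborel. I (x / r + (1 / r) * w)) = (LINT w|lborel. of_real r * k w)"
  proof (rule integral_cong_AE)
    show "(\<lambda>w. I (x / r + (1 / r) * w)) \<in> borel_measurable lborel"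
      unfolding Ie using km by measurable
    show "(\<lambda>w. of_real r * k w) \<in> borel_measurable lborel" using km by measurable
    show "AE w in lborel. I (x / r + (1 / r) * w) = of_real r * k w"
      using AE_lborel_singleton[of "- x"] by eventually_elim (rule key)
  qed
  also have "\<bar>1 / r\<bar> *\<^sub>R (LINT w|lborel. of_real r * k w) = (LINT w|lborel. k w)"
    using r by (simp add: scaleR_conv_of_real)
  also have "\<dots> = e * (sin_pow (1 - s) x * intertwining_integral s h (arccot x))"
    by (simp add: k_def intertwining_integral_def mult.assoc)
  finally show ?thesis by (simp add: I_def e_def)
qed

text \<open>\<open>Gamma\<close> undoes the normalisation of \<open>intertwining_entire\<close>, and
  the excluded \<open>s0\<close> are its poles. The exponent \<open>- s0 + 1\<close> is that of a
  section at \<open>- s0\<close>, which makes \<open>whittaker_eq\<close> applicable to the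
  image.\<close>

lemma intertwining_eq:
  assumes f: "f \<in> principal_series a chi s0" and a: "a \<noteq> 0" and chi: "chi = triv_char \<or> chi = sign_char"
    and h: "family UNIV (\<lambda>_. h)" and per: "\<And>t. h (t + pi) = - cell_phase a chi * h t"
    and fh: "\<And>x. f (w0 ** upper x, 1) = sin_pow (s0 + 1) x * h (arccot x)"
    and s0: "s0 \<notin> \<int>\<^sub>\<le>\<^sub>0"
  shows "intertwining s0 f (w0 ** upper x, 1)
    = (cell_phase a chi * Gamma s0) * (sin_pow (- s0 + 1) x * intertwining_entire s0 h (arccot x))"
proof -
  define G where "G s = (cell_phase a chi * Gamma s) * (sin_pow (1 - s) x * intertwining_entire s h (arccot x))" for s
  have "(\<lambda>s. intertwining_entire s h (arccot x)) holomorphic_on UNIV"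
    using family_bounded[OF family_intertwining_entire[OF h]] by (auto simp: bounded_family_def)
  then have "(\<lambda>s. sin_pow (1 - s) x * intertwining_entire s h (arccot x)) holomorphic_on UNIV"
    by (intro holomorphic_intros)
  then have an: "(\<lambda>s. sin_pow (1 - s) x * intertwining_entire s h (arccot x)) analytic_on A" for A
    using analytic_on_open[OF open_UNIV] analytic_on_subset by blast
  have "(\<lambda>s::complex. inverse (rGamma s)) meromorphic_on UNIV"
    by (intro meromorphic_intros analytic_on_imp_meromorphic_on analytic_rGamma)
  then have Gmer: "Gamma meromorphic_on (UNIV :: complex set)" by (simp add: rGamma_inverse_Gamma)
  then have Gm: "G meromorphic_on UNIV"
    unfolding G_def[abs_def] by (intro meromorphic_intros Gmer analytic_on_imp_meromorphic_on[OF an])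
  have Ga: "G analytic_on {s}" if "s \<notin> \<int>\<^sub>\<le>\<^sub>0" for s
    unfolding G_def[abs_def] using that by (intro analytic_intros an) auto
  have "mero_cont (\<lambda>s. LINT u|lborel. flat_section s0 f s ((w0 ** upper u, 1) \<bullet>\<^sub>M (w0 ** upper x, 1))) s0 = G s0"
  proof (rule mero_cont_eqI[OF Gm _ Ga[OF s0]])
    fix s :: complex assume s: "Re s > 0"
    then have ns: "s \<notin> \<int>\<^sub>\<le>\<^sub>0" by (auto elim!: nonpos_Ints_cases)
    then have "Gamma s * rGamma s = 1" by (simp add: rGamma_inverse_Gamma Gamma_eq_zero_iff)
    then have "Gamma s * intertwining_entire s h (arccot x) = intertwining_integral s h (arccot x)"
      using intertwining_entire_pos[OF s h] by (simp add: mult.assoc[symmetric])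
    then have "G s = cell_phase a chi * (sin_pow (1 - s) x * intertwining_integral s h (arccot x))"
      by (simp add: G_def mult_ac)
    then show "G analytic_on {s} \<and> G s = (LINT u|lborel. flat_section s0 f s ((w0 ** upper u, 1) \<bullet>\<^sub>M (w0 ** upper x, 1)))"
      using flat_section_intertwining_integral[OF f a chi h per fh s] Ga[OF ns] by simp
  qed
  then show ?thesis by (simp add: intertwining_def G_def)
qed

lemma holomorphic_kernel_factor:
  assumes "a \<noteq> 0" shows "(\<lambda>s. kernel_factor s e a) holomorphic_on A"
proof -
  have "(\<lambda>s. exp (- s * Ln (- \<i> * of_real a)) + e * exp (- s * Ln (- \<i> * of_real (- a)))) holomorphic_on A"
    by (intro holomorphic_intros)
  then show ?thesis using assms by (simp add: kernel_factor_def powr_def)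
qed

lemma functional_equation_entire:
  assumes a: "a \<noteq> 0" and e: "e * e = - 1" and h: "family UNIV (\<lambda>_. h)"
    and per: "\<And>t. h (t + pi) = - e * h t"
  shows "e * whittaker_entire a (- s) (intertwining_entire s h) = kernel_factor s e a * whittaker_entire a s h"
proof -
  let ?f = "\<lambda>s. e * whittaker_entire a (- s) (intertwining_entire s h) - kernel_factor s e a * whittaker_entire a s h"
  \<comment> \<open>\<open>holomorphic_whittaker_entire\<close> wants the functional and its section
    in the same parameter. The section is therefore taken at \<open>- s\<close>, and composition
    with negation restores the original signs.\<close>
  have "family UNIV (\<lambda>s. intertwining_entire (- s) h)"
    by (rule family_compose[OF family_intertwining_entire[OF h]]) (auto intro!: holomorphic_intros)
  then have "(\<lambda>s. whittaker_entire a s (intertwining_entire (- s) h)) holomorphic_on UNIV"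
    by (rule holomorphic_whittaker_entire[OF _ a])
  then have "(\<lambda>s. whittaker_entire a s (intertwining_entire (- s) h)) \<circ> uminus holomorphic_on UNIV"
    by (intro holomorphic_on_compose_gen[where t = UNIV]) (auto intro!: holomorphic_intros)
  then have hol: "(\<lambda>s. whittaker_entire a (- s) (intertwining_entire s h)) holomorphic_on UNIV"
    by (simp add: o_def)
  have "?f s = 0"
  proof (rule analytic_continuation[of ?f UNIV "of_real ` {0<..<1}" "1 / 2"])
    show "?f holomorphic_on UNIV"
      by (intro holomorphic_intros hol holomorphic_kernel_factor a holomorphic_whittaker_entire h)
    show "(1 / 2 :: complex) islimpt of_real ` {0<..<1}"
      unfolding islimpt_sequential
    proof (intro exI[of _ "\<lambda>n. of_real (1 / 2 + 1 / (2 * real (n + 2)))"] conjI allI)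
      have "(\<lambda>n. complex_of_real (1 / 2 + 1 / (2 * real (n + 2)))) \<longlonglongrightarrow> of_real (1 / 2)"
        by (intro tendsto_of_real) real_asymp
      then show "(\<lambda>n. complex_of_real (1 / 2 + 1 / (2 * real (n + 2)))) \<longlonglongrightarrow> 1 / 2" by simp
      fix n
      define r where "r = 1 / (2 * real (n + 2))"
      have "0 < r" "r < 1 / 2" by (auto simp: r_def field_simps)
      then have m: "1 / 2 + r \<in> {0<..<1}" "complex_of_real (1 / 2 + r) \<noteq> of_real (1 / 2)" by (auto simp only: of_real_eq_iff greaterThanLessThan_iff)
      have "complex_of_real (1 / 2 + r) \<in> of_real ` {0<..<1}" using m(1) by (rule imageI)
      moreover have "complex_of_real (1 / 2 + r) \<noteq> 1 / 2" using m(2) by simp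
      ultimately have "complex_of_real (1 / 2 + r) \<in> of_real ` {0<..<1} - {1 / 2}" by blast
      then show "complex_of_real (1 / 2 + 1 / (2 * real (n + 2))) \<in> of_real ` {0<..<1} - {1 / 2}" by (simp only: r_def)
    qed
    show "?f w = 0" if "w \<in> of_real ` {0<..<1}" for w
      using that functional_equation_segment[OF _ _ a e h per] by auto
  qed auto
  then show ?thesis by simp
qed

lemma whittaker_intertwining:
  assumes f: "f \<in> principal_series a chi s" and a: "a \<noteq> 0" and chi: "chi = triv_char \<or> chi = sign_char"
    and s: "s \<notin> \<int>\<^sub>\<le>\<^sub>0"
  shows "whittaker a (- s) (intertwining s f) = Gamma s * kernel_factor s (cell_phase a chi) a * whittaker a s f"
proof -
  obtain h where h: "family UNIV (\<lambda>_. h)" and per: "\<And>t. h (t + pi) = - cell_phase a chi * h t"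
    and fh: "\<And>x. f (w0 ** upper x, 1) = sin_pow (s + 1) x * h (arccot x)"
    using principal_series_circle[OF f a chi] by blast
  have k: "family UNIV (\<lambda>_. intertwining_entire s h)"
    by (rule family_at[OF family_intertwining_entire[OF h]]) simp
  have "whittaker a (- s) (intertwining s f) = (cell_phase a chi * Gamma s) * whittaker_entire a (- s) (intertwining_entire s h)"
    by (rule whittaker_eq[OF intertwining_eq[OF f a chi h per fh s] k a])
  also have "\<dots> = Gamma s * (cell_phase a chi * whittaker_entire a (- s) (intertwining_entire s h))" by simp
  also have "\<dots> = Gamma s * (kernel_factor s (cell_phase a chi) a * whittaker_entire a s h)"
    by (simp only: functional_equation_entire[OF a cell_phase_sq[OF a chi] h per])
  also have "whittaker_entire a s h = whittaker a s f"
    using whittaker_eq[of f 1 s h, OF _ h a] fh by simp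
  finally show ?thesis by (simp add: mult.assoc)
qed


section \<open>A vector of half-integral weight\<close>

text \<open>The power \<open>\<eta> / 2\<close> of \<zeta> / \<bar>\<zeta>\<bar>, on the principal
  branch. Its jump along the negative axis is what compensates the Kubota cocycle.\<close>

definition weight :: "real \<Rightarrow> complex \<Rightarrow> complex" where
  "weight \<eta> \<zeta> = exp (\<i> * of_real (\<eta> * Im (Ln \<zeta>) / 2))"

text \<open>For the lower row (c, d) the branch is taken at d - i c and not at d + i c: on the negative real
  axis, where c = 0 and d < 0, the argument of d + i c would jump to the wrong side for the Kubota
  cocycle.\<close>

definition weight_vector :: "real \<Rightarrow> complex \<Rightarrow> mp \<Rightarrow> complex" where
  "weight_vector \<eta> s g = of_int (snd g) *
     (of_real ((fst g $ 2 $ 1)\<^sup>2 + (fst g $ 2 $ 2)\<^sup>2) powr (- (s + 1) / 2) * weight \<eta> (Complex (fst g $ 2 $ 2) (- fst g $ 2 $ 1)))"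

lemma exp_quarter:
  assumes "\<eta> = 1 \<or> \<eta> = - 1"
  shows "exp (\<i> * of_real (\<eta> * pi / 2)) = \<i> * of_real \<eta>"
  unfolding cis_conv_exp[symmetric] using assms by (auto simp: complex_eq_iff)

text \<open>The argument changes by pi, up or down according to which keeps the principal branch;
  the two directions differ by the sign.\<close>

lemma weight_minus:
  assumes \<eta>: "\<eta> = 1 \<or> \<eta> = - 1" and \<zeta>: "\<zeta> \<noteq> 0"
  shows "weight \<eta> (- \<zeta>) = (if Im \<zeta> > 0 \<or> Im \<zeta> = 0 \<and> Re \<zeta> < 0 then - 1 else 1) * (\<i> * of_real \<eta>) * weight \<eta> \<zeta>"
proof -
  have q: "exp (\<i> * of_real (\<eta> * pi / 2)) = \<i> * of_real \<eta>" by (rule exp_quarter[OF \<eta>])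
  define A where "A = Im (Ln \<zeta>)"
  have Lm: "Im (Ln (- \<zeta>)) = (if Im \<zeta> > 0 \<or> Im \<zeta> = 0 \<and> Re \<zeta> < 0 then A - pi else A + pi)"
    using \<zeta> unfolding A_def by (subst Ln_minus) (auto simp: not_le)
  have "exp (\<i> * of_real (\<eta> * (A + pi) / 2)) = \<i> * of_real \<eta> * exp (\<i> * of_real (\<eta> * A / 2))"
  proof -
    have "\<i> * complex_of_real (\<eta> * (A + pi) / 2) = \<i> * of_real (\<eta> * pi / 2) + \<i> * of_real (\<eta> * A / 2)"
      by (simp add: field_simps)
    then show ?thesis by (simp only: exp_add q)
  qed
  moreover have "exp (\<i> * of_real (\<eta> * (A - pi) / 2)) = - (\<i> * of_real \<eta>) * exp (\<i> * of_real (\<eta> * A / 2))"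
  proof -
    have "\<i> * complex_of_real (\<eta> * (A - pi) / 2) = - (\<i> * of_real (\<eta> * pi / 2)) + \<i> * of_real (\<eta> * A / 2)"
      by (simp add: field_simps)
    moreover have "inverse (\<i> * of_real \<eta>) = - (\<i> * complex_of_real \<eta>)" using \<eta> by auto
    ultimately show ?thesis by (simp only: exp_add exp_minus q)
  qed
  ultimately show ?thesis
    unfolding weight_def Lm A_def[symmetric]
    by (cases "Im \<zeta> > 0 \<or> Im \<zeta> = 0 \<and> Re \<zeta> < 0") (simp_all only: if_True if_False mult_minus_left mult_1)
qed

lemma weight_scale:
  assumes "r > 0" "\<zeta> \<noteq> 0" shows "weight \<eta> (of_real r * \<zeta>) = weight \<eta> \<zeta>"
  using assms by (simp add: weight_def Ln_times_of_real)

text \<open>Off the cut the function is a product of a holomorphic function of \<zeta> and one of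
  its conjugate, which brings it into the scope of \<open>Ck_on_holomorphic_compose\<close>. The two
  exponents have sum \<open>- (s + 1)\<close> and difference \<open>\<eta> / 2\<close>.\<close>

lemma weight_norm_powr:
  assumes "\<zeta> \<notin> \<real>\<^sub>\<le>\<^sub>0"
  shows "of_real ((norm \<zeta>)\<^sup>2) powr (- (s + 1) / 2) * weight \<eta> \<zeta> =
    exp ((- (s + 1) / 2 + of_real \<eta> / 4) * Ln \<zeta>) * exp ((- (s + 1) / 2 - of_real \<eta> / 4) * Ln (cnj \<zeta>))"
proof -
  have z: "\<zeta> \<noteq> 0" using assms by auto
  define l A where "l = ln (norm \<zeta>)" and "A = Im (Ln \<zeta>)"
  have "norm \<zeta> = exp l" using z by (simp add: l_def)
  then have n: "(norm \<zeta>)\<^sup>2 = exp (2 * l)" by (simp add: exp_double)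
  have L: "Ln \<zeta> = of_real l + \<i> * of_real A"
    using z by (simp add: complex_eq_iff l_def A_def)
  have Lc: "Ln (cnj \<zeta>) = of_real l - \<i> * of_real A"
    using assms by (subst cnj_Ln[symmetric]) (simp_all add: L)
  show ?thesis
  proof -
    have "of_real (2 * l) * (- (s + 1) / 2) + \<i> * of_real (\<eta> * A / 2) =
      (- (s + 1) / 2 + of_real \<eta> / 4) * (of_real l + \<i> * of_real A) + (- (s + 1) / 2 - of_real \<eta> / 4) * (of_real l - \<i> * of_real A)"
      by (simp add: field_simps)
    moreover have "weight \<eta> \<zeta> = exp (\<i> * of_real (\<eta> * A / 2))" by (simp only: weight_def A_def)
    ultimately show ?thesis
      unfolding n of_real_exp_powr L Lc exp_add[symmetric] by (simp only: exp_add[symmetric])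
  qed
qed

lemma weight_vector_mat2:
  "weight_vector \<eta> s (mat2 p q r m, \<epsilon>) = of_int \<epsilon> * (of_real ((norm (Complex m (- r)))\<^sup>2) powr (- (s + 1) / 2) * weight \<eta> (Complex m (- r)))"
  by (simp add: weight_vector_def cmod_power2 add.commute)

lemma Mp_cases:
  assumes "h \<in> Mp"
  obtains p q r m \<epsilon> where "h = (mat2 p q r m, \<epsilon>)" "p * m - q * r = 1"
proof -
  define g where "g = fst h"
  have "det g = 1" using assms by (auto simp: Mp_def g_def)
  then have "g $ 1 $ 1 * g $ 2 $ 2 - g $ 1 $ 2 * g $ 2 $ 1 = 1" by (simp add: det_2)
  moreover have "h = (mat2 (g $ 1 $ 1) (g $ 1 $ 2) (g $ 2 $ 1) (g $ 2 $ 2), snd h)"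
    unfolding mat2_eta[symmetric] by (simp add: g_def)
  ultimately show ?thesis by (rule that[rotated])
qed

text \<open>On a single chart the sign of \<open>m\<close> decides whether \<zeta> or -\<zeta>
  avoids the cut. For m \<ge> 0 the cocycle is constant; for m < 0 the jump of \<open>weight\<close>
  under \<zeta> to -\<zeta> equals the jump of the cocycle up to a constant.\<close>

lemma mp_smooth_weight_vector:
  assumes \<eta>: "\<eta> = 1 \<or> \<eta> = - 1"
  shows "mp_smooth (weight_vector \<eta> s)"
  unfolding mp_smooth_def
proof (intro ballI allI)
  fix h k assume "h \<in> Mp"
  then obtain p q r m \<epsilon> where h: "h = (mat2 p q r m, \<epsilon>)" and det: "p * m - q * r = 1"
    by (rule Mp_cases)
  define S where "S = (UNIV \<times> {0<..} \<times> UNIV :: (real \<times> real \<times> real) set)"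
  have S: "open S" unfolding S_def by (intro open_Times) auto
  define \<zeta> where "\<zeta> P = Complex ((r + m * fst P) * fst (snd P) * snd (snd P) + m * inverse (fst (snd P))) (- ((r + m * fst P) * fst (snd P)))" for P
  define G where "G w = exp ((- (s + 1) / 2 + of_real \<eta> / 4) * Ln w) * exp ((- (s + 1) / 2 - of_real \<eta> / 4) * Ln (cnj w))" for w
  define \<kappa> where "\<kappa> y = kubota_cocycle (mat2 p q r m) (lower y)" for y
  have nz: "r \<noteq> 0 \<or> m \<noteq> 0" using det by auto
  have val: "weight_vector \<eta> s (mp_chart h P) = of_int (\<epsilon> * \<kappa> (fst P)) * (of_real ((norm (\<zeta> P))\<^sup>2) powr (- (s + 1) / 2) * weight \<eta> (\<zeta> P))"
    if "P \<in> S" for P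
  proof -
    obtain y t x where P: "P = (y, t, x)" using prod_cases3 by blast
    then have t: "t > 0" using that by (simp add: S_def)
    show ?thesis unfolding h P mp_chart_eq[OF det t] weight_vector_mat2 by (simp add: \<zeta>_def \<kappa>_def)
  qed
  have z0: "\<zeta> P \<noteq> 0" if "P \<in> S" for P
    using that nz by (auto simp: \<zeta>_def S_def complex_eq_iff)
  have \<zeta>k: "Ck_on k \<zeta> S"
  proof -
    have c1: "Ck_on k (\<lambda>P. complex_of_real (fst P)) S" 
      by (intro Ck_on_linear[OF _ S] bounded_linear_compose[OF bounded_linear_of_real] bounded_linear_fst)
    have c2: "Ck_on k (\<lambda>P. complex_of_real (fst (snd P))) S"
      by (intro Ck_on_linear[OF _ S] bounded_linear_compose[OF bounded_linear_of_real] bounded_linear_compose[OF bounded_linear_fst] bounded_linear_snd)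
    have c3: "Ck_on k (\<lambda>P. complex_of_real (snd (snd P))) S"
      by (intro Ck_on_linear[OF _ S] bounded_linear_compose[OF bounded_linear_of_real] bounded_linear_compose[OF bounded_linear_snd] bounded_linear_snd)
    have c4: "Ck_on k (\<lambda>P. inverse (complex_of_real (fst (snd P)))) S"
      by (rule Ck_on_holomorphic_compose[OF S _ _ c2, of "- {0}" inverse]) (auto intro!: holomorphic_intros simp: S_def)
    have "Ck_on k (\<lambda>P. ((of_real r + of_real m * of_real (fst P)) * of_real (fst (snd P)) * of_real (snd (snd P)) + of_real m * inverse (of_real (fst (snd P))))
       + - \<i> * ((of_real r + of_real m * of_real (fst P)) * of_real (fst (snd P)))) S"
      by (intro Ck_on_add Ck_on_mult Ck_on_const S c1 c2 c3 c4)
    also have "(\<lambda>P. ((of_real r + of_real m * of_real (fst P)) * of_real (fst (snd P)) * of_real (snd (snd P)) + of_real m * inverse (of_real (fst (snd P))))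
       + - \<i> * ((of_real r + of_real m * of_real (fst P)) * of_real (fst (snd P)))) = \<zeta>"
      by (auto simp: \<zeta>_def complex_eq_iff fun_eq_iff simp flip: of_real_inverse)
    finally show ?thesis .
  qed
  have Gk: "Ck_on k (\<lambda>P. G (u * \<zeta> P)) S" if u: "\<And>P. P \<in> S \<Longrightarrow> u * \<zeta> P \<notin> \<real>\<^sub>\<le>\<^sub>0" for u
  proof -
    have k1: "Ck_on k (\<lambda>P. u * \<zeta> P) S" by (intro Ck_on_mult Ck_on_const S \<zeta>k)
    have k2: "Ck_on k (\<lambda>P. cnj (u * \<zeta> P)) S" by (rule Ck_on_bounded_linear[OF bounded_linear_cnj S k1])
    have "Ck_on k (\<lambda>P. exp (b * Ln (u * \<zeta> P))) S" for b
      by (rule Ck_on_holomorphic_compose[OF S _ _ k1, of "- \<real>\<^sub>\<le>\<^sub>0" "\<lambda>w. exp (b * Ln w)"])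
         (use u in \<open>auto intro!: holomorphic_intros\<close>)
    moreover have "Ck_on k (\<lambda>P. exp (b * Ln (cnj (u * \<zeta> P)))) S" for b
    proof (rule Ck_on_holomorphic_compose[OF S _ _ k2, of "- \<real>\<^sub>\<le>\<^sub>0" "\<lambda>w. exp (b * Ln w)"])
      have "cnj w \<notin> \<real>\<^sub>\<le>\<^sub>0" if "w \<notin> \<real>\<^sub>\<le>\<^sub>0" for w
        using that by (simp add: complex_nonpos_Reals_iff)
      then show "(\<lambda>P. cnj (u * \<zeta> P)) ` S \<subseteq> - \<real>\<^sub>\<le>\<^sub>0" using u by blast
    qed (auto intro!: holomorphic_intros)
    ultimately show ?thesis unfolding G_def by (intro Ck_on_mult S)
  qed
  have \<kappa>: "\<kappa> y = (if m \<ge> 0 then 1 else if r > 0 then (if r + m * y \<le> 0 then - 1 else 1) else (if r + m * y > 0 then - 1 else 1))" for y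
    unfolding \<kappa>_def by (rule kubota_cocycle_lower[OF nz])
  have "\<exists>u C. (\<forall>P\<in>S. u * \<zeta> P \<notin> \<real>\<^sub>\<le>\<^sub>0) \<and> (\<forall>P\<in>S. C * G (u * \<zeta> P) = weight_vector \<eta> s (mp_chart h P))"
  proof (cases "m \<ge> 0")
    case True
    have n: "1 * \<zeta> P \<notin> \<real>\<^sub>\<le>\<^sub>0" if P: "P \<in> S" for P
    proof
      assume "1 * \<zeta> P \<in> \<real>\<^sub>\<le>\<^sub>0"
      then have "Im (\<zeta> P) = 0" "Re (\<zeta> P) \<le> 0" by (auto simp: complex_nonpos_Reals_iff)
      moreover have t: "fst (snd P) > 0" using P by (auto simp: S_def)
      ultimately have "(r + m * fst P) = 0" "m * inverse (fst (snd P)) \<le> 0" by (auto simp: \<zeta>_def)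
      then have "m \<le> 0" using t by (simp add: mult_le_0_iff)
      then show False using True nz \<open>r + m * fst P = 0\<close> by auto
    qed
    moreover have "of_int \<epsilon> * G (1 * \<zeta> P) = weight_vector \<eta> s (mp_chart h P)" if "P \<in> S" for P
      unfolding val[OF that] G_def mult_1 using weight_norm_powr[of "\<zeta> P" s \<eta>] n[OF that] True \<kappa> by simp
    ultimately show ?thesis by (intro exI[of _ 1] exI[of _ "of_int \<epsilon>"]) auto
  next
    case False
    have n: "- 1 * \<zeta> P \<notin> \<real>\<^sub>\<le>\<^sub>0" if P: "P \<in> S" for P
    proof
      assume "- 1 * \<zeta> P \<in> \<real>\<^sub>\<le>\<^sub>0"
      then have "Im (\<zeta> P) = 0" "Re (\<zeta> P) \<ge> 0" by (auto simp: complex_nonpos_Reals_iff)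
      moreover have t: "fst (snd P) > 0" using P by (auto simp: S_def)
      ultimately have "(r + m * fst P) = 0" "m * inverse (fst (snd P)) \<ge> 0" by (auto simp: \<zeta>_def)
      then have "m \<ge> 0" using t by (simp add: zero_le_mult_iff)
      then show False using False by auto
    qed
    \<comment> \<open>The constant that relates the two jumps. It depends on the sign of
      \<open>r\<close> because the cocycle is normalised to be 1 at \<open>y = 0\<close>, while the
      sign in \<open>weight_minus\<close> is decided by \<open>r + m * y \<le> 0\<close>
      alone.\<close>
    define \<delta> :: complex where "\<delta> = (if r > 0 then - \<i> * of_real \<eta> else \<i> * of_real \<eta>)"
    have "of_int \<epsilon> * \<delta> * G (- 1 * \<zeta> P) = weight_vector \<eta> s (mp_chart h P)" if P: "P \<in> S" for P
    proof -
      have t: "fst (snd P) > 0" using P by (auto simp: S_def)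
      have ee: "\<i> * of_real \<eta> * (\<i> * of_real \<eta>) = (- 1 :: complex)" using \<eta> by auto
      have cond: "(Im (\<zeta> P) > 0 \<or> Im (\<zeta> P) = 0 \<and> Re (\<zeta> P) < 0) \<longleftrightarrow> r + m * fst P \<le> 0"
      proof -
        have "Im (\<zeta> P) > 0 \<longleftrightarrow> r + m * fst P < 0" "Im (\<zeta> P) = 0 \<longleftrightarrow> r + m * fst P = 0"
          using t by (auto simp: \<zeta>_def mult_less_0_iff)
        moreover have "Re (\<zeta> P) < 0" if "r + m * fst P = 0"
          using that t False by (auto simp: \<zeta>_def mult_less_0_iff not_le)
        ultimately show ?thesis by auto
      qed
      have "of_real ((norm (\<zeta> P))\<^sup>2) powr (- (s + 1) / 2) * weight \<eta> (- \<zeta> P) = G (- 1 * \<zeta> P)"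
        using weight_norm_powr[of "- \<zeta> P" s \<eta>] n[OF P] by (simp add: G_def)
      then have "\<delta> * G (- 1 * \<zeta> P) = of_real ((norm (\<zeta> P))\<^sup>2) powr (- (s + 1) / 2) * (\<delta> * weight \<eta> (- \<zeta> P))"
        by (simp add: mult_ac)
      also have "\<delta> * weight \<eta> (- \<zeta> P) = of_int (\<kappa> (fst P)) * weight \<eta> (\<zeta> P)"
        unfolding weight_minus[OF \<eta> z0[OF P]] cond \<delta>_def \<kappa>
        using ee False by (auto simp: mult.assoc[symmetric])
      finally show ?thesis unfolding val[OF P] by (simp add: mult_ac)
    qed
    then show ?thesis using n by (intro exI[of _ "- 1"] exI[of _ "of_int \<epsilon> * \<delta>"]) auto
  qed
  then obtain u C where u: "\<And>P. P \<in> S \<Longrightarrow> u * \<zeta> P \<notin> \<real>\<^sub>\<le>\<^sub>0" and C: "\<And>P. P \<in> S \<Longrightarrow> C * G (u * \<zeta> P) = weight_vector \<eta> s (mp_chart h P)"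
    by blast
  have "Ck_on k (\<lambda>P. C * G (u * \<zeta> P)) S" by (intro Ck_on_mult Ck_on_const S Gk u)
  then show "Ck_on k (\<lambda>p. weight_vector \<eta> s (mp_chart h p)) (UNIV \<times> {0<..} \<times> UNIV)"
    unfolding S_def[symmetric] by (rule Ck_on_cong_imp[OF S, rotated]) (rule C)
qed

text \<open>For \<open>t < 0\<close> the lower row is scaled by a negative number, and
  \<open>weight_minus\<close> produces \<open>\<i> * of_real \<eta>\<close> up to a sign; this sign
  cancels the Kubota sign \<open>\<kappa>\<close> of the product.\<close>

lemma weight_vector_principal_series:
  assumes a: "a \<noteq> 0" and chi: "chi = triv_char \<or> chi = sign_char"
    and \<eta>: "\<eta> = 1 \<or> \<eta> = - 1" and phase: "cell_phase a chi = \<i> * of_real \<eta>"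
  shows "weight_vector \<eta> s \<in> principal_series a chi s"
  unfolding principal_series_def
proof (intro CollectI conjI allI ballI impI mp_smooth_weight_vector[OF \<eta>])
  fix t b :: real and \<epsilon> :: int and g :: mp
  assume \<epsilon>: "\<epsilon> \<in> {1, - 1}" and g: "g \<in> Mp" and t: "t \<noteq> 0"
  obtain p q r m \<epsilon>' where h: "g = (mat2 p q r m, \<epsilon>')" and det: "p * m - q * r = 1"
    using g by (rule Mp_cases)
  have nz: "r \<noteq> 0 \<or> m \<noteq> 0" using det by auto
  define \<zeta> where "\<zeta> = Complex m (- r)"
  have z0: "\<zeta> \<noteq> 0" using nz by (auto simp: \<zeta>_def complex_eq_iff)
  define \<kappa> :: int where "\<kappa> = (if t < 0 \<and> (r < 0 \<or> r = 0 \<and> m < 0) then - 1 else 1)"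
  have prod: "(mat2 t b 0 (inverse t), \<epsilon>) \<bullet>\<^sub>M g = (mat2 (t * p + b * r) (t * q + b * m) (inverse t * r) (inverse t * m), \<epsilon> * \<epsilon>' * \<kappa>)"
    using nz t by (cases "r = 0") (auto simp: h \<kappa>_def mat2_mult kubota_cocycle_def kubota_x_mat2 hilbert_symbol_nonzero mult_less_0_iff zero_less_mult_iff)
  have z': "Complex (inverse t * m) (- (inverse t * r)) = of_real (inverse t) * \<zeta>"
    by (simp only: \<zeta>_def complex_of_real_mult_Complex mult_minus_right)
  have pw: "of_real ((norm (of_real (inverse t) * \<zeta>))\<^sup>2) powr (- (s + 1) / 2) = of_real \<bar>t\<bar> powr (s + 1) * of_real ((norm \<zeta>)\<^sup>2) powr (- (s + 1) / 2)"
  proof -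
    define T Z where "T = ln \<bar>t\<bar>" and "Z = ln (norm \<zeta>)"
    have T: "\<bar>t\<bar> = exp T" and Z: "(norm \<zeta>)\<^sup>2 = exp (2 * Z)" using t z0 by (simp_all add: T_def Z_def exp_double)
    have "norm (of_real (inverse t) * \<zeta>) = exp (Z - T)"
      using t z0 by (simp add: norm_mult norm_inverse exp_diff T_def Z_def divide_inverse norm_divide)
    then have N: "(norm (of_real (inverse t) * \<zeta>))\<^sup>2 = exp (2 * (Z - T))" by (simp only: exp_double)
    have "of_real (2 * (Z - T)) * (- (s + 1) / 2) = of_real T * (s + 1) + of_real (2 * Z) * (- (s + 1) / 2)"
      by (simp add: field_simps)
    then show ?thesis unfolding N unfolding T Z of_real_exp_powr exp_add[symmetric] by (simp only:)
  qed
  have ee: "\<i> * of_real \<eta> * (\<i> * of_real \<eta>) = (- 1 :: complex)" using \<eta> by auto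
  have wt: "of_int \<kappa> * weight \<eta> (of_real (inverse t) * \<zeta>) = (if t > 0 then 1 else cell_phase a chi) * weight \<eta> \<zeta>"
  proof (cases "t > 0")
    case True
    then show ?thesis using weight_scale[of "inverse t" \<zeta> \<eta>] z0 by (simp add: \<kappa>_def)
  next
    case False
    then have tn: "t < 0" using t by simp
    have "of_real (inverse t) * \<zeta> = of_real (inverse (- t)) * (- \<zeta>)" by simp
    then have "weight \<eta> (of_real (inverse t) * \<zeta>) = weight \<eta> (- \<zeta>)"
      using weight_scale[of "inverse (- t)" "- \<zeta>" \<eta>] z0 tn by simp
    moreover have "(Im \<zeta> > 0 \<or> Im \<zeta> = 0 \<and> Re \<zeta> < 0) \<longleftrightarrow> (r < 0 \<or> r = 0 \<and> m < 0)"
      by (auto simp: \<zeta>_def)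
    ultimately show ?thesis using weight_minus[OF \<eta> z0] tn phase by (simp add: \<kappa>_def)
  qed
  have "weight_vector \<eta> s ((mat2 t b 0 (inverse t), \<epsilon>) \<bullet>\<^sub>M g) =
     of_int \<epsilon> * of_real \<bar>t\<bar> powr (s + 1) * of_int \<epsilon>' * of_real ((norm \<zeta>)\<^sup>2) powr (- (s + 1) / 2) * (of_int \<kappa> * weight \<eta> (of_real (inverse t) * \<zeta>))"
    unfolding prod weight_vector_mat2 z' pw by (simp add: mult_ac)
  also have "\<dots> = of_int \<epsilon> * of_real \<bar>t\<bar> powr (s + 1) * (if t > 0 then 1 else cell_phase a chi) * weight_vector \<eta> s g"
    unfolding wt h weight_vector_mat2 \<zeta>_def[symmetric] by (simp only: mult_ac)
  also have "(if t > 0 then 1 else cell_phase a chi) = chi t * inverse (weil_index a t)"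
    by (rule char_weil_index[OF a chi t, symmetric])
  finally show "weight_vector \<eta> s ((mat2 t b 0 (inverse t), \<epsilon>) \<bullet>\<^sub>M g) =
    of_int \<epsilon> * of_real \<bar>t\<bar> powr (s + 1) * chi t * inverse (weil_index a t) * weight_vector \<eta> s g"
    by (simp only: mult.assoc)
qed

text \<open>This is exp (i \<eta> (pi - t) / 2), written as a product to match
  \<open>family_scalar\<close> and \<open>family_exp\<close>. At \<open>w0 ** upper x\<close> the
  branch is taken at - x + i, whose argument is \<open>pi - arccot x\<close>.\<close>

definition circle_weight :: "real \<Rightarrow> real \<Rightarrow> complex" where
  "circle_weight \<eta> t = exp (\<i> * of_real (\<eta> * pi / 2)) * exp (\<i> * of_real (- \<eta> / 2 * t))"

lemma family_circle_weight: "family UNIV (\<lambda>_. circle_weight \<eta>)"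
  unfolding circle_weight_def[abs_def] by (intro family_mult family_scalar family_exp) auto

lemma weight_vector_cell:
  "weight_vector \<eta> s (w0 ** upper x, 1) = sin_pow (s + 1) x * circle_weight \<eta> (arccot x)"
proof -
  have "Complex (- x) 1 = of_real (sqrt (1 + x\<^sup>2)) * exp (\<i> * of_real (pi - arccot x))"
    using one_plus_sq_pos[of x]
    by (simp add: complex_eq_iff exp_eq_polar sin_arccot cos_arccot)
  moreover have "Im (Ln (of_real (sqrt (1 + x\<^sup>2)) * exp (\<i> * of_real (pi - arccot x)))) = pi - arccot x"
    using one_plus_sq_pos[of x] arccot_bounds[of x] by (subst Ln_times_of_real) auto
  ultimately have ic: "Im (Ln (Complex (- x) 1)) = pi - arccot x" by simp
  have "weight \<eta> (Complex (- x) 1) = circle_weight \<eta> (arccot x)"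
  proof -
    have "\<i> * complex_of_real (\<eta> * (pi - arccot x) / 2) = \<i> * of_real (\<eta> * pi / 2) + \<i> * of_real (- \<eta> / 2 * arccot x)"
      by (simp add: field_simps)
    then show ?thesis
      unfolding weight_def circle_weight_def ic by (simp only: exp_add)
  qed
  then show ?thesis by (simp add: w0_upper weight_vector_def sin_pow_def)
qed

text \<open>The first factor removes the phase of the integrand at x = 0, so that near 0 the real
  part is positive.\<close>

lemma Re_circle_weight:
  assumes "\<eta> = 1 \<or> \<eta> = - 1"
  shows "Re (exp (- (\<i> * of_real (\<eta> * pi / 4))) * (inverse (psi a x) * circle_weight \<eta> (arccot x))) = cos (\<eta> * arctan x / 2 - a * x)"
proof -
  have "exp (- (\<i> * of_real (\<eta> * pi / 4))) * (inverse (psi a x) * circle_weight \<eta> (arccot x)) = exp (\<i> * of_real (\<eta> * arctan x / 2 - a * x))"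
    unfolding inverse_psi circle_weight_def exp_add[symmetric] arccot_def
    by (rule arg_cong[of _ _ exp]) (simp add: field_simps)
  then show ?thesis by (simp add: exp_eq_polar)
qed

text \<open>For large real s the integrand concentrates near 0, where its phase is almost constant.\<close>

lemma whittaker_entire_circle_weight_nonzero:
  assumes \<eta>: "\<eta> = 1 \<or> \<eta> = - 1" and a: "a \<noteq> 0"
  shows "\<exists>s. whittaker_entire a s (circle_weight \<eta>) \<noteq> 0"
proof (rule ccontr)
  assume "\<not> ?thesis"
  then have zero: "whittaker_entire a s (circle_weight \<eta>) = 0" for s by blast
  define q where "q x = cos (\<eta> * arctan x / 2 - a * x)" for x
  \<comment> \<open>For \<bar>x\<bar> < \<delta> the character contributes at most pi / 8 to the
    phase and the half arctangent at most pi / 4, so the phase stays within 3 pi / 8, below pi /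
    2.\<close>
  define \<delta> where "\<delta> = pi / (8 * \<bar>a\<bar>)"
  have \<delta>: "\<delta> > 0" using a by (simp add: \<delta>_def)
  have cq: "continuous_on A q" for A unfolding q_def by (intro continuous_intros) auto
  have qm: "q \<in> borel_measurable borel" using cq by (rule borel_measurable_continuous_onI)
  have qb: "\<bar>q x\<bar> \<le> 1" for x by (simp add: q_def)
  define c where "c = cos (3 * pi / 8)"
  have c: "c > 0" unfolding c_def by (intro cos_gt_zero) auto
  have qc: "q x \<ge> c" if "\<bar>x\<bar> < \<delta>" for x
  proof -
    have "\<bar>a * x\<bar> \<le> pi / 8"
    proof -
      have "\<bar>a\<bar> * \<bar>x\<bar> \<le> \<bar>a\<bar> * \<delta>" using that by (intro mult_left_mono) auto
      also have "\<dots> = pi / 8" using a by (simp add: \<delta>_def)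
      finally show ?thesis by (simp add: abs_mult)
    qed
    moreover have "\<bar>\<eta> * arctan x / 2\<bar> \<le> pi / 4"
      using \<eta> arctan_bounded[of x] by (auto simp: abs_le_iff)
    ultimately have "\<bar>\<eta> * arctan x / 2 - a * x\<bar> \<le> 3 * pi / 8" by linarith
    then have "cos (3 * pi / 8) \<le> cos \<bar>\<eta> * arctan x / 2 - a * x\<bar>"
      by (intro cos_monotone_0_pi_le) auto
    then show ?thesis by (simp add: q_def c_def)
  qed
  \<comment> \<open>The powers are normalised at \<delta>: the quotient is at least 1 inside the
    interval and below 1 outside. The inner part of the integral stays above a positive constant
    while the outer part tends to 0, so the total cannot vanish for all \<open>n\<close>.\<close>
  define F where "F n x = ((1 + \<delta>\<^sup>2) / (1 + x\<^sup>2)) ^ n * (inverse (1 + x\<^sup>2) * q x)" for n :: nat and x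
  have i1: "integrable lborel (\<lambda>x::real. inverse (1 + x\<^sup>2))"
  proof -
    have "(1 + x\<^sup>2) powr (- 2 / 2) = inverse (1 + x\<^sup>2)" for x :: real
      using one_plus_sq_pos[of x] by (simp add: powr_minus)
    then show ?thesis using integrable_one_plus_sq_powr[of 2] by simp
  qed
  have Fm: "F n \<in> borel_measurable lborel" for n unfolding F_def using qm by measurable
  have Fb: "\<bar>F n x\<bar> \<le> (1 + \<delta>\<^sup>2) ^ n * inverse (1 + x\<^sup>2)" for n x
  proof -
    have "(1 + \<delta>\<^sup>2) / (1 + x\<^sup>2) \<le> (1 + \<delta>\<^sup>2) / 1"
      using one_plus_sq_pos[of \<delta>] one_plus_sq_pos[of x] by (intro divide_left_mono) auto
    then have "((1 + \<delta>\<^sup>2) / (1 + x\<^sup>2)) ^ n \<le> (1 + \<delta>\<^sup>2) ^ n" by (intro power_mono) auto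
    moreover have "inverse (1 + x\<^sup>2) * \<bar>q x\<bar> \<le> inverse (1 + x\<^sup>2) * 1" using qb by (intro mult_left_mono) auto
    ultimately have "((1 + \<delta>\<^sup>2) / (1 + x\<^sup>2)) ^ n * (inverse (1 + x\<^sup>2) * \<bar>q x\<bar>) \<le> (1 + \<delta>\<^sup>2) ^ n * (inverse (1 + x\<^sup>2) * 1)"
      using qb[of x] by (intro mult_mono) auto
    then show ?thesis by (simp add: F_def abs_mult power_abs)
  qed
  have Fi: "integrable lborel (F n)" for n
    by (rule Bochner_Integration.integrable_bound[OF integrable_mult_right[OF i1, of "(1 + \<delta>\<^sup>2) ^ n"] Fm])
       (use Fb in \<open>auto intro!: AE_I2 intro: order_trans[OF _ abs_ge_self]\<close>)
  have F0: "(LINT x|lborel. F n x) = 0" for n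
  proof -
    \<comment> \<open>An odd parameter makes the exponent of \<open>sin_pow\<close> the even number
      \<open>2 * real (Suc n)\<close>, hence an integral power of
      \<open>inverse (1 + x\<^sup>2)\<close>.\<close>
    let ?s = "of_real (2 * real n + 1) :: complex"
    let ?g = "\<lambda>x. sin_pow (?s + 1) x * (inverse (psi a x) * circle_weight \<eta> (arccot x))"
    have s: "Re ?s > 0" by simp
    have "(LINT x|lborel. ?g x) = 0"
      using zero[of ?s] unfolding whittaker_entire_pos[OF s a family_circle_weight] whittaker_integral_def .
    moreover have gi: "integrable lborel ?g"
    proof -
      obtain B where "\<And>t. norm (circle_weight \<eta> t) \<le> B" using family_const_bound[OF family_circle_weight] by blast
      then show ?thesis
        using continuous_arccot_compose[OF family_const_continuous[OF family_circle_weight], of \<eta> 0]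
        by (intro integrable_sin_pow_mult[of _ _ B]) (auto simp: norm_mult intro!: continuous_intros continuous_on_inverse_psi)
    qed
    ultimately have "(LINT x|lborel. of_real ((1 + \<delta>\<^sup>2) ^ n) * exp (- (\<i> * of_real (\<eta> * pi / 4))) * ?g x) = 0" by simp
    moreover have "(LINT x|lborel. Re (of_real ((1 + \<delta>\<^sup>2) ^ n) * exp (- (\<i> * of_real (\<eta> * pi / 4))) * ?g x)) =
       Re (LINT x|lborel. of_real ((1 + \<delta>\<^sup>2) ^ n) * exp (- (\<i> * of_real (\<eta> * pi / 4))) * ?g x)"
      by (rule integral_Re) (use gi in auto)
    moreover have "Re (of_real ((1 + \<delta>\<^sup>2) ^ n) * exp (- (\<i> * of_real (\<eta> * pi / 4))) * ?g x) = F n x" for x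
    proof -
      have R: "Re (complex_of_real r * w) = r * Re w" for r w by simp
      have "?s + 1 = of_real (2 * real (Suc n))" by simp
      then have "sin_pow (?s + 1) x = of_real ((1 + x\<^sup>2) powr (- (2 * real (Suc n)) / 2))" by (simp only: sin_pow_of_real)
      also have "(1 + x\<^sup>2) powr (- (2 * real (Suc n)) / 2) = inverse ((1 + x\<^sup>2) ^ Suc n)"
        using one_plus_sq_pos[of x] powr_realpow[of "1 + x\<^sup>2" "Suc n"] by (simp add: powr_minus del: of_nat_Suc power_Suc)
      finally have "of_real ((1 + \<delta>\<^sup>2) ^ n) * exp (- (\<i> * of_real (\<eta> * pi / 4))) * ?g x =
        of_real ((1 + \<delta>\<^sup>2) ^ n * inverse ((1 + x\<^sup>2) ^ Suc n)) * (exp (- (\<i> * of_real (\<eta> * pi / 4))) * (inverse (psi a x) * circle_weight \<eta> (arccot x)))"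
        by (simp only: of_real_mult mult_ac)
      then have "Re (of_real ((1 + \<delta>\<^sup>2) ^ n) * exp (- (\<i> * of_real (\<eta> * pi / 4))) * ?g x) = (1 + \<delta>\<^sup>2) ^ n * inverse ((1 + x\<^sup>2) ^ Suc n) * q x"
        by (simp only: R Re_circle_weight[OF \<eta>] q_def)
      also have "\<dots> = F n x" by (simp add: F_def power_divide field_simps)
      finally show ?thesis .
    qed
    ultimately show ?thesis by (simp only: zero_complex.sel)
  qed
  define K where "K = {-\<delta><..<\<delta>}"
  define m where "m = c * inverse (1 + \<delta>\<^sup>2)"
  have m: "m > 0" using c one_plus_sq_pos[of \<delta>] by (simp add: m_def)
  have inner: "(LINT x|lborel. indicator K x *\<^sub>R F n x) \<ge> m * (2 * \<delta>)" for n
  proof -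
    have "(LINT x|lborel. indicator K x *\<^sub>R m) \<le> (LINT x|lborel. indicator K x *\<^sub>R F n x)"
    proof (rule integral_mono)
      show "integrable lborel (\<lambda>x. indicator K x *\<^sub>R m)"
        unfolding K_def using \<delta> by (auto intro!: integrable_mult_left integrable_real_indicator)
      show "integrable lborel (\<lambda>x. indicator K x *\<^sub>R F n x)"
        using Fi by (intro integrable_mult_indicator) (auto simp: K_def)
      fix x
      show "indicator K x *\<^sub>R m \<le> indicator K x *\<^sub>R F n x"
      proof (cases "x \<in> K")
        case True
        then have x: "\<bar>x\<bar> < \<delta>" by (auto simp: K_def)
        then have "x\<^sup>2 \<le> \<delta>\<^sup>2" using abs_le_square_iff[of x \<delta>] \<delta> by simp
        then have "1 \<le> (1 + \<delta>\<^sup>2) / (1 + x\<^sup>2)" "inverse (1 + \<delta>\<^sup>2) \<le> inverse (1 + x\<^sup>2)"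
          using one_plus_sq_pos[of x] by (auto simp: le_imp_inverse_le)
        then have "1 * (inverse (1 + \<delta>\<^sup>2) * c) \<le> F n x"
          unfolding F_def using qc[OF x] c by (intro mult_mono one_le_power) auto
        then show ?thesis using True by (simp add: m_def mult.commute)
      qed simp
    qed
    also have "(LINT x|lborel. indicator K x *\<^sub>R m) = m * (2 * \<delta>)"
      using \<delta> by (simp add: K_def mult.commute)
    finally show ?thesis .
  qed
  have outer: "(\<lambda>n. LINT x|lborel. indicator (- K) x *\<^sub>R F n x) \<longlonglongrightarrow> (LINT x::real|lborel. (0::real))"
  proof (rule integral_dominated_convergence[where w = "\<lambda>x. inverse (1 + x\<^sup>2)"])
    show "AE x in lborel. (\<lambda>n. indicator (- K) x *\<^sub>R F n x) \<longlonglongrightarrow> 0"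
      using AE_lborel_singleton[of \<delta>] AE_lborel_singleton[of "- \<delta>"]
    proof eventually_elim
      case (elim x)
      show ?case
      proof (cases "x \<in> K")
        case False
        then have "\<delta> < \<bar>x\<bar>" using elim by (auto simp: K_def)
        then have "\<delta>\<^sup>2 < x\<^sup>2" using abs_le_square_iff[of x \<delta>] \<delta> by (simp add: not_le[symmetric])
        then have "(\<lambda>n. ((1 + \<delta>\<^sup>2) / (1 + x\<^sup>2)) ^ n) \<longlonglongrightarrow> 0"
          using one_plus_sq_pos[of x] by (intro LIMSEQ_power_zero) (auto simp: abs_of_nonneg add_nonneg_nonneg divide_less_eq)
        then have "(\<lambda>n. ((1 + \<delta>\<^sup>2) / (1 + x\<^sup>2)) ^ n * (inverse (1 + x\<^sup>2) * q x)) \<longlonglongrightarrow> 0"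
          by (rule tendsto_mult_left_zero)
        then show ?thesis using False by (simp add: F_def)
      qed simp
    qed
    show "AE x in lborel. norm (indicator (- K) x *\<^sub>R F n x) \<le> inverse (1 + x\<^sup>2)" for n
    proof (rule AE_I2)
      fix x
      show "norm (indicator (- K) x *\<^sub>R F n x) \<le> inverse (1 + x\<^sup>2)"
      proof (cases "x \<in> K")
        case False
        then have "\<delta> \<le> \<bar>x\<bar>" by (auto simp: K_def)
        then have "\<delta>\<^sup>2 \<le> x\<^sup>2" using abs_le_square_iff[of \<delta> x] \<delta> by simp
        then have "((1 + \<delta>\<^sup>2) / (1 + x\<^sup>2)) ^ n \<le> 1"
          using one_plus_sq_pos[of x] by (intro power_le_one) (auto simp: add_nonneg_nonneg)
        then have "((1 + \<delta>\<^sup>2) / (1 + x\<^sup>2)) ^ n * (inverse (1 + x\<^sup>2) * \<bar>q x\<bar>) \<le> 1 * (inverse (1 + x\<^sup>2) * 1)"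
          using qb[of x] by (intro mult_mono) auto
        then show ?thesis using False by (simp add: F_def abs_mult power_abs)
      qed simp
    qed
    show "(\<lambda>x. indicator (- K) x *\<^sub>R F n x) \<in> borel_measurable lborel" for n
      using Fm[of n] by (auto simp: K_def)
  qed (use i1 in auto)
  have "(LINT x|lborel. indicator (- K) x *\<^sub>R F n x) \<le> - (m * (2 * \<delta>))" for n
  proof -
    have "(LINT x|lborel. F n x) = (LINT x|lborel. indicator K x *\<^sub>R F n x + indicator (- K) x *\<^sub>R F n x)"
      by (intro Bochner_Integration.integral_cong) (auto simp: indicator_def)
    also have "\<dots> = (LINT x|lborel. indicator K x *\<^sub>R F n x) + (LINT x|lborel. indicator (- K) x *\<^sub>R F n x)"
      using Fi[of n] by (intro Bochner_Integration.integral_add integrable_mult_indicator) (auto simp: K_def)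
    finally show ?thesis using F0[of n] inner[of n] by linarith
  qed
  then have "(LINT x::real|lborel. (0::real)) \<le> - (m * (2 * \<delta>))"
    by (intro LIMSEQ_le_const2[OF outer]) auto
  moreover have "m * (2 * \<delta>) > 0" using m \<delta> by simp
  ultimately show False by simp
qed

section \<open>Evaluation of the kernel factor\<close>

lemma triv_char_ne_sign_char: "sign_char \<noteq> triv_char"
proof
  assume "sign_char = triv_char"
  then have "sign_char (- 1) = triv_char (- 1)" by simp
  then show False by (simp add: sign_char_def triv_char_def)
qed

text \<open>The logarithms of the two bases differ only in the sign of their imaginary part, which
  has modulus pi / 2. Writing \<open>\<i> * of_real \<eta>\<close> as exp (2 E) and pulling out exp
  E turns the sum of the two exponentials into a cosine.\<close>

lemma kernel_factor_eq:
  assumes a: "a \<noteq> 0" and \<eta>: "\<eta> = 1 \<or> \<eta> = - 1"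
  shows "kernel_factor s (\<i> * of_real \<eta>) a =
    of_real \<bar>a\<bar> powr (- s) * (2 * exp (\<i> * of_real (\<eta> * pi / 4)) * cos (of_real pi * s / 2 - of_real (\<eta> * sgn a * pi / 4)))"
proof -
  define \<sigma> where "\<sigma> = sgn a"
  have \<sigma>: "\<sigma> = 1 \<or> \<sigma> = - 1" using a by (auto simp: \<sigma>_def sgn_if)
  have pw: "(- \<i> * of_real b) powr (- s) = of_real \<bar>a\<bar> powr (- s) * exp (\<i> * of_real (sgn b) * (of_real pi * s / 2))" if b: "\<bar>b\<bar> = \<bar>a\<bar>" for b
  proof -
    have b0: "b \<noteq> 0" using b a by auto
    have "Ln (- \<i> * of_real b) = of_real (ln \<bar>a\<bar>) - \<i> * of_real (sgn b) * of_real pi / 2"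
    proof (cases "b > 0")
      case True
      then have "Ln (of_real b * (- \<i>)) = of_real (ln b) + Ln (- \<i>)" by (subst Ln_times_of_real) (auto simp: Ln_of_real)
      then show ?thesis using True b by (simp add: mult.commute)
    next
      case False
      then have "Ln (of_real (- b) * \<i>) = of_real (ln (- b)) + Ln \<i>" using b0 by (subst Ln_times_of_real) (use Ln_of_real[of "- b"] in auto)
      then show ?thesis using False b b0 by (simp add: mult.commute)
    qed
    moreover have "(- \<i> * of_real b) powr (- s) = exp (- s * Ln (- \<i> * of_real b))"
      using b0 by (simp add: powr_def)
    moreover have "of_real \<bar>a\<bar> powr (- s) = exp (of_real (ln \<bar>a\<bar>) * - s)"
      using of_real_exp_powr[of "ln \<bar>a\<bar>" "- s"] a by simp
    moreover have "- s * (of_real (ln \<bar>a\<bar>) - \<i> * of_real (sgn b) * of_real pi / 2) =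
      of_real (ln \<bar>a\<bar>) * - s + \<i> * of_real (sgn b) * (of_real pi * s / 2)"
      by (simp add: field_simps)
    ultimately show ?thesis by (simp only: exp_add)
  qed
  define E where "E = \<i> * of_real (\<eta> * pi / 4)"
  define T where "T = \<i> * of_real \<sigma> * (of_real pi * s / 2)"
  have q: "\<i> * of_real \<eta> = exp (E + E)"
    using exp_quarter[OF \<eta>] by (simp add: E_def field_simps)
  have "exp T + exp (E + E) * exp (- T) = exp E * (exp (T - E) + exp (- (T - E)))"
    by (simp add: exp_add[symmetric] distrib_left)
  also have "exp (T - E) + exp (- (T - E)) = 2 * cos (of_real pi * s / 2 - of_real (\<eta> * \<sigma> * pi / 4))"
  proof -
    define w where "w = of_real pi * s / 2 - of_real (\<eta> * \<sigma> * pi / 4)"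
    have "T - E = \<i> * of_real \<sigma> * w"
      using \<sigma> by (auto simp: T_def E_def w_def algebra_simps)
    then have "exp (T - E) + exp (- (T - E)) = exp (\<i> * w) + exp (- (\<i> * w))" using \<sigma> by auto
    then show ?thesis by (simp add: cos_exp_eq w_def)
  qed
  finally have "exp T + exp (E + E) * exp (- T) = exp E * (2 * cos (of_real pi * s / 2 - of_real (\<eta> * \<sigma> * pi / 4)))" .
  moreover have "kernel_factor s (\<i> * of_real \<eta>) a = of_real \<bar>a\<bar> powr (- s) * (exp T + exp (E + E) * exp (- T))"
    unfolding kernel_factor_def q pw[OF refl] using pw[of "- a"]
    by (simp add: T_def \<sigma>_def sgn_minus algebra_simps)
  ultimately show ?thesis by (simp add: E_def \<sigma>_def mult_ac)
qed


section \<open>The local coefficient\<close>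

text \<open>Excluding half-integral \<open>s\<close> keeps the arguments of the Gamma functions in
  the formula away from the poles.\<close>

lemma half_shift_not_Int:
  fixes s :: complex
  assumes "2 * s \<notin> \<int>"
  shows "s / 2 + of_int k / 4 \<notin> \<int>" "of_int k / 4 - s / 2 \<notin> \<int>" "s \<notin> \<int>"
proof -
  show "s / 2 + of_int k / 4 \<notin> \<int>"
  proof
    assume "s / 2 + of_int k / 4 \<in> \<int>"
    then obtain n :: int where "s / 2 + of_int k / 4 = of_int n" by (elim Ints_cases)
    then have "2 * s = of_int (4 * n - k)" by (simp add: field_simps)
    then show False using assms Ints_of_int by metis
  qed
  show "of_int k / 4 - s / 2 \<notin> \<int>"
  proof
    assume "of_int k / 4 - s / 2 \<in> \<int>"
    then obtain n :: int where n: "of_int k / 4 - s / 2 = of_int n" by (elim Ints_cases)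
    have "2 * s = 4 * (of_int k / 4 - (of_int k / 4 - s / 2))" by simp
    also have "\<dots> = of_int (k - 4 * n)" unfolding n by simp
    finally show False using assms Ints_of_int by metis
  qed
  show "s \<notin> \<int>" using assms by auto
qed

text \<open>Duplication writes Gamma (1/2 - s) as the product of Gamma (p - s/2) and Gamma (p' -
  s/2). The first cancels the denominator L(chi, 1/2 - s); since p + p' = 1, the second meets Gamma
  (s/2 + p) in the reflection formula, which gives the cosine.\<close>

lemma L_factor_quotient:
  assumes d: "(chi = triv_char \<and> d = 1) \<or> (chi = sign_char \<and> d = - 1)" and s: "2 * s \<notin> \<int>"
  shows "2 powr (s - 1 / 2) / of_real pi powr s * (L_factor chi (s + 1 / 2) / L_factor chi (- s + 1 / 2)) *
    (L_factor triv_char (- 2 * s + 1) / L_factor triv_char (2 * s)) =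
    rGamma s / (2 * cos (of_real pi * s / 2 - of_real (d * pi / 4)))"
proof -
  define P Q :: complex where "P = of_real (ln pi)" and "Q = of_real (ln 2)"
  \<comment> \<open>The L-factors of \<open>chi\<close> at s + 1/2 and 1/2 - s have their Gamma
    functions at s/2 + p and p - s/2; the parity of \<open>chi\<close> moves p from 1/4 to
    3/4.\<close>
  define p :: complex where "p = (if d = 1 then 1 / 4 else 3 / 4)"
  define p' :: complex where "p' = (if d = 1 then 3 / 4 else 1 / 4)"
  have pipow: "of_real pi powr z = exp (P * z)" for z
    using of_real_exp_powr[of "ln pi" z] by (simp add: P_def)
  have twopow: "(2 :: complex) powr z = exp (Q * z)" for z
    using of_real_exp_powr[of "ln 2" z] by (simp add: Q_def)
  have L1: "L_factor chi (s + 1 / 2) = exp (P * (- (s / 2 + p))) * Gamma (s / 2 + p)"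
    and L2: "L_factor chi (- s + 1 / 2) = exp (P * (- (p - s / 2))) * Gamma (p - s / 2)"
    and L3: "L_factor triv_char (- 2 * s + 1) = exp (P * (s - 1 / 2)) * Gamma (1 / 2 - s)"
    and L4: "L_factor triv_char (2 * s) = exp (P * (- s)) * Gamma s"
  proof -
    have a1: "- (s + 1 / 2) / 2 = - (s / 2 + 1 / 4)" "(s + 1 / 2) / 2 = s / 2 + 1 / 4"
      "- (s + 1 / 2 + 1) / 2 = - (s / 2 + 3 / 4)" "(s + 1 / 2 + 1) / 2 = s / 2 + 3 / 4"
      "- (- s + 1 / 2) / 2 = - (1 / 4 - s / 2)" "(- s + 1 / 2) / 2 = 1 / 4 - s / 2"
      "- (- s + 1 / 2 + 1) / 2 = - (3 / 4 - s / 2)" "(- s + 1 / 2 + 1) / 2 = 3 / 4 - s / 2"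
      "- (- 2 * s + 1) / 2 = s - 1 / 2" "(- 2 * s + 1) / 2 = 1 / 2 - s" "- (2 * s) / 2 = - s" "2 * s / 2 = s"
      by (simp_all add: field_simps)
    show "L_factor chi (s + 1 / 2) = exp (P * (- (s / 2 + p))) * Gamma (s / 2 + p)"
      "L_factor chi (- s + 1 / 2) = exp (P * (- (p - s / 2))) * Gamma (p - s / 2)"
      using d triv_char_ne_sign_char unfolding L_factor_def pipow a1 p_def by auto
    show "L_factor triv_char (- 2 * s + 1) = exp (P * (s - 1 / 2)) * Gamma (1 / 2 - s)"
      "L_factor triv_char (2 * s) = exp (P * (- s)) * Gamma s"
      unfolding L_factor_def pipow a1 by simp_all
  qed
  have ni: "Gamma z \<noteq> 0" if "z \<notin> \<int>" for z :: complex
    using that nonpos_Ints_Int by (auto simp: Gamma_eq_zero_iff)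
  note nI = half_shift_not_Int[OF s]
  have i1: "1 / 4 - s / 2 \<notin> \<int>" "3 / 4 - s / 2 \<notin> \<int>" using nI(2)[of 1] nI(2)[of 3] by simp_all
  have G2: "Gamma (p - s / 2) \<noteq> 0" using ni i1 by (auto simp: p_def)
  have G4: "Gamma s \<noteq> 0" using ni nI(3) by blast
  have pp: "p - s / 2 = 1 / 4 - s / 2 \<and> p' - s / 2 = 3 / 4 - s / 2 \<or> p - s / 2 = 3 / 4 - s / 2 \<and> p' - s / 2 = 1 / 4 - s / 2"
    by (auto simp: p_def p'_def)
  have dup: "Gamma (p - s / 2) * Gamma (p' - s / 2) = exp (Q * (1 / 2 + s)) * exp (P / 2) * Gamma (1 / 2 - s)"
  proof -
    have "1 / 4 - s / 2 \<notin> \<int>\<^sub>\<le>\<^sub>0" "1 / 4 - s / 2 + 1 / 2 \<notin> \<int>\<^sub>\<le>\<^sub>0"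
      using i1 nonpos_Ints_Int by (auto simp: algebra_simps)
    note D = Gamma_legendre_duplication[OF this]
    have e: "1 / 4 - s / 2 + 1 / 2 = 3 / 4 - s / 2" "2 * (1 / 4 - s / 2) = 1 / 2 - s" "1 - 2 * (1 / 4 - s / 2) = 1 / 2 + s"
      by (simp_all add: field_simps)
    have sq: "complex_of_real (sqrt pi) = exp (P / 2)"
    proof -
      have "sqrt pi = exp (ln pi / 2)" using powr_half_sqrt[of pi] by (simp add: powr_def)
      then show ?thesis by (simp add: P_def flip: exp_of_real)
    qed
    have "Gamma (1 / 4 - s / 2) * Gamma (3 / 4 - s / 2) = exp (Q * (1 / 2 + s)) * exp (P / 2) * Gamma (1 / 2 - s)"
      using D unfolding e sq Q_def by (simp add: mult.commute)
    with pp show ?thesis by (elim disjE conjE) (simp_all only: mult_ac)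
  qed
  have G3: "Gamma (1 / 2 - s) = Gamma (p - s / 2) * Gamma (p' - s / 2) * exp (- (Q * (1 / 2 + s)) - P / 2)"
  proof -
    have "exp A * exp B * exp (- A - B) = 1" for A B :: complex
      by (simp add: exp_diff exp_minus)
    then have "(exp (Q * (1 / 2 + s)) * exp (P / 2) * exp (- (Q * (1 / 2 + s)) - P / 2)) * Gamma (1 / 2 - s) = Gamma (1 / 2 - s)"
      by (simp only: mult_1)
    then show ?thesis unfolding dup by (simp only: mult_ac)
  qed
  have refl: "Gamma (s / 2 + p) * Gamma (p' - s / 2) = exp P / cos (of_real pi * s / 2 - of_real (d * pi / 4))"
  proof -
    have "1 - (s / 2 + p) = p' - s / 2" by (simp add: p_def p'_def)
    moreover have "sin (of_real pi * (s / 2 + p)) = cos (of_real pi * s / 2 - of_real (d * pi / 4))"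
    proof -
      have "sin (of_real pi * (s / 2 + p)) = cos (of_real pi / 2 - of_real pi * (s / 2 + p))" by (rule sin_cos_eq)
      also have "of_real pi / 2 - of_real pi * (s / 2 + p) = - (of_real pi * s / 2 - of_real (d * pi / 4))"
        using d by (auto simp: p_def field_simps)
      finally show ?thesis by (simp only: cos_minus)
    qed
    moreover have "exp P = of_real pi" by (simp add: P_def exp_of_real)
    ultimately show ?thesis using Gamma_reflection_complex[of "s / 2 + p"] by (simp only:)
  qed
  have "2 powr (s - 1 / 2) / of_real pi powr s * (L_factor chi (s + 1 / 2) / L_factor chi (- s + 1 / 2)) *
    (L_factor triv_char (- 2 * s + 1) / L_factor triv_char (2 * s))
    = (exp (Q * (s - 1 / 2)) / exp (P * s) * (exp (P * (- (s / 2 + p))) / exp (P * (- (p - s / 2)))) * (exp (P * (s - 1 / 2)) / exp (P * (- s)))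
       * exp (- (Q * (1 / 2 + s)) - P / 2)) * ((Gamma (s / 2 + p) * Gamma (p' - s / 2)) * (Gamma (p - s / 2) / Gamma (p - s / 2)) / Gamma s)"
    unfolding twopow pipow L1 L2 L3 L4 G3 by (simp add: field_simps)
  \<comment> \<open>All powers of 2 and pi that involve \<open>s\<close> cancel and 1 / (2 pi)
    remains; its pi cancels against the one in the reflection formula.\<close>
  also have "exp (Q * (s - 1 / 2)) / exp (P * s) * (exp (P * (- (s / 2 + p))) / exp (P * (- (p - s / 2)))) * (exp (P * (s - 1 / 2)) / exp (P * (- s)))
       * exp (- (Q * (1 / 2 + s)) - P / 2) = exp (- Q - P)"
    unfolding exp_diff[symmetric] exp_add[symmetric] by (rule arg_cong[of _ _ exp]) (simp add: field_simps)
  also have "exp (- Q - P) = 1 / (2 * exp P)"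
  proof -
    have "exp Q = 2" by (simp add: Q_def exp_of_real)
    then show ?thesis by (simp add: exp_diff exp_minus field_simps)
  qed
  finally show ?thesis unfolding refl using G2 by (simp add: rGamma_inverse_Gamma field_simps)
qed

lemma eventually_cosparse_nonzero:
  assumes "f holomorphic_on UNIV" "f z0 \<noteq> 0"
  shows "\<forall>\<^sub>\<approx>z. f z \<noteq> 0"
proof -
  have "f analytic_on UNIV" using assms(1) analytic_on_open[OF open_UNIV] by blast
  then have "f nicely_meromorphic_on UNIV" by (rule analytic_on_imp_nicely_meromorphic_on)
  then have "(\<forall>z\<in>UNIV. f z = 0) \<or> (\<forall>\<^sub>\<approx>z. f z \<noteq> 0)"
    by (rule nicely_meromorphic_imp_constant_or_avoid) auto
  then show ?thesis using assms(2) by blast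
qed

lemma eventually_cosparse_double_not_Int: "\<forall>\<^sub>\<approx>s::complex. 2 * s \<notin> \<int>"
proof -
  have "\<forall>\<^sub>\<approx>s. sin (of_real pi * (2 * s)) \<noteq> (0::complex)"
  proof (rule eventually_cosparse_nonzero)
    show "(\<lambda>s. sin (of_real pi * (2 * s))) holomorphic_on UNIV" by (intro holomorphic_intros)
    have "complex_of_real pi * (2 * (1 / 4)) = of_real (pi / 2)" by simp
    then show "sin (of_real pi * (2 * (1 / 4 :: complex))) \<noteq> 0" by (simp only: sin_of_real sin_pi_half) simp
  qed
  then show ?thesis
  proof eventually_elim
    case (elim s)
    show ?case
    proof
      assume "2 * s \<in> \<int>"
      then obtain n :: int where "2 * s = of_int n" by (elim Ints_cases)
      then have "of_real pi * (2 * s) = of_real (of_int n * pi)" by (simp add: mult.commute)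
      then have "sin (of_real pi * (2 * s)) = of_real (sin (of_int n * pi))" by (simp only: sin_of_real)
      moreover have "sin (of_int n * pi) = 0" by (auto simp: sin_zero_iff_int2)
      ultimately show False using elim by simp
    qed
  qed
qed

text \<open>\<open>local_coeff\<close> is nicely meromorphic, whereas the closed formula also takes
  default values where single factors are singular; \<open>remove_sings\<close> turns an identity
  off the half-integers into one of functions on the whole plane.\<close>

theorem theorem8p2:
  fixes a :: real and chi :: "real \<Rightarrow> complex"
  assumes "a \<noteq> 0"
    and "chi = triv_char \<or> chi = sign_char"
  shows "local_coeff a chi = remove_sings (\<lambda>s.
    of_real \<bar>a\<bar> powr s *
    (exp (- (\<i> * of_real pi * chi (- 1) * of_real (sgn a) / 4)) * 2 powr (s - 1 / 2) / of_real pi powr s *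
     (L_factor chi (s + 1 / 2) / L_factor chi (- s + 1 / 2)) *
     (L_factor (\<lambda>t. chi t ^ 2) (- 2 * s + 1) / L_factor (\<lambda>t. chi t ^ 2) (2 * s))))"
    (is "_ = remove_sings ?X")
proof -
  note a = assms(1) and chi = assms(2)
  obtain d :: real where d: "(chi = triv_char \<and> d = 1) \<or> (chi = sign_char \<and> d = - 1)"
    using chi by auto
  have chi1: "chi (- 1) = of_real d" using d by (auto simp: triv_char_def sign_char_def)
  have chi2: "(\<lambda>t. chi t ^ 2) = triv_char"
    using d by (auto simp: fun_eq_iff triv_char_def sign_char_def sgn_if)
  \<comment> \<open>The sign that describes both the phase of the inducing function and the weight
    of the test vector.\<close>
  define \<eta> where "\<eta> = d * sgn a"
  have \<eta>: "\<eta> = 1 \<or> \<eta> = - 1" using a d by (auto simp: \<eta>_def sgn_if)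
  have phase: "cell_phase a chi = \<i> * of_real \<eta>" by (simp add: cell_phase_def chi1 \<eta>_def)
  define \<kappa> where "\<kappa> s = kernel_factor s (cell_phase a chi) a" for s
  have \<kappa>: "\<kappa> s = of_real \<bar>a\<bar> powr (- s) * (2 * exp (\<i> * of_real (\<eta> * pi / 4)) * cos (of_real pi * s / 2 - of_real (d * pi / 4)))" for s
  proof -
    \<comment> \<open>The sign of \<open>a\<close> enters \<open>\<eta>\<close> and
      \<open>kernel_factor_eq\<close> once each, so it drops out of the cosine and remains only in
      the constant in front.\<close>
    have "\<eta> * sgn a * pi / 4 = d * pi / 4" using a by (simp add: \<eta>_def sgn_if)
    then show ?thesis using kernel_factor_eq[OF a \<eta>, of s] by (simp only: \<kappa>_def phase)
  qed
  have \<kappa>0: "\<kappa> s \<noteq> 0" if s: "2 * s \<notin> \<int>" for s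
  proof
    assume "\<kappa> s = 0"
    then have "cos (of_real pi * s / 2 - of_real (d * pi / 4)) = 0" using a by (simp add: \<kappa>)
    then obtain n :: int where n: "of_real pi * s / 2 - of_real (d * pi / 4) = of_real (of_int n * pi) + of_real pi / 2"
      by (auto simp: cos_eq_0)
    have "of_real pi * (2 * s) = 4 * (of_real pi * s / 2 - of_real (d * pi / 4)) + of_real (d * pi)" by simp
    also have "\<dots> = of_real pi * of_int (4 * n + 2 + (if d = 1 then 1 else - 1))"
      unfolding n using d by (auto simp: algebra_simps)
    finally have "2 * s = of_int (4 * n + 2 + (if d = 1 then 1 else - 1))" by (simp del: of_int_add)
    then show False using s Ints_of_int by metis
  qed
  \<comment> \<open>The inverse of the factor \<open>Gamma s * \<kappa> s\<close> from
    \<open>whittaker_intertwining\<close>; with \<open>rGamma\<close> both numerator and denominator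
    are entire.\<close>
  define Y where "Y s = rGamma s / \<kappa> s" for s
  have "\<kappa> holomorphic_on UNIV" unfolding \<kappa>_def[abs_def] by (rule holomorphic_kernel_factor[OF a])
  then have "\<kappa> analytic_on UNIV" using analytic_on_open[OF open_UNIV] by blast
  then have Ym: "Y meromorphic_on UNIV"
    unfolding Y_def[abs_def] by (intro meromorphic_intros analytic_on_imp_meromorphic_on analytic_rGamma)
  have XY: "?X s = Y s" if s: "2 * s \<notin> \<int>" for s
  proof -
    have "?X s = of_real \<bar>a\<bar> powr s * (exp (- (\<i> * of_real (\<eta> * pi / 4))) * (rGamma s / (2 * cos (of_real pi * s / 2 - of_real (d * pi / 4)))))"
      unfolding chi2 L_factor_quotient[OF d s, symmetric] chi1 \<eta>_def by (simp add: mult_ac)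
    also have "\<dots> = Y s"
      using a by (simp add: Y_def \<kappa> powr_minus exp_minus field_simps)
    finally show ?thesis .
  qed
  have rs: "remove_sings ?X = remove_sings Y"
  proof
    fix z
    have "eventually (\<lambda>s. ?X s = Y s) (at z)"
      using eventually_cosparse_imp_eventually_at[OF eventually_cosparse_double_not_Int UNIV_I]
      by eventually_elim (rule XY)
    then show "remove_sings ?X z = remove_sings Y z" by (rule remove_sings_cong) simp
  qed
  have Yn: "remove_sings Y nicely_meromorphic_on UNIV" by (rule remove_sings_nicely_meromorphic[OF Ym])
  have Ye: "\<forall>\<^sub>\<approx>s. remove_sings Y s = Y s" by (rule eventually_remove_sings_eq[OF Ym])
  have fe: "whittaker a (- s) (intertwining s f) = Gamma s * \<kappa> s * whittaker a s f \<and> Y s * (Gamma s * \<kappa> s) = 1"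
    if s: "2 * s \<notin> \<int>" and f: "f \<in> principal_series a chi s" for s f
  proof -
    have ns: "s \<notin> \<int>\<^sub>\<le>\<^sub>0" using half_shift_not_Int(3)[OF s] nonpos_Ints_Int by blast
    then have "rGamma s * Gamma s = 1" by (simp add: rGamma_inverse_Gamma Gamma_eq_zero_iff)
    then show ?thesis
      using whittaker_intertwining[OF f a chi ns] \<kappa>0[OF s] by (simp add: Y_def \<kappa>_def field_simps)
  qed
  have "local_coeff a chi = remove_sings Y"
    unfolding local_coeff_def
  proof (rule the_equality)
    show "remove_sings Y nicely_meromorphic_on UNIV \<and>
      (\<forall>\<^sub>\<approx>s. \<forall>f\<in>principal_series a chi s. whittaker a s f = remove_sings Y s * whittaker a (- s) (intertwining s f))"
    proof (intro conjI Yn)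
      show "\<forall>\<^sub>\<approx>s. \<forall>f\<in>principal_series a chi s. whittaker a s f = remove_sings Y s * whittaker a (- s) (intertwining s f)"
        using Ye eventually_cosparse_double_not_Int
      proof eventually_elim
        case (elim s)
        show ?case
        proof
          fix f assume "f \<in> principal_series a chi s"
          from fe[OF elim(2) this] show "whittaker a s f = remove_sings Y s * whittaker a (- s) (intertwining s f)"
            unfolding elim(1) by (simp add: mult.assoc[symmetric])
        qed
      qed
    qed
  next
    fix C assume C: "C nicely_meromorphic_on UNIV \<and>
      (\<forall>\<^sub>\<approx>s. \<forall>f\<in>principal_series a chi s. whittaker a s f = C s * whittaker a (- s) (intertwining s f))"
    let ?f = "weight_vector \<eta>"
    have fW: "whittaker a s (?f s) = whittaker_entire a s (circle_weight \<eta>)" for s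
      using whittaker_eq[of "?f s" 1 s "circle_weight \<eta>" a] weight_vector_cell family_circle_weight a by simp
    obtain s1 where "whittaker_entire a s1 (circle_weight \<eta>) \<noteq> 0"
      using whittaker_entire_circle_weight_nonzero[OF \<eta> a] by blast
    \<comment> \<open>An entire function that is nonzero somewhere vanishes at most on a discrete
      closed set, so the test vector can be cancelled for all remaining \<open>s\<close>.\<close>
    then have W: "\<forall>\<^sub>\<approx>s. whittaker_entire a s (circle_weight \<eta>) \<noteq> 0"
      by (rule eventually_cosparse_nonzero[OF holomorphic_whittaker_entire[OF family_circle_weight a]])
    from C have "\<forall>\<^sub>\<approx>s. \<forall>f\<in>principal_series a chi s. whittaker a s f = C s * whittaker a (- s) (intertwining s f)" by blast
    with W eventually_cosparse_double_not_Int Ye have "\<forall>\<^sub>\<approx>s. C s = remove_sings Y s"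
    proof eventually_elim
      case (elim s)
      have f: "?f s \<in> principal_series a chi s" by (rule weight_vector_principal_series[OF a chi \<eta> phase])
      then have "whittaker a s (?f s) = C s * whittaker a (- s) (intertwining s (?f s))" using elim(4) by blast
      then have "whittaker a s (?f s) = C s * (Gamma s * \<kappa> s) * whittaker a s (?f s)"
        using fe[OF elim(2) f] by (simp add: mult.assoc)
      then have "C s * (Gamma s * \<kappa> s) = 1" using elim(1) fW[of s] by simp
      moreover have "Y s * (Gamma s * \<kappa> s) = 1" using fe[OF elim(2) f] by blast
      ultimately have "C s = Y s" by (metis mult_cancel_right zero_neq_one mult_zero_right)
      then show ?case using elim(3) by simp
    qed
    then have "eventually (\<lambda>s. C s = remove_sings Y s) (at 0)"
      by (rule eventually_cosparse_imp_eventually_at) simp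
    then show "C = remove_sings Y"
      using C Yn by (intro nicely_meromorphic_unique[of C _ 0] eventually_frequently) auto
  qed
  then show ?thesis using rs by simp
qed

end
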